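(* Fix $\underline{\eta}\in\mathbb{S}$. Let $\Gamma$ be a Jordan surface in $\mathbb{R}^{p+1}\oplus\underline{\eta}\mathbb{R}\cong\mathbb{R}^{p+2}$ which partitions this space into an exterior domain $U_{\underline{\eta}}^-$ and an interior domain $U_{\underline{\eta}}^+$, oriented so that its normal vector points towards $U_{\underline{\eta}}^-$. Let $f$ be an $\mathbb{R}_{p+q}$-valued function that is left generalized partial-slice monogenic in $U_{\underline{\eta}}^-$, continuously differentiable in $U_{\underline{\eta}}^-\cup\Gamma$, and has a limit value $f(\infty)$ at $\boldsymbol{x}=\infty$. Then $$\int_{\Gamma}\mathcal{E}_{\boldsymbol{y}}(\boldsymbol{x})\,n(\boldsymbol{y})\,f(\boldsymbol{y})\,dS_{\underline{\eta}}(\boldsymbol{y})=\begin{cases}-f(\boldsymbol{x})+f(\infty), & \boldsymbol{x}\in U_{\underline{\eta}}^-,\\ f(\infty), & \boldsymbol{x}\in U_{\underline{\eta}}^+,\end{cases}$$ where $n(\boldsymbol{y})=\sum_{i=0}^p n_i(\boldsymbol{y})e_i+n_{p+1}(\boldsymbol{y})\underline{\eta}$ is the unit normal vector to $\Gamma$ at $\boldsymbol{y}$ pointing towards $U_{\underline{\eta}}^-$.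
   Context: Let $p\ge 0$ and $q\ge 1$ be integers. $\mathbb{R}_{p+q}$ is the real Clifford algebra generated by $e_1,\dots,e_{p+q}$ with $e_ie_j+e_je_i=-2\delta_{ij}$, and $e_0=1$. Clifford conjugation is the linear anti-involution with $\overline{e_0}=e_0$, $\overline{e_j}=-e_j$ for $1\le j\le p+q$. The norm of $a=\sum_A a_Ae_A$ is $|a|=(\sum_A a_A^2)^{1/2}$. A point of $\mathbb{R}^{p+q+1}=\mathbb{R}^{p+1}\oplus\mathbb{R}^q$ is identified with the paravector $\boldsymbol{x}=\boldsymbol{x}_p+\underline{\boldsymbol{x}}_q$, $\boldsymbol{x}_p=\sum_{i=0}^p x_ie_i$, $\underline{\boldsymbol{x}}_q=\sum_{i=p+1}^{p+q}x_ie_i$. $\mathbb{S}=\{\underline{\boldsymbol{x}}_q:\underline{\boldsymbol{x}}_q^2=-1\}$ is the unit sphere of $\mathbb{R}^q$. Write $\boldsymbol{x}=\boldsymbol{x}_p+r\underline{\omega}$ with $r=|\underline{\boldsymbol{x}}_q|\ge 0$ and $\underline{\omega}\in\mathbb{S}$ ($\underline{\omega}=\underline{\boldsymbol{x}}_q/|\underline{\boldsymbol{x}}_q|$ if $\underline{\boldsymbol{x}}_q\neq0$, arbitrary otherwise). For $\underline{\eta}\in\mathbb{S}$, the space $\mathbb{R}^{p+1}\oplus\underline{\eta}\mathbb{R}$ is identified with $\mathbb{R}^{p+2}$ via $\boldsymbol{x}_p+r\underline{\eta}\leftrightarrow(\boldsymbol{x}_p,r)$, $r\in\mathbb{R}$.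 A function on an open subset of this space is left generalized partial-slice monogenic there if it is $C^1$ and $\left(\sum_{i=0}^p e_i\partial_{x_i}+\underline{\eta}\,\partial_r\right)f(\boldsymbol{x}_p+r\underline{\eta})=0$. A Jordan surface is a compact hypersurface, regular enough to have a unit normal and surface measure, separating the space into a bounded (interior) domain and an unbounded (exterior) domain. $dS_{\underline{\eta}}$ is the surface measure on hypersurfaces of $\mathbb{R}^{p+1}\oplus\underline{\eta}\mathbb{R}$. The monogenic Cauchy kernel is $E(\boldsymbol{x})=\frac{1}{\sigma_{p+1}}\frac{\overline{\boldsymbol{x}}}{|\boldsymbol{x}|^{p+2}}$, where $\sigma_{p+1}=2\Gamma(\tfrac12)^{p+2}/\Gamma(\tfrac{p+2}{2})$ (here $\Gamma(\cdot)$ is the Gamma function) is the area of the unit sphere in $\mathbb{R}^{p+2}$, and $E_{\boldsymbol{y}}(\boldsymbol{x})=E(\boldsymbol{y}-\boldsymbol{x})$. For $\boldsymbol{y}\in\mathbb{R}^{p+1}\oplus\underline{\eta}\mathbb{R}$ and $\boldsymbol{x}=\boldsymbol{x}_p+r\underline{\omega}$, the left generalized partial-slice Cauchy kernel is $$\mathcal{E}_{\boldsymbol{y}}(\boldsymbol{x})=\tfrac12(1-\underline{\omega}\,\underline{\eta})E_{\boldsymbol{y}}(\boldsymbol{x}_p+r\underline{\eta})+\tfrac12(1+\underline{\omega}\,\underline{\eta})E_{\boldsymbol{y}}(\boldsymbol{x}_p-r\underline{\eta}).$$ *)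

theory Defs
  imports "HOL-Analysis.Analysis"
begin

section \<open>The real Clifford algebra with negative definite generators\<close>

text \<open>
  One generator for every element of the finite linear order \<open>'n\<close>.  An element
  \<open>a = (\<Sum>A. a\<^sub>A e\<^sub>A)\<close> is its family of coefficients, where \<open>e\<^sub>A\<close> is the product of the generators
  in \<open>A\<close> in increasing order.
\<close>

typedef (overloaded) 'n clifford = "UNIV :: ('n::finite set \<Rightarrow> real) set"
  morphisms cl_coeff Abs_clifford by simp

setup_lifting type_definition_clifford

lemma clifford_eqI: "(\<And>A. cl_coeff a A = cl_coeff b A) \<Longrightarrow> a = b"
  by transfer auto

instantiation clifford :: (finite) real_vector
begin
lift_definition zero_clifford :: "'a clifford" is "\<lambda>_. 0" .
lift_definition plus_clifford :: "'a clifford \<Rightarrow> 'a clifford \<Rightarrow> 'a clifford" is "\<lambda>a b A. a A + b A" .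
lift_definition minus_clifford :: "'a clifford \<Rightarrow> 'a clifford \<Rightarrow> 'a clifford" is "\<lambda>a b A. a A - b A" .
lift_definition uminus_clifford :: "'a clifford \<Rightarrow> 'a clifford" is "\<lambda>a A. - a A" .
lift_definition scaleR_clifford :: "real \<Rightarrow> 'a clifford \<Rightarrow> 'a clifford" is "\<lambda>c a A. c * a A" .
instance by standard (transfer; simp add: algebra_simps)+
end

lift_definition blade :: "'n::finite set \<Rightarrow> 'n clifford" is "\<lambda>A B. if B = A then 1 else 0" .

instantiation clifford :: (finite) euclidean_space
begin
definition inner_clifford :: "'a clifford \<Rightarrow> 'a clifford \<Rightarrow> real"
  where "inner_clifford a b = (\<Sum>A\<in>UNIV. cl_coeff a A * cl_coeff b A)"
definition norm_clifford :: "'a clifford \<Rightarrow> real"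
  where "norm_clifford a = sqrt (\<Sum>A\<in>UNIV. (cl_coeff a A)\<^sup>2)"
definition sgn_clifford :: "'a clifford \<Rightarrow> 'a clifford"
  where "sgn_clifford a = a /\<^sub>R norm a"
definition dist_clifford :: "'a clifford \<Rightarrow> 'a clifford \<Rightarrow> real"
  where "dist_clifford a b = norm (a - b)"
definition uniformity_clifford :: "('a clifford \<times> 'a clifford) filter"
  where "uniformity_clifford = (INF e\<in>{0 <..}. principal {(x, y). dist x y < e})"
definition open_clifford :: "'a clifford set \<Rightarrow> bool"
  where "open_clifford U = (\<forall>x\<in>U. \<forall>\<^sub>F (x', y) in uniformity. x' = x \<longrightarrow> y \<in> U)"
definition Basis_clifford :: "'a clifford set"
  where "Basis_clifford = range blade"
instance
proof
  fix x y z :: "'a clifford" and r :: real and u v :: "'a clifford" and U :: "'a clifford set"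
  show "sgn x = x /\<^sub>R norm x" by (rule sgn_clifford_def)
  show "dist x y = norm (x - y)" by (rule dist_clifford_def)
  show "uniformity = (INF e\<in>{0 <..}. principal {(x, y :: 'a clifford). dist x y < e})"
    by (rule uniformity_clifford_def)
  show "open U = (\<forall>x\<in>U. \<forall>\<^sub>F (x', y) in uniformity. x' = x \<longrightarrow> y \<in> U)"
    by (rule open_clifford_def)
  show "inner x y = inner y x" by (simp add: inner_clifford_def mult.commute)
  show "inner (x + y) z = inner x z + inner y z"
    by (simp add: inner_clifford_def plus_clifford.rep_eq distrib_right sum.distrib)
  show "inner (r *\<^sub>R x) y = r * inner x y"
    by (simp add: inner_clifford_def scaleR_clifford.rep_eq sum_distrib_left mult.assoc)
  show "0 \<le> inner x x" by (simp add: inner_clifford_def sum_nonneg)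
  show "inner x x = 0 \<longleftrightarrow> x = 0"
    by (auto simp: inner_clifford_def sum_nonneg_eq_0_iff zero_clifford.rep_eq intro: clifford_eqI)
  show "norm x = sqrt (inner x x)"
    by (simp add: inner_clifford_def norm_clifford_def power2_eq_square)
  have inner_blade: "inner x (blade A) = cl_coeff x A" for x :: "'a clifford" and A
    by (simp add: inner_clifford_def blade.rep_eq if_distrib cong: if_cong)
  show "(Basis :: 'a clifford set) \<noteq> {}" by (simp add: Basis_clifford_def)
  show "finite (Basis :: 'a clifford set)" by (simp add: Basis_clifford_def)
  show "inner u v = (if u = v then 1 else 0)" if "u \<in> Basis" "v \<in> Basis"
    using that by (auto simp: Basis_clifford_def inner_blade blade.rep_eq)
  show "(\<forall>u\<in>Basis. inner x u = 0) \<longleftrightarrow> x = 0"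
    by (auto simp: Basis_clifford_def inner_blade zero_clifford.rep_eq intro: clifford_eqI)
qed
end

text \<open>
  The sign in \<open>e\<^sub>A e\<^sub>B = \<plusminus> e\<^bsub>A \<triangle> B\<^esub>\<close>: moving \<open>e\<^sub>b\<close> to the left past \<open>e\<^sub>a\<close> costs one sign for \<open>b < a\<close>,
  and each common generator contributes \<open>e\<^sub>a\<^sup>2 = -1\<close>.
\<close>

definition blade_sign :: "'n::{finite,linorder} set \<Rightarrow> 'n set \<Rightarrow> real" where
  "blade_sign A B = (\<Prod>a\<in>A. \<Prod>b\<in>B. if b \<le> a then -1 else 1)"

lemma prod_sym_diff:
  fixes g :: "'n::finite \<Rightarrow> real"
  assumes "\<And>x. g x * g x = 1"
  shows "prod g (sym_diff A B) = prod g A * prod g B"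
proof -
  have A: "prod g A = prod g (A - B) * prod g (A \<inter> B)"
    by (metis finite prod.Int_Diff mult.commute)
  have B: "prod g B = prod g (B - A) * prod g (A \<inter> B)"
    by (metis finite prod.Int_Diff mult.commute inf_commute)
  have "prod g (A \<inter> B) * prod g (A \<inter> B) = 1"
    by (simp add: assms flip: prod.distrib)
  then have "prod g A * prod g B = prod g (A - B) * prod g (B - A)"
    unfolding A B by (metis (no_types, opaque_lifting) mult.assoc mult.commute mult_1)
  also have "\<dots> = prod g (sym_diff A B)"
    by (intro prod.union_disjoint [symmetric]) auto
  finally show ?thesis by simp
qed

lemma blade_sign_square [simp]: "blade_sign A B * blade_sign A B = 1"
  by (auto simp: blade_sign_def simp flip: prod.distrib intro!: prod.neutral)

lemma blade_sign_sym_diff_left: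
  "blade_sign (sym_diff A B) C = blade_sign A C * blade_sign B C"
  unfolding blade_sign_def by (intro prod_sym_diff) (auto simp flip: prod.distrib intro!: prod.neutral)

lemma blade_sign_sym_diff_right:
  "blade_sign C (sym_diff A B) = blade_sign C A * blade_sign C B"
  unfolding blade_sign_def prod.distrib [symmetric] by (intro prod.cong refl prod_sym_diff) auto

lemma blade_sign_empty [simp]: "blade_sign {} B = 1" "blade_sign A {} = 1"
  by (simp_all add: blade_sign_def)

lemma sym_diff_eq_iff: "sym_diff A B = C \<longleftrightarrow> B = sym_diff A C"
  by blast

lemma sym_diff_eq_iff': "sym_diff A B = C \<longleftrightarrow> A = sym_diff C B"
  by blast

instantiation clifford :: ("{finite,linorder}") real_algebra_1
begin
definition one_clifford :: "'a clifford" where "one_clifford = blade {}"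
lift_definition times_clifford :: "'a clifford \<Rightarrow> 'a clifford \<Rightarrow> 'a clifford" is
  "\<lambda>a b C. \<Sum>A\<in>UNIV. \<Sum>B\<in>UNIV. if sym_diff A B = C then blade_sign A B * a A * b B else 0" .
instance
proof
  fix a b c :: "'a clifford" and r :: real
  have T: "cl_coeff (a * b) C = (\<Sum>A\<in>UNIV. blade_sign A (sym_diff A C) * cl_coeff a A * cl_coeff b (sym_diff A C))"
    for a b :: "'a clifford" and C
    by (simp add: times_clifford.rep_eq sym_diff_eq_iff)
  have T': "cl_coeff (a * b) C = (\<Sum>B\<in>UNIV. blade_sign (sym_diff C B) B * cl_coeff a (sym_diff C B) * cl_coeff b B)"
    for a b :: "'a clifford" and C
    unfolding times_clifford.rep_eq by (subst sum.swap) (simp add: sym_diff_eq_iff')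
  show "a * b * c = a * (b * c)"
  proof (rule clifford_eqI)
    fix D
    have "cl_coeff (a * b * c) D = (\<Sum>C\<in>UNIV. \<Sum>A\<in>UNIV. blade_sign (sym_diff D C) C *
        (blade_sign A (sym_diff A (sym_diff D C)) * cl_coeff a A * cl_coeff b (sym_diff A (sym_diff D C))) * cl_coeff c C)"
      by (simp only: T' [of "a * b" c] T [of a b] sum_distrib_left sum_distrib_right)
    also have "\<dots> = (\<Sum>A\<in>UNIV. \<Sum>C\<in>UNIV. blade_sign (sym_diff D C) C *
        (blade_sign A (sym_diff A (sym_diff D C)) * cl_coeff a A * cl_coeff b (sym_diff A (sym_diff D C))) * cl_coeff c C)"
      by (rule sum.swap)
    also have "\<dots> = (\<Sum>A\<in>UNIV. \<Sum>C\<in>UNIV. blade_sign A (sym_diff A D) * cl_coeff a A *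
        (blade_sign (sym_diff (sym_diff A D) C) C * cl_coeff b (sym_diff (sym_diff A D) C) * cl_coeff c C))"
    proof (intro sum.cong refl)
      fix A C
      have e: "sym_diff A (sym_diff D C) = sym_diff (sym_diff A D) C" by blast
      have f: "blade_sign A C * blade_sign A C * x = x" for x by simp
      show "blade_sign (sym_diff D C) C *
        (blade_sign A (sym_diff A (sym_diff D C)) * cl_coeff a A * cl_coeff b (sym_diff A (sym_diff D C))) * cl_coeff c C
        = blade_sign A (sym_diff A D) * cl_coeff a A *
        (blade_sign (sym_diff (sym_diff A D) C) C * cl_coeff b (sym_diff (sym_diff A D) C) * cl_coeff c C)"
        unfolding e blade_sign_sym_diff_left blade_sign_sym_diff_right by (simp add: ac_simps)
    qed
    also have "\<dots> = cl_coeff (a * (b * c)) D"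
      by (simp only: T [of a "b * c"] T' [of b c] sum_distrib_left sum_distrib_right)
    finally show "cl_coeff (a * b * c) D = cl_coeff (a * (b * c)) D" .
  qed
  show "(a + b) * c = a * c + b * c"
    by (rule clifford_eqI) (simp add: T plus_clifford.rep_eq algebra_simps sum.distrib)
  show "a * (b + c) = a * b + a * c"
    by (rule clifford_eqI) (simp add: T plus_clifford.rep_eq algebra_simps sum.distrib)
  show "r *\<^sub>R a * b = r *\<^sub>R (a * b)"
    by (rule clifford_eqI) (simp add: T scaleR_clifford.rep_eq sum_distrib_left ac_simps)
  show "a * r *\<^sub>R b = r *\<^sub>R (a * b)"
    by (rule clifford_eqI) (simp add: T scaleR_clifford.rep_eq sum_distrib_left ac_simps)
  show "1 * a = a"
    by (rule clifford_eqI)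
      (simp add: T one_clifford_def blade.rep_eq if_distrib if_distribR cong: if_cong)
  show "a * 1 = a"
    by (rule clifford_eqI)
      (simp add: T' one_clifford_def blade.rep_eq if_distrib if_distribR cong: if_cong)
  have "cl_coeff (0::'a clifford) {} \<noteq> cl_coeff 1 {}"
    by (simp add: one_clifford_def blade.rep_eq zero_clifford.rep_eq)
  then show "(0::'a clifford) \<noteq> 1" by metis
qed
end

lemma blade_times_blade: "blade A * blade B = blade_sign A B *\<^sub>R blade (sym_diff A B)"
proof (rule clifford_eqI)
  fix C
  have "cl_coeff (blade A * blade B) C = (\<Sum>A'\<in>UNIV. if A' = A then
      \<Sum>B'\<in>UNIV. if B' = B then (if sym_diff A B = C then blade_sign A B else 0) else 0 else 0)"
    unfolding times_clifford.rep_eq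
  proof (intro sum.cong refl)
    fix A'
    show "(\<Sum>B'\<in>UNIV. if sym_diff A' B' = C
        then blade_sign A' B' * cl_coeff (blade A) A' * cl_coeff (blade B) B' else 0) =
      (if A' = A then \<Sum>B'\<in>UNIV. if B' = B then
         (if sym_diff A B = C then blade_sign A B else 0) else 0 else 0)"
    proof (cases "A' = A")
      case True
      have "(\<Sum>B'\<in>UNIV. if sym_diff A B' = C
          then blade_sign A B' * cl_coeff (blade A) A * cl_coeff (blade B) B' else 0) =
        (\<Sum>B'\<in>UNIV. if B' = B then (if sym_diff A B = C then blade_sign A B else 0) else 0)"
      proof (rule sum.cong [OF refl])
        fix B'
        show "(if sym_diff A B' = C
          then blade_sign A B' * cl_coeff (blade A) A * cl_coeff (blade B) B' else 0) =
          (if B' = B then (if sym_diff A B = C then blade_sign A B else 0) else 0)"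
          by (cases "B' = B") (simp_all add: blade.rep_eq)
      qed
      then show ?thesis unfolding True by (simp only: simp_thms if_True)
    qed (simp add: blade.rep_eq cong: if_cong)
  qed
  then show "cl_coeff (blade A * blade B) C = cl_coeff (blade_sign A B *\<^sub>R blade (sym_diff A B)) C"
    by (simp add: scaleR_clifford.rep_eq blade.rep_eq eq_commute [of C])
qed

text \<open>\<open>cl_e 0 = 1\<close>, and \<open>cl_e 1, \<dots>, cl_e CARD('n)\<close> are the generators, in increasing order.\<close>

definition cl_e :: "nat \<Rightarrow> 'n::{finite,linorder} clifford" where
  "cl_e k = (if k = 0 then 1 else blade {sorted_list_of_set UNIV ! (k - 1)})"

lemma cl_e_anticommute:
  assumes "i \<in> {1..CARD('n::{finite,linorder})}" "j \<in> {1..CARD('n)}"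
  shows "cl_e i * cl_e j + cl_e j * cl_e i = (if i = j then - 2 else 0 :: 'n clifford)"
proof -
  define l where "l = sorted_list_of_set (UNIV :: 'n set)"
  have len: "distinct l" "length l = CARD('n)"
    by (simp_all add: l_def)
  have ij: "l ! (i - 1) = l ! (j - 1) \<longleftrightarrow> i = j"
    using assms nth_eq_iff_index_eq [OF len(1), of "i - 1" "j - 1"] len(2)
    by (metis (no_types, lifting) atLeastAtMost_iff diff_less eq_diff_iff less_le_trans
        le_imp_less_Suc less_Suc_eq_le not_less zero_less_one One_nat_def Suc_diff_le diff_Suc_Suc minus_nat.diff_0)
  have e: "cl_e k = blade {l ! (k - 1)}" if "k \<ge> 1" for k
    using that by (simp add: cl_e_def l_def)
  have "blade {a} * blade {b} + blade {b} * blade {a} = (if a = b then - 2 else 0)" for a b :: 'n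
  proof (cases "a = b")
    case True
    then show ?thesis
      by (simp add: blade_times_blade blade_sign_def flip: one_clifford_def)
  next
    case False
    then have "sym_diff {a} {b} = {a, b}" "sym_diff {b} {a} = {a, b}" by auto
    then show ?thesis
      using False by (auto simp: blade_times_blade blade_sign_def)
  qed
  from this [of "l ! (i - 1)" "l ! (j - 1)"] show ?thesis
    using assms by (simp add: e ij del: One_nat_def)
qed

text \<open>Conjugation reverses the factors of \<open>e\<^sub>A\<close> and negates each of them.\<close>

lift_definition clifford_cnj :: "'n::{finite,linorder} clifford \<Rightarrow> 'n clifford" is
  "\<lambda>a A. (-1) ^ (card A * (card A + 1) div 2) * a A" .

lemma blade_sign_self:
  "blade_sign A A = (-1) ^ (card A * (card A + 1) div 2)" for A :: "'n::{finite,linorder} set"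
using finite [of A]
proof (induction A rule: finite_linorder_max_induct)
  case (insert m A)
  have m: "m \<notin> A" using insert.hyps(2) by auto
  have "{m} \<union> A = sym_diff {m} A" using m by auto
  then have "blade_sign (insert m A) (insert m A) =
      blade_sign {m} {m} * blade_sign {m} A * (blade_sign A {m} * blade_sign A A)"
    by (simp only: insert_is_Un [of m A] blade_sign_sym_diff_left blade_sign_sym_diff_right) (simp add: ac_simps)
  also have "blade_sign {m} {m} = -1" by (simp add: blade_sign_def)
  also have "blade_sign A {m} = 1"
    unfolding blade_sign_def using insert.hyps(2) by (auto intro!: prod.neutral simp: not_le)
  also have "blade_sign {m} A = (\<Prod>b\<in>A. -1)"
  proof -
    have "(\<Prod>b\<in>A. if b \<le> m then -1 else (1::real)) = (\<Prod>b\<in>A. -1)"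
      using insert.hyps(2) by (intro prod.cong refl) auto
    then show ?thesis by (simp add: blade_sign_def)
  qed
  finally have *: "blade_sign (insert m A) (insert m A) = (-1) ^ (card A + 1) * blade_sign A A" by simp
  have "card (insert m A) * (card (insert m A) + 1) div 2 = (card A + 1) + card A * (card A + 1) div 2"
    using m by simp
  then show ?case
    unfolding * insert.IH by (simp add: power_add)
qed simp

lemma clifford_cnj_mult: "clifford_cnj (a * b) = clifford_cnj b * clifford_cnj a"
proof (rule clifford_eqI)
  fix C
  have "cl_coeff (clifford_cnj (a * b)) C = (\<Sum>A\<in>UNIV. \<Sum>B\<in>UNIV. if sym_diff A B = C
      then blade_sign C C * (blade_sign A B * cl_coeff a A * cl_coeff b B) else 0)"
    unfolding clifford_cnj.rep_eq times_clifford.rep_eq blade_sign_self [symmetric] sum_distrib_left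
    by (intro sum.cong refl) simp
  also have "\<dots> = (\<Sum>A\<in>UNIV. \<Sum>B\<in>UNIV. if sym_diff B A = C
      then blade_sign B A * cl_coeff (clifford_cnj b) B * cl_coeff (clifford_cnj a) A else 0)"
  proof (intro sum.cong refl)
    fix A B :: "'a set"
    have c: "sym_diff B A = sym_diff A B" by blast
    have f: "blade_sign A B * (blade_sign A B * x) = x" for x
      by (metis blade_sign_square mult.assoc mult_1)
    show "(if sym_diff A B = C then blade_sign C C * (blade_sign A B * cl_coeff a A * cl_coeff b B) else 0)
      = (if sym_diff B A = C then blade_sign B A * cl_coeff (clifford_cnj b) B * cl_coeff (clifford_cnj a) A else 0)"
      unfolding c clifford_cnj.rep_eq blade_sign_self [symmetric]
      by (auto simp: blade_sign_sym_diff_left blade_sign_sym_diff_right ac_simps f)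
  qed
  also have "\<dots> = cl_coeff (clifford_cnj b * clifford_cnj a) C"
    unfolding times_clifford.rep_eq by (rule sum.swap)
  finally show "cl_coeff (clifford_cnj (a * b)) C = cl_coeff (clifford_cnj b * clifford_cnj a) C" .
qed

lemma clifford_cnj_cl_e: "clifford_cnj (cl_e k) = (if k = 0 then cl_e k else - cl_e k)"
  by (rule clifford_eqI)
    (simp add: clifford_cnj.rep_eq cl_e_def one_clifford_def blade.rep_eq uminus_clifford.rep_eq)


section \<open>Hypersurfaces and surface measure\<close>

text \<open>
  On a relatively open subset of a subspace \<open>V\<close> this is the usual notion on \<open>V\<close>: the derivative is
  then only determined on \<open>V\<close>, but it extends to the whole space by composition with the projection.
  On a domain together with its boundary it is continuous differentiability up to the boundary.
\<close>

definition C1_on :: "'a::real_normed_vector set \<Rightarrow> ('a \<Rightarrow> 'b::real_normed_vector) \<Rightarrow> bool" where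
  "C1_on S f \<longleftrightarrow> (\<exists>f' :: 'a \<Rightarrow> 'a \<Rightarrow>\<^sub>L 'b.
     continuous_on S f' \<and> (\<forall>x\<in>S. (f has_derivative blinfun_apply (f' x)) (at x within S)))"

definition surface_patch ::
  "'a::euclidean_space set \<Rightarrow> (real^'m::finite) set \<Rightarrow> (real^'m \<Rightarrow> 'a) \<Rightarrow> bool" where
  "surface_patch \<Gamma> D \<phi> \<longleftrightarrow>
     open D \<and> openin (top_of_set \<Gamma>) (\<phi> ` D) \<and> (\<exists>\<psi>. homeomorphism D (\<phi> ` D) \<phi> \<psi>) \<and>
     C1_on D \<phi> \<and> (\<forall>t\<in>D. inj (frechet_derivative \<phi> (at t)))"

definition C1_surface :: "'m::finite itself \<Rightarrow> 'a::euclidean_space set \<Rightarrow> bool" where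
  "C1_surface _ \<Gamma> \<longleftrightarrow> (\<forall>y\<in>\<Gamma>. \<exists>(D :: (real^'m) set) \<phi>. surface_patch \<Gamma> D \<phi> \<and> y \<in> \<phi> ` D)"

definition area_element :: "(real^'m::finite \<Rightarrow> 'a::euclidean_space) \<Rightarrow> real^'m \<Rightarrow> real" where
  "area_element \<phi> t = sqrt (det (\<chi> i j.
     frechet_derivative \<phi> (at t) (axis i 1) \<bullet> frechet_derivative \<phi> (at t) (axis j 1)))"

text \<open>
  The Borel measure on the ambient space that is carried by \<open>\<Gamma>\<close> and is given in every patch by the
  area element.  A compact \<open>C\<^sup>1\<close> surface is covered by finitely many patches, so there is exactly one.
\<close>

definition is_surface_measure ::
  "'m::finite itself \<Rightarrow> 'a::euclidean_space set \<Rightarrow> 'a measure \<Rightarrow> bool" where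
  "is_surface_measure _ \<Gamma> \<mu> \<longleftrightarrow>
     sets \<mu> = sets borel \<and> emeasure \<mu> (- \<Gamma>) = 0 \<and>
     (\<forall>(D :: (real^'m) set) \<phi> B. surface_patch \<Gamma> D \<phi> \<longrightarrow> B \<in> sets borel \<longrightarrow> B \<subseteq> D \<longrightarrow>
        emeasure \<mu> (\<phi> ` B) = (\<integral>\<^sup>+t\<in>B. ennreal (area_element \<phi> t) \<partial>lborel))"

definition surface_measure :: "'m::finite itself \<Rightarrow> 'a::euclidean_space set \<Rightarrow> 'a measure" where
  "surface_measure T \<Gamma> = (THE \<mu>. is_surface_measure T \<Gamma> \<mu>)"

definition tangent_vectors :: "'a::euclidean_space set \<Rightarrow> 'a \<Rightarrow> 'a set" where
  "tangent_vectors \<Gamma> y = {v. \<exists>\<gamma> \<epsilon>. \<epsilon> > 0 \<and> (\<forall>t. \<bar>t\<bar> < \<epsilon> \<longrightarrow> \<gamma> t \<in> \<Gamma>) \<and> \<gamma> 0 = y \<and>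
     (\<gamma> has_vector_derivative v) (at (0::real))}"

definition unit_normal_towards ::
  "'a::euclidean_space set \<Rightarrow> 'a set \<Rightarrow> 'a set \<Rightarrow> 'a \<Rightarrow> 'a \<Rightarrow> bool" where
  "unit_normal_towards V \<Gamma> U y \<nu> \<longleftrightarrow>
     \<nu> \<in> V \<and> norm \<nu> = 1 \<and> (\<forall>v\<in>tangent_vectors \<Gamma> y. \<nu> \<bullet> v = 0) \<and>
     (\<exists>\<epsilon>>0. \<forall>t. 0 < t \<and> t < \<epsilon> \<longrightarrow> y + t *\<^sub>R \<nu> \<in> U)"

text \<open>
  \<open>Up\<close> is the interior and \<open>Um\<close> the exterior domain of \<open>\<Gamma>\<close> in the subspace \<open>V\<close>; the closure
  conditions express that \<open>\<Gamma>\<close> separates them, i.e. is their common boundary.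
\<close>

definition jordan_surface ::
  "'m::finite itself \<Rightarrow> 'a::euclidean_space set \<Rightarrow> 'a set \<Rightarrow> 'a set \<Rightarrow> 'a set \<Rightarrow> bool" where
  "jordan_surface T V \<Gamma> Up Um \<longleftrightarrow>
     \<Gamma> \<subseteq> V \<and> compact \<Gamma> \<and> C1_surface T \<Gamma> \<and>
     Up \<inter> Um = {} \<and> Up \<union> Um = V - \<Gamma> \<and>
     openin (top_of_set V) Up \<and> connected Up \<and> Up \<noteq> {} \<and> bounded Up \<and>
     openin (top_of_set V) Um \<and> connected Um \<and> Um \<noteq> {} \<and> \<not> bounded Um \<and>
     \<Gamma> \<subseteq> closure Up \<and> \<Gamma> \<subseteq> closure Um"


section \<open>Generalized partial-slice monogenic functions\<close>

definition unit_sphere :: "nat \<Rightarrow> nat \<Rightarrow> 'n::{finite,linorder} clifford set" where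
  "unit_sphere p q = {x \<in> span (cl_e ` {p + 1..p + q}). x * x = - 1}"

definition slice :: "nat \<Rightarrow> 'n::{finite,linorder} clifford \<Rightarrow> 'n clifford set" where
  "slice p \<eta> = {xp + r *\<^sub>R \<eta> | xp r. xp \<in> span (cl_e ` {0..p})}"

definition partial_deriv ::
  "('a::real_normed_vector \<Rightarrow> 'b::real_normed_vector) \<Rightarrow> 'a \<Rightarrow> 'a \<Rightarrow> 'b" where
  "partial_deriv f v x = vector_derivative (\<lambda>t. f (x + t *\<^sub>R v)) (at 0)"

text \<open>In the coordinates \<open>(x\<^sub>0, \<dots>, x\<^sub>p, r)\<close> of \<open>slice p \<eta>\<close>, \<open>\<partial>\<^sub>r\<close> is the derivative in direction \<open>\<eta>\<close>.\<close>

definition gps_monogenic_on ::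
  "nat \<Rightarrow> 'n::{finite,linorder} clifford \<Rightarrow> 'n clifford set \<Rightarrow> ('n clifford \<Rightarrow> 'n clifford) \<Rightarrow> bool" where
  "gps_monogenic_on p \<eta> U f \<longleftrightarrow>
     openin (top_of_set (slice p \<eta>)) U \<and> C1_on U f \<and>
     (\<forall>x\<in>U. (\<Sum>i=0..p. cl_e i * partial_deriv f (cl_e i) x) + \<eta> * partial_deriv f \<eta> x = 0)"

definition sphere_area :: "nat \<Rightarrow> real" where
  "sphere_area p = 2 * Gamma (1/2) ^ (p + 2) / Gamma (real (p + 2) / 2)"

definition cauchy_E :: "nat \<Rightarrow> 'n::{finite,linorder} clifford \<Rightarrow> 'n clifford" where
  "cauchy_E p x = (1 / sphere_area p) *\<^sub>R (clifford_cnj x /\<^sub>R norm x ^ (p + 2))"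

definition para_part :: "nat \<Rightarrow> 'n::{finite,linorder} clifford \<Rightarrow> 'n clifford" where
  "para_part p x = (\<Sum>i=0..p. (x \<bullet> cl_e i) *\<^sub>R cl_e i)"

definition vec_part :: "nat \<Rightarrow> nat \<Rightarrow> 'n::{finite,linorder} clifford \<Rightarrow> 'n clifford" where
  "vec_part p q x = (\<Sum>i=p+1..p+q. (x \<bullet> cl_e i) *\<^sub>R cl_e i)"

text \<open>For \<open>vec_part p q x = 0\<close> the direction is an arbitrary element of the sphere.\<close>

definition direction :: "nat \<Rightarrow> nat \<Rightarrow> 'n::{finite,linorder} clifford \<Rightarrow> 'n clifford" where
  "direction p q x =
     (if vec_part p q x = 0 then SOME \<omega>. \<omega> \<in> unit_sphere p q else vec_part p q x /\<^sub>R norm (vec_part p q x))"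

definition gps_kernel ::
  "nat \<Rightarrow> nat \<Rightarrow> 'n::{finite,linorder} clifford \<Rightarrow> 'n clifford \<Rightarrow> 'n clifford \<Rightarrow> 'n clifford" where
  "gps_kernel p q \<eta> y x =
     (let xp = para_part p x; r = norm (vec_part p q x); \<omega> = direction p q x in
        (1/2) *\<^sub>R ((1 - \<omega> * \<eta>) * cauchy_E p (y - (xp + r *\<^sub>R \<eta>))) +
        (1/2) *\<^sub>R ((1 + \<omega> * \<eta>) * cauchy_E p (y - (xp - r *\<^sub>R \<eta>))))"

end

theory Submission
  imports Defs "HOL-Combinatorics.Permutations"
begin

text \<open>
  On the slice through \<open>\<eta>\<close> the partial-slice kernel reduces to the monogenic Cauchy kernel, so the
  statement is the exterior Cauchy formula in \<open>p + 2\<close> real variables.  Multiply the Cauchy kernel at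
  \<open>x\<close> by a cutoff that depends on \<open>|y - x|\<^bsup>p + 2\<^esup>\<close>, vanishes near \<open>x\<close> and near infinity and is \<open>1\<close> on \<open>\<Gamma>\<close>.  As
  kernel and function are monogenic, the divergence theorem on the exterior domain expresses the boundary
  integral by averages of \<open>f\<close> over a small shell around \<open>x\<close> and over a large shell; these tend to
  \<open>f x\<close> (or \<open>0\<close>) and to \<open>f(\<infinity>)\<close>.

  The divergence theorem only has to be proved for one direction \<open>v\<close> at a time.  Near a boundary point
  with parametrization \<open>\<phi>\<close> and for transversal \<open>v\<close>, the map \<open>(t, s) \<mapsto> \<phi> t + s v\<close> straightens the boundary, and
  its Jacobian is the area element times the \<open>v\<close>-component of the normal.  Every direction is a difference
  of two transversal ones.
\<close>

section \<open>Change of variables over an arbitrary finite index type\<close>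

text \<open>The difficulty is low regularity: \<Gamma> is only \<open>C1\<close>, \<open>n\<close>
  is prescribed pointwise without any continuity, and \<open>f\<close> is controlled only on
  \<open>Um \<union> \<Gamma>\<close>. Moving along a fixed vector \<open>v\<close> instead of along
  \<open>n\<close> keeps the straightening map \<open>C1\<close>, uses \<open>f\<close> on the
  exterior side alone, and expresses the normal component as a quotient of a Jacobian by an area
  element.

  The exponent \<open>p + 2\<close> is the dimension of the slice. Lebesgue measure pushed forward
  by this power of the norm has constant density, so all shells have the same mass whatever their
  radius, and no integration in polar coordinates occurs. That mass is the volume of the unit ball;
  times \<open>p + 2\<close> it is \<open>sphere_area p\<close>, the normalisation of the kernel.
  Since \<open>f\<close> only tends to a constant, the flux through large spheres does not vanish,
  which is why an outer cutoff takes the place of a decay estimate.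

  The surface measure is a definite description, so existence and uniqueness have to precede every
  integral over \<Gamma>.\<close>

definition extend_matrix :: "('a::finite \<Rightarrow> 'b::finite) \<Rightarrow> real^'a^'a \<Rightarrow> real^'b^'b" where
  "extend_matrix \<sigma> A = (\<chi> i j. if i \<in> range \<sigma> \<and> j \<in> range \<sigma>
     then A $ inv \<sigma> i $ inv \<sigma> j else if i = j then 1 else 0)"

text \<open>In the Leibniz sum only permutations that fix every index outside
  \<open>range \<sigma>\<close> survive, and \<open>map_permutation\<close> matches them, sign
  included, with the permutations of the small index type. There are two uses: renaming the indices
  in the change of variables, and, with \<open>\<sigma> = Some\<close>, bordering a Gram matrix by a
  unit normal.\<close>

lemma det_extend_matrix:
  fixes A :: "real^'a^'a" and \<sigma> :: "'a::finite \<Rightarrow> 'b::finite"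
  assumes "inj \<sigma>"
  shows "det (extend_matrix \<sigma> A) = det A"
proof -
  let ?E = "extend_matrix \<sigma> A" and ?m = "map_permutation UNIV \<sigma>"
  have inv: "inv \<sigma> (\<sigma> x) = x" for x
    using assms by simp
  have m_apply: "?m p (\<sigma> x) = \<sigma> (p x)" for p x
    by (simp add: map_permutation_def restrict_id_def inv)
  have m_outside: "?m p y = y" if "y \<notin> range \<sigma>" for p y
    using that by (simp add: map_permutation_def restrict_id_def)
  have m_permutes: "?m p permutes range \<sigma>" if "p permutes UNIV" for p
    using that assms by (intro map_permutation_permutes) (auto simp: bij_betw_def)
  have inj_m: "inj_on ?m {p. p permutes UNIV}"
  proof (rule inj_onI)
    fix p q assume "?m p = ?m q"
    then have "\<sigma> (p x) = \<sigma> (q x)" for x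
      by (metis m_apply)
    then show "p = q"
      using assms by (auto simp: inj_def)
  qed
  have image_m: "?m ` {p. p permutes UNIV} = {p. p permutes range \<sigma>}"
  proof (intro equalityI subsetI)
    fix r assume "r \<in> {p. p permutes range \<sigma>}"
    then have r: "r permutes range \<sigma>" by simp
    define p where "p = (\<lambda>x. inv \<sigma> (r (\<sigma> x)))"
    have \<sigma>p: "\<sigma> (p x) = r (\<sigma> x)" for x
      using permutes_in_image [OF r, of "\<sigma> x"] by (simp add: p_def f_inv_into_f)
    have "inj p"
      using permutes_inj [OF r] assms by (metis \<sigma>p injD injI)
    then have "p permutes UNIV"
      using finite_UNIV_inj_surj [OF finite_class.finite_UNIV \<open>inj p\<close>] by (intro bij_imp_permutes) (simp_all add: bij_def)
    moreover have "?m p = r"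
    proof
      fix y show "?m p y = r y"
        using permutes_not_in [OF r] m_outside by (cases "y \<in> range \<sigma>") (auto simp: m_apply \<sigma>p)
    qed
    ultimately show "r \<in> ?m ` {p. p permutes UNIV}" by blast
  qed (use m_permutes in blast)
  have "det ?E = (\<Sum>r\<in>{r. r permutes range \<sigma>}. of_int (sign r) * (\<Prod>i\<in>UNIV. ?E $ i $ r i))"
    unfolding det_def
  proof (rule sum.mono_neutral_right)
    show "\<forall>r\<in>{r. r permutes UNIV} - {r. r permutes range \<sigma>}. of_int (sign r) * (\<Prod>i\<in>UNIV. ?E $ i $ r i) = 0"
    proof
      fix r assume r: "r \<in> {r. r permutes UNIV} - {r. r permutes range \<sigma>}"
      then obtain i where "i \<notin> range \<sigma>" "r i \<noteq> i"
        using permutes_superset [of r UNIV "range \<sigma>"] by auto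
      then have "?E $ i $ r i = 0"
        by (auto simp: extend_matrix_def)
      then show "of_int (sign r) * (\<Prod>i\<in>UNIV. ?E $ i $ r i) = 0"
        by (metis UNIV_I finite mult_zero_right prod_zero)
    qed
  qed (auto simp: finite_permutations intro: permutes_subset)
  also have "\<dots> = (\<Sum>p\<in>{p. p permutes UNIV}. of_int (sign (?m p)) * (\<Prod>i\<in>UNIV. ?E $ i $ ?m p i))"
    unfolding image_m [symmetric] by (rule sum.reindex [OF inj_m, unfolded o_def])
  also have "\<dots> = det A"
    unfolding det_def
  proof (rule sum.cong [OF refl])
    fix p :: "'a \<Rightarrow> 'a" assume "p \<in> {p. p permutes UNIV}"
    then have "sign (?m p) = sign p"
      using assms by (intro sign_map_permutation) auto
    moreover have "(\<Prod>i\<in>UNIV. ?E $ i $ ?m p i) = (\<Prod>i\<in>range \<sigma>. ?E $ i $ ?m p i)"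
      by (rule prod.mono_neutral_right) (auto simp: extend_matrix_def m_outside)
    moreover have "\<dots> = (\<Prod>i\<in>UNIV. A $ i $ p i)"
      by (subst prod.reindex [OF assms]) (simp add: m_apply extend_matrix_def inv)
    ultimately show "of_int (sign (?m p)) * (\<Prod>i\<in>UNIV. ?E $ i $ ?m p i) = of_int (sign p) * (\<Prod>i\<in>UNIV. A $ i $ p i)"
      by simp
  qed
  finally show ?thesis .
qed

text \<open>
  The change of variables theorem of the library is restricted to well-ordered index types; a copy of
  the index type with an arbitrary well-order removes this restriction.
\<close>

typedef 'k windex = "UNIV :: 'k::finite set" by simp

definition windex_num :: "'k::finite windex \<Rightarrow> nat" where
  "windex_num = (SOME f. inj f)"

lemma inj_Rep_windex: "inj Rep_windex"
  by (rule injI) (simp add: Rep_windex_inject)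

instance windex :: (finite) finite
proof
  have "finite (Rep_windex ` (UNIV :: 'a windex set))" by simp
  then show "finite (UNIV :: 'a windex set)"
    using inj_Rep_windex by (rule finite_imageD)
qed

lemma inj_windex_num: "inj (windex_num :: 'a::finite windex \<Rightarrow> nat)"
proof -
  obtain f :: "'a windex \<Rightarrow> nat" where "inj f"
    using finite_imp_inj_to_nat_seg [of "UNIV :: 'a windex set"] by auto
  then show ?thesis
    unfolding windex_num_def by (rule someI [of inj])
qed

instantiation windex :: (finite) wellorder
begin
definition less_eq_windex :: "'a windex \<Rightarrow> 'a windex \<Rightarrow> bool"
  where "less_eq_windex a b \<longleftrightarrow> windex_num a \<le> windex_num b"
definition less_windex :: "'a windex \<Rightarrow> 'a windex \<Rightarrow> bool"
  where "less_windex a b \<longleftrightarrow> windex_num a < windex_num b"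
instance
proof
  fix P :: "'a windex \<Rightarrow> bool" and a
  assume step: "\<And>x. (\<And>y. y < x \<Longrightarrow> P y) \<Longrightarrow> P x"
  show "P a"
    by (induction a rule: measure_induct [of windex_num]) (auto simp: less_windex_def intro: step)
qed (auto simp: less_eq_windex_def less_windex_def dest: injD [OF inj_windex_num])
end

section \<open>Lebesgue measure under a renaming of coordinates\<close>

definition reindex :: "('b \<Rightarrow> 'a) \<Rightarrow> real^'a \<Rightarrow> real^'b" where
  "reindex \<sigma> x = (\<chi> j. x $ \<sigma> j)"

lemma reindex_nth [simp]: "reindex \<sigma> x $ j = x $ \<sigma> j"
  by (simp add: reindex_def)

lemma linear_reindex: "linear (reindex \<sigma> :: real^'a::finite \<Rightarrow> real^'b::finite)"
  by (rule linearI) (auto simp: vec_eq_iff)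

lemma reindex_inv [simp]:
  assumes "bij \<sigma>"
  shows "reindex \<sigma> (reindex (inv \<sigma>) x) = x" "reindex (inv \<sigma>) (reindex \<sigma> y) = y"
  using assms by (simp_all add: vec_eq_iff bij_is_inj bij_is_surj surj_f_inv_f)

lemma continuous_on_reindex [continuous_intros]:
  "continuous_on S (reindex \<sigma> :: real^'a::finite \<Rightarrow> real^'b::finite)"
  by (simp add: linear_continuous_on linear_linear linear_reindex)

lemma emeasure_lborel_box_cart:
  fixes l u :: "real^'k::finite"
  assumes "\<And>i. l $ i \<le> u $ i"
  shows "emeasure lborel (box l u) = (\<Prod>i\<in>UNIV. ennreal (u $ i - l $ i))"
proof -
  have "l \<bullet> b \<le> u \<bullet> b" if "b \<in> Basis" for b
    using that assms by (auto simp: Basis_vec_def inner_axis)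
  then have "emeasure lborel (box l u) = ennreal (\<Prod>b\<in>Basis. (u - l) \<bullet> b)"
    by simp
  also have "(\<Prod>b\<in>Basis. (u - l) \<bullet> b) = (\<Prod>i\<in>UNIV. u $ i - l $ i)"
  proof -
    have B: "(Basis :: (real^'k) set) = range (\<lambda>i. axis i 1)"
      by (auto simp: Basis_vec_def)
    have "inj (\<lambda>i::'k. axis i (1::real))"
      by (auto simp: inj_def axis_eq_axis)
    then show ?thesis
      unfolding B by (simp add: prod.reindex inner_axis)
  qed
  also have "ennreal \<dots> = (\<Prod>i\<in>UNIV. ennreal (u $ i - l $ i))"
    using assms by (simp add: prod_ennreal)
  finally show ?thesis .
qed

lemma lborel_eqI_cart:
  fixes M :: "(real^'k::finite) measure"
  assumes "sets M = sets borel"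
    and "\<And>l u. (\<And>i. l $ i \<le> u $ i) \<Longrightarrow> emeasure M (box l u) = (\<Prod>i\<in>UNIV. ennreal (u $ i - l $ i))"
  shows "M = lborel"
proof (rule lborel_eqI [symmetric])
  fix l u :: "real^'k" assume lu: "\<And>b. b \<in> Basis \<Longrightarrow> l \<bullet> b \<le> u \<bullet> b"
  have "l $ i \<le> u $ i" for i
    using lu [of "axis i 1"] by (simp add: inner_axis)
  then show "emeasure M (box l u) = ennreal (\<Prod>b\<in>Basis. (u - l) \<bullet> b)"
    using assms(2) [of l u] emeasure_lborel_box_cart [of l u] emeasure_lborel_box [OF lu] by simp
qed (simp add: assms)

lemma distr_lborel_reindex:
  fixes \<sigma> :: "'b::finite \<Rightarrow> 'a::finite"
  assumes \<sigma>: "bij \<sigma>"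
  shows "distr lborel borel (reindex \<sigma>) = (lborel :: (real^'b) measure)"
proof (rule lborel_eqI_cart)
  fix l u :: "real^'b" assume lu: "\<And>i. l $ i \<le> u $ i"
  have inv: "inv \<sigma> (\<sigma> j) = j" "\<sigma> (inv \<sigma> i) = i" for i j
    using \<sigma> by (simp_all add: bij_is_inj bij_is_surj surj_f_inv_f)
  have "reindex \<sigma> x \<in> box l u \<longleftrightarrow> x \<in> box (reindex (inv \<sigma>) l) (reindex (inv \<sigma>) u)" for x :: "real^'a"
    unfolding mem_box_cart reindex_nth using inv by metis
  then have "reindex \<sigma> -` box l u \<inter> space lborel = box (reindex (inv \<sigma>) l) (reindex (inv \<sigma>) u)"
    by auto
  then have "emeasure (distr lborel borel (reindex \<sigma>)) (box l u) =
      emeasure lborel (box (reindex (inv \<sigma>) l) (reindex (inv \<sigma>) u))"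
    by (subst emeasure_distr) (auto intro!: borel_measurable_continuous_onI continuous_on_reindex)
  also have "\<dots> = (\<Prod>i\<in>UNIV. ennreal (u $ inv \<sigma> i - l $ inv \<sigma> i))"
    by (subst emeasure_lborel_box_cart) (auto simp: lu)
  also have "\<dots> = (\<Prod>j\<in>UNIV. ennreal (u $ j - l $ j))"
    using \<sigma> by (intro prod.reindex_bij_betw [of "inv \<sigma>"]) (simp add: bij_imp_bij_inv)
  finally show "emeasure (distr lborel borel (reindex \<sigma>)) (box l u) = (\<Prod>j\<in>UNIV. ennreal (u $ j - l $ j))" .
qed simp


section \<open>Splitting \<open>real^('m option)\<close> into surface parameters and one transversal
  coordinate \<open>None\<close>\<close>

definition join_vec :: "(real^'m) \<times> real \<Rightarrow> real^('m option)" where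
  "join_vec z = (\<chi> i. case i of None \<Rightarrow> snd z | Some j \<Rightarrow> fst z $ j)"

definition tpart :: "real^('m option) \<Rightarrow> real^'m" where
  "tpart x = (\<chi> j. x $ Some j)"

lemma join_vec_nth [simp]: "join_vec z $ None = snd z" "join_vec z $ Some j = fst z $ j"
  by (simp_all add: join_vec_def)

lemma tpart_nth [simp]: "tpart x $ j = x $ Some j"
  by (simp add: tpart_def)

lemma tpart_join_vec [simp]: "tpart (join_vec z) = fst z"
  by (simp add: vec_eq_iff)

lemma join_vec_tpart [simp]: "join_vec (tpart x, x $ None) = x"
  by (simp add: vec_eq_iff join_vec_def split: option.split)

lemma linear_join_vec: "linear (join_vec :: (real^'m::finite) \<times> real \<Rightarrow> _)"
  by (rule linearI) (auto simp: vec_eq_iff join_vec_def split: option.split)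

lemma linear_tpart: "linear (tpart :: real^('m::finite option) \<Rightarrow> _)"
  by (rule linearI) (auto simp: vec_eq_iff)

lemma continuous_on_join_vec: "continuous_on S (join_vec :: (real^'m::finite) \<times> real \<Rightarrow> _)"
  by (simp add: linear_continuous_on linear_linear linear_join_vec)

lemma continuous_on_tpart: "continuous_on S (tpart :: real^('m::finite option) \<Rightarrow> _)"
  by (simp add: linear_continuous_on linear_linear linear_tpart)

lemma distr_lborel_join_vec:
  "distr (lborel \<Otimes>\<^sub>M lborel) borel join_vec = (lborel :: (real^('m::finite option)) measure)"
proof (rule lborel_eqI_cart)
  fix l u :: "real^('m option)" assume lu: "\<And>i. l $ i \<le> u $ i"
  have all: "(\<forall>i. P i) \<longleftrightarrow> P None \<and> (\<forall>j. P (Some j))" for P :: "'m option \<Rightarrow> bool"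
    by (metis option.exhaust)
  have "join_vec -` box l u = box (tpart l) (tpart u) \<times> box (l $ None) (u $ None)"
    by (auto simp: mem_box_cart all)
  then have "emeasure (distr (lborel \<Otimes>\<^sub>M lborel) borel join_vec) (box l u) =
      emeasure (lborel \<Otimes>\<^sub>M lborel) (box (tpart l) (tpart u) \<times> box (l $ None) (u $ None))"
    by (subst emeasure_distr)
      (auto simp: lborel_prod space_pair_measure intro!: borel_measurable_continuous_onI continuous_on_join_vec)
  also have "\<dots> = emeasure lborel (box (tpart l) (tpart u)) * emeasure lborel (box (l $ None) (u $ None))"
    by (rule lborel.emeasure_pair_measure_Times) auto
  also have "\<dots> = (\<Prod>j\<in>UNIV. ennreal (u $ Some j - l $ Some j)) * ennreal (u $ None - l $ None)"
    using lu by (subst emeasure_lborel_box_cart) auto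
  also have "\<dots> = (\<Prod>i\<in>UNIV. ennreal (u $ i - l $ i))"
    by (simp add: UNIV_option_conv prod.reindex mult.commute)
  finally show "emeasure (distr (lborel \<Otimes>\<^sub>M lborel) borel join_vec) (box l u) =
      (\<Prod>i\<in>UNIV. ennreal (u $ i - l $ i))" .
qed simp

text \<open>The classical formula concerns sets of finite measure. Integrability of the Jacobian is
  equivalent to finite measure of the image, so in the remaining case both sides are infinite and
  the identity holds in \<open>ennreal\<close> without a finiteness assumption.\<close>

lemma emeasure_image_wellorder:
  fixes g :: "real^'k::{finite,wellorder} \<Rightarrow> real^'k::_"
  assumes B: "B \<in> sets borel" and gB: "g ` B \<in> sets borel" and inj: "inj_on g B"
    and der: "\<And>x. x \<in> B \<Longrightarrow> (g has_derivative g' x) (at x within B)"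
    and meas: "(\<lambda>x. indicator B x * \<bar>det (matrix (g' x))\<bar>) \<in> borel_measurable borel"
  shows "emeasure lborel (g ` B) = (\<integral>\<^sup>+x. ennreal (indicator B x * \<bar>det (matrix (g' x))\<bar>) \<partial>lborel)"
proof -
  let ?F = "\<lambda>x. \<bar>det (matrix (g' x))\<bar>"
  have B': "B \<in> sets lebesgue"
    using B by (metis sets_completionI_sets sets_lborel)
  note [simp] = B gB
  have iff: "?F integrable_on B \<longleftrightarrow> (\<lambda>x. indicator B x * ?F x) integrable_on UNIV"
    by (subst integrable_restrict_UNIV [symmetric])
      (auto intro!: arg_cong [where f = "\<lambda>f. f integrable_on UNIV"] simp: indicator_def fun_eq_iff)
  show ?thesis
  proof (cases "?F integrable_on B")
    case True
    then have L: "g ` B \<in> lmeasurable"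
      using measurable_differentiable_image_eq [OF B' der inj] by blast
    have "emeasure lborel (g ` B) = emeasure lebesgue (g ` B)" by simp
    also have "\<dots> = ennreal (measure lebesgue (g ` B))"
      using L by (simp add: emeasure_eq_measure2)
    also have "measure lebesgue (g ` B) = integral B ?F"
      by (rule measure_differentiable_image_eq [OF B' der inj True])
    also have "ennreal \<dots> = (\<integral>\<^sup>+x. ennreal (indicator B x * ?F x) \<partial>lborel)"
      using nn_integral_has_integral_lebesgue [OF _ integrable_integral [OF True]] by simp
    finally show ?thesis .
  next
    case False
    then have "g ` B \<notin> lmeasurable"
      using measurable_differentiable_image_eq [OF B' der inj] by blast
    then have "emeasure lborel (g ` B) = \<infinity>"
      using fmeasurableI [of "g ` B" lebesgue] by (intro ccontr [of "_ = _"]) (auto simp: less_top)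
    moreover have "(\<integral>\<^sup>+x. ennreal (indicator B x * ?F x) \<partial>lborel) = \<infinity>"
      using nn_integral_integrable_on [OF meas] False iff
      by (intro ccontr [of "_ = \<infinity>"]) (auto simp: less_top)
    ultimately show ?thesis by simp
  qed
qed

text \<open>Conjugating \<open>g\<close> with the coordinate renaming \<open>\<rho>\<close> moves
  the problem to the well-ordered copy of the index type. Neither Lebesgue measure nor the
  determinant of the derivative notices the renaming.\<close>

lemma emeasure_image:
  fixes g :: "real^'k::finite \<Rightarrow> real^'k"
  assumes B: "B \<in> sets borel" and gB: "g ` B \<in> sets borel" and inj: "inj_on g B"
    and der: "\<And>x. x \<in> B \<Longrightarrow> (g has_derivative g' x) (at x within B)"
    and meas: "(\<lambda>x. indicator B x * \<bar>det (matrix (g' x))\<bar>) \<in> borel_measurable borel"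
  shows "emeasure lborel (g ` B) = (\<integral>\<^sup>+x. ennreal (indicator B x * \<bar>det (matrix (g' x))\<bar>) \<partial>lborel)"
proof -
  have bij: "bij (Rep_windex :: 'k windex \<Rightarrow> 'k)"
    using Abs_windex_inverse by (metis UNIV_I bijI inj_Rep_windex surjI)
  have inv_Abs: "inv Abs_windex = (Rep_windex :: 'k windex \<Rightarrow> 'k)"
    using inv_equality [of Rep_windex Abs_windex] Abs_windex_inverse Rep_windex_inverse by auto
  have inj_Abs: "inj (Abs_windex :: 'k \<Rightarrow> _)" and surj_Abs: "range (Abs_windex :: 'k \<Rightarrow> _) = UNIV"
    using Abs_windex_inverse Rep_windex_inverse by (metis UNIV_I injI) (metis Rep_windex_inverse surjI)
  define \<rho> where "\<rho> = (reindex Rep_windex :: real^'k \<Rightarrow> real^('k windex))"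
  define \<rho>' where "\<rho>' = (reindex (inv Rep_windex) :: real^('k windex) \<Rightarrow> real^'k)"
  have \<rho>: "\<rho>' (\<rho> x) = x" "\<rho> (\<rho>' y) = y" for x y
    by (simp_all add: \<rho>_def \<rho>'_def bij)
  have lin: "linear \<rho>" "linear \<rho>'"
    by (simp_all add: \<rho>_def \<rho>'_def linear_reindex)
  have cont: "continuous_on UNIV \<rho>" "continuous_on UNIV \<rho>'"
    by (simp_all add: \<rho>_def \<rho>'_def continuous_on_reindex)
  then have [measurable]: "\<rho> \<in> borel_measurable borel" "\<rho>' \<in> borel_measurable borel"
    by (auto intro: borel_measurable_continuous_onI)
  have image: "\<rho> ` C = \<rho>' -` C" for C
    using \<rho> by (auto simp: image_iff) metis
  have image_sets: "\<rho> ` C \<in> sets borel" if "C \<in> sets borel" for C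
    unfolding image using that \<open>\<rho>' \<in> borel_measurable borel\<close> by (metis inf_top_right measurable_sets space_borel)
  have distr: "distr lborel borel \<rho> = lborel"
    unfolding \<rho>_def by (rule distr_lborel_reindex [OF bij])
  have emeasure_\<rho>: "emeasure lborel (\<rho> ` C) = emeasure lborel C" if "C \<in> sets borel" for C
  proof -
    have "\<rho> -` \<rho> ` C = C"
      using \<rho> by (metis image inj_vimage_image_eq injI)
    then show ?thesis
      using image_sets [OF that] by (subst distr [symmetric]) (simp add: emeasure_distr)
  qed
  define h where "h = (\<lambda>y. \<rho> (g (\<rho>' y)))"
  define h' where "h' = (\<lambda>y v. \<rho> (g' (\<rho>' y) (\<rho>' v)))"
  have det_h': "det (matrix (h' y)) = det (matrix (g' (\<rho>' y)))" for y
  proof -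
    have axis: "\<rho>' (axis j 1) = axis (Rep_windex j) 1" for j
    proof -
      have "inv Rep_windex i = j \<longleftrightarrow> i = Rep_windex j" for i
        by (metis bij bij_inv_eq_iff)
      then show ?thesis
        by (simp add: \<rho>'_def vec_eq_iff axis_def)
    qed
    have "matrix (h' y) = extend_matrix Abs_windex (matrix (g' (\<rho>' y)))"
      unfolding matrix_def extend_matrix_def h'_def axis by (simp add: vec_eq_iff surj_Abs inv_Abs \<rho>_def)
    then show ?thesis
      by (simp add: det_extend_matrix inj_Abs)
  qed
  have h_image: "h ` \<rho> ` B = \<rho> ` g ` B"
    by (simp add: h_def image_image \<rho>)
  have ind: "indicator (\<rho> ` B) y = (indicator B (\<rho>' y) :: real)" for y
    by (auto simp: indicator_def image)
  have "emeasure lborel (h ` \<rho> ` B) = (\<integral>\<^sup>+y. ennreal (indicator (\<rho> ` B) y * \<bar>det (matrix (h' y))\<bar>) \<partial>lborel)"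
  proof (rule emeasure_image_wellorder)
    show "inj_on h (\<rho> ` B)"
      using inj by (auto simp: inj_on_def h_def \<rho>) (metis \<rho>(1))
    show "(h has_derivative h' y) (at y within \<rho> ` B)" if "y \<in> \<rho> ` B" for y
    proof -
      have "\<rho>' ` \<rho> ` B = B" by (auto simp: image_image \<rho>)
      moreover have "\<rho>' y \<in> B" using that by (auto simp: \<rho>)
      ultimately have "(g has_derivative g' (\<rho>' y)) (at (\<rho>' y) within \<rho>' ` \<rho> ` B)"
        using der by auto
      then have "((\<lambda>y. g (\<rho>' y)) has_derivative (\<lambda>v. g' (\<rho>' y) (\<rho>' v))) (at y within \<rho> ` B)"
        by (rule has_derivative_in_compose [OF linear_imp_has_derivative [OF lin(2)]])
      then show ?thesis
        unfolding h_def h'_def using bounded_linear.has_derivative lin(1) linear_conv_bounded_linear by blast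
    qed
    have "(\<lambda>y. (\<lambda>x. indicator B x * \<bar>det (matrix (g' x))\<bar>) (\<rho>' y)) \<in> borel_measurable borel"
      by (rule measurable_compose [OF _ meas]) measurable
    then show "(\<lambda>y. indicator (\<rho> ` B) y * \<bar>det (matrix (h' y))\<bar>) \<in> borel_measurable borel"
      by (simp add: ind det_h')
  qed (use B gB image_sets h_image in auto)
  also have "\<dots> = (\<integral>\<^sup>+x. ennreal (indicator B x * \<bar>det (matrix (g' x))\<bar>) \<partial>lborel)"
  proof -
    have "(\<lambda>y. ennreal (indicator B (\<rho>' y) * \<bar>det (matrix (g' (\<rho>' y)))\<bar>)) \<in> borel_measurable borel"
      using measurable_compose [OF _ meas, of \<rho>' borel] by simp
    then show ?thesis
      unfolding ind det_h' by (subst distr [symmetric]) (simp add: nn_integral_distr \<rho>)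
  qed
  finally show ?thesis
    unfolding h_image by (simp add: emeasure_\<rho> gB)
qed

text \<open>Setting the map to 0 off \<open>D\<close> makes it Borel on the whole space; the density
  vanishes there, so this value carries no mass. Surface measure on a patch and Lebesgue measure in
  new coordinates are both of this form.\<close>

definition push_measure ::
  "'a::euclidean_space set \<Rightarrow> ('a \<Rightarrow> real) \<Rightarrow> ('a \<Rightarrow> 'b::euclidean_space) \<Rightarrow> 'b measure" where
  "push_measure D J g =
     distr (density lborel (\<lambda>x. ennreal (indicator D x * J x))) borel (\<lambda>x. if x \<in> D then g x else 0)"

lemma sets_push_measure [simp, measurable_cong]: "sets (push_measure D J g) = sets borel"
  by (simp add: push_measure_def)

lemma space_push_measure [simp]: "space (push_measure D J g) = UNIV"
  by (simp add: push_measure_def)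

lemma borel_measurable_indicator_times:
  fixes f :: "'a::euclidean_space \<Rightarrow> 'b::euclidean_space"
  assumes "open D" "continuous_on D f"
  shows "(\<lambda>x. indicator D x *\<^sub>R f x) \<in> borel_measurable borel"
  using assms by (intro borel_measurable_continuous_on_indicator) auto

lemma borel_measurable_if_continuous:
  fixes f :: "'a::euclidean_space \<Rightarrow> 'b::euclidean_space"
  assumes "open D" "continuous_on D f"
  shows "(\<lambda>x. if x \<in> D then f x else 0) \<in> borel_measurable borel"
  using borel_measurable_indicator_times [OF assms]
  by (rule back_subst [of "\<lambda>f. f \<in> borel_measurable borel"]) (auto simp: indicator_def)

lemma borel_preimage_continuous:
  fixes f :: "'a::euclidean_space \<Rightarrow> 'b::euclidean_space"
  assumes "open D" "continuous_on D f" "A \<in> sets borel"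
  shows "{x\<in>D. f x \<in> A} \<in> sets borel"
proof -
  have "{x\<in>D. f x \<in> A} = D \<inter> (\<lambda>x. if x \<in> D then f x else 0) -` A"
    by auto
  moreover have "(\<lambda>x. if x \<in> D then f x else 0) -` A \<in> sets borel"
    using measurable_sets [OF borel_measurable_if_continuous [OF assms(1,2)] assms(3)] by simp
  ultimately show ?thesis
    using assms(1) by auto
qed

context
  fixes D :: "'a::euclidean_space set" and J :: "'a \<Rightarrow> real" and g :: "'a \<Rightarrow> 'b::euclidean_space"
  assumes D: "open D" and J: "continuous_on D J" and nonneg: "\<And>x. x \<in> D \<Longrightarrow> 0 \<le> J x"
    and g: "continuous_on D g"
begin

lemma push_density_measurable: "(\<lambda>x. indicator D x * J x) \<in> borel_measurable borel"
  using borel_measurable_indicator_times [OF D J] by simp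

lemma nn_integral_push_measure:
  assumes f: "f \<in> borel_measurable borel"
  shows "(\<integral>\<^sup>+y. f y \<partial>push_measure D J g) = (\<integral>\<^sup>+x. ennreal (indicator D x * J x) * f (g x) \<partial>lborel)"
proof -
  note [measurable] = f push_density_measurable borel_measurable_if_continuous [OF D g]
  have "(\<integral>\<^sup>+y. f y \<partial>push_measure D J g) =
      (\<integral>\<^sup>+x. ennreal (indicator D x * J x) * f (if x \<in> D then g x else 0) \<partial>lborel)"
    unfolding push_measure_def by (subst nn_integral_distr) (auto simp: nn_integral_density)
  also have "\<dots> = (\<integral>\<^sup>+x. ennreal (indicator D x * J x) * f (g x) \<partial>lborel)"
    by (intro nn_integral_cong) (auto simp: indicator_def)
  finally show ?thesis .
qed

lemma emeasure_push_measure: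
  assumes "A \<in> sets borel"
  shows "emeasure (push_measure D J g) A = (\<integral>\<^sup>+x. ennreal (indicator {x\<in>D. g x \<in> A} x * J x) \<partial>lborel)"
proof -
  have "emeasure (push_measure D J g) A = (\<integral>\<^sup>+y. indicator A y \<partial>push_measure D J g)"
    using assms by simp
  also have "\<dots> = (\<integral>\<^sup>+x. ennreal (indicator {x\<in>D. g x \<in> A} x * J x) \<partial>lborel)"
    using assms by (subst nn_integral_push_measure) (auto intro!: nn_integral_cong simp: indicator_def)
  finally show ?thesis .
qed

lemma has_bochner_integral_push_measure:
  fixes f :: "'b \<Rightarrow> 'c::euclidean_space"
  assumes f: "f \<in> borel_measurable borel"
  shows "has_bochner_integral (push_measure D J g) f i \<longleftrightarrow>
    has_bochner_integral lborel (\<lambda>x. indicator D x *\<^sub>R J x *\<^sub>R f (g x)) i"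
proof -
  note [measurable] = f push_density_measurable borel_measurable_if_continuous [OF D g]
  let ?d = "density lborel (\<lambda>x. ennreal (indicator D x * J x))"
  let ?g = "\<lambda>x. if x \<in> D then g x else 0"
  have ae: "AE x in lborel. 0 \<le> indicator D x * J x"
    using nonneg by (auto simp: indicator_def)
  have eq: "(\<lambda>x. (indicator D x * J x) *\<^sub>R f (?g x)) = (\<lambda>x. indicator D x *\<^sub>R J x *\<^sub>R f (g x))"
    by (auto simp: indicator_def)
  have "integrable (push_measure D J g) f \<longleftrightarrow> integrable ?d (\<lambda>x. f (?g x))"
    unfolding push_measure_def by (rule integrable_distr_eq) measurable
  also have "\<dots> \<longleftrightarrow> integrable lborel (\<lambda>x. indicator D x *\<^sub>R J x *\<^sub>R f (g x))"
    by (subst integrable_density [OF _ _ ae]) (simp_all only: eq, measurable)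
  finally have 1: "integrable (push_measure D J g) f \<longleftrightarrow> integrable lborel (\<lambda>x. indicator D x *\<^sub>R J x *\<^sub>R f (g x))" .
  have "(\<integral>y. f y \<partial>push_measure D J g) = (\<integral>x. f (?g x) \<partial>?d)"
    unfolding push_measure_def by (rule integral_distr) measurable
  also have "\<dots> = (\<integral>x. indicator D x *\<^sub>R J x *\<^sub>R f (g x) \<partial>lborel)"
    by (subst integral_density [OF _ _ ae]) (simp_all only: eq, measurable)
  finally show ?thesis
    using 1 by (simp add: has_bochner_integral_iff)
qed

end

text \<open>Stated as an equality of measures, the change of variables applies to nonnegative
  integrals (compatibility of patches) and to Bochner integrals (the flow) alike.\<close>

lemma push_measure_change_of_variables:
  fixes g :: "real^'k::finite \<Rightarrow> real^'k"
  assumes S: "open S" and inj: "inj_on g S"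
    and der: "\<And>x. x \<in> S \<Longrightarrow> (g has_derivative g' x) (at x)"
    and J: "continuous_on S J" "\<And>x. x \<in> S \<Longrightarrow> J x = \<bar>det (matrix (g' x))\<bar>"
  shows "push_measure S J g = density lborel (indicator (g ` S))"
proof (rule measure_eqI)
  fix A assume "A \<in> sets (push_measure S J g)"
  then have A: "A \<in> sets borel" by simp
  have cont: "continuous_on S g"
    using der by (meson continuous_at_imp_continuous_on has_derivative_continuous)
  have open_gS: "open (g ` S)"
    by (rule invariance_of_domain [OF cont S inj])
  define B where "B = {x\<in>S. g x \<in> A}"
  have B: "B \<in> sets borel" "B \<subseteq> S" "g ` B = g ` S \<inter> A"
    using borel_preimage_continuous [OF S cont A] by (auto simp: B_def)
  have eq: "indicator B x * J x = indicator B x * \<bar>det (matrix (g' x))\<bar>" for x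
    using J(2) B(2) by (auto simp: indicator_def)
  have "(\<lambda>x. indicator B x * (indicator S x * J x)) \<in> borel_measurable borel"
    using borel_measurable_indicator_times [OF S J(1)] B(1) by simp
  also have "(\<lambda>x. indicator B x * (indicator S x * J x)) = (\<lambda>x. indicator B x * J x)"
    using B(2) by (intro ext) (auto simp: indicator_def)
  finally have meas: "(\<lambda>x. indicator B x * J x) \<in> borel_measurable borel" .
  have "emeasure (push_measure S J g) A = (\<integral>\<^sup>+x. ennreal (indicator B x * J x) \<partial>lborel)"
    unfolding B_def by (rule emeasure_push_measure) (use S J cont A in auto)
  also have "\<dots> = emeasure lborel (g ` B)"
    unfolding eq
  proof (rule emeasure_image [symmetric])
    show "(g has_derivative g' x) (at x within B)" if "x \<in> B" for x
      using that B(2) der has_derivative_at_withinI by blast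
    show "inj_on g B"
      using inj B(2) by (rule inj_on_subset)
    show "(\<lambda>x. indicator B x * \<bar>det (matrix (g' x))\<bar>) \<in> borel_measurable borel"
      using meas by (simp add: eq)
  qed (use B A open_gS in auto)
  also have "\<dots> = emeasure (density lborel (indicator (g ` S))) A"
    using A open_gS by (simp add: B(3) emeasure_density flip: indicator_inter_arith)
  finally show "emeasure (push_measure S J g) A = emeasure (density lborel (indicator (g ` S))) A" .
qed simp

lemma has_bochner_integral_change_of_variables:
  fixes g :: "real^'k::finite \<Rightarrow> real^'k" and f :: "real^'k \<Rightarrow> 'c::euclidean_space"
  assumes S: "open S" and inj: "inj_on g S"
    and der: "\<And>x. x \<in> S \<Longrightarrow> (g has_derivative g' x) (at x)"
    and J: "continuous_on S J" "\<And>x. x \<in> S \<Longrightarrow> J x = \<bar>det (matrix (g' x))\<bar>"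
    and f: "f \<in> borel_measurable borel"
  shows "has_bochner_integral lborel (\<lambda>y. indicator (g ` S) y *\<^sub>R f y) i \<longleftrightarrow>
    has_bochner_integral lborel (\<lambda>x. indicator S x *\<^sub>R J x *\<^sub>R f (g x)) i"
proof -
  have cont: "continuous_on S g"
    using der by (meson continuous_at_imp_continuous_on has_derivative_continuous)
  have [measurable]: "g ` S \<in> sets borel"
    using invariance_of_domain [OF cont S inj] by simp
  note [measurable] = f
  have d: "density lborel (indicator (g ` S)) = density lborel (\<lambda>y. ennreal (indicator (g ` S) y))"
    by (simp add: ennreal_indicator)
  have "has_bochner_integral lborel (\<lambda>y. indicator (g ` S) y *\<^sub>R f y) i \<longleftrightarrow>
      has_bochner_integral (density lborel (indicator (g ` S))) f i"
    unfolding d by (simp add: has_bochner_integral_iff integrable_density integral_density)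
  also have "\<dots> \<longleftrightarrow> has_bochner_integral (push_measure S J g) f i"
    by (simp add: push_measure_change_of_variables [OF S inj der J])
  also have "\<dots> \<longleftrightarrow> has_bochner_integral lborel (\<lambda>x. indicator S x *\<^sub>R J x *\<^sub>R f (g x)) i"
    by (rule has_bochner_integral_push_measure) (use S J cont f in auto)
  finally show ?thesis .
qed

section \<open>Existence of the surface measure\<close>

text \<open>Every matrix on the segment \<open>H\<close> from the identity to the Gram matrix is
  positive definite, hence has nonzero determinant. The determinant is continuous along the segment
  and starts at 1, so it cannot reach a value \<le> 0.\<close>

lemma det_gram_pos:
  fixes A :: "real^'m::finite \<Rightarrow> 'a::euclidean_space"
  assumes "linear A" "inj A"
  shows "det (\<chi> i j. A (axis i 1) \<bullet> A (axis j 1)) > 0"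
proof (rule ccontr)
  assume neg: "\<not> ?thesis"
  let ?G = "(\<chi> i j. A (axis i 1) \<bullet> A (axis j 1)) :: real^'m^'m"
  define H where "H s = (\<chi> i j. (1 - s) * (if i = j then 1 else 0) + s * ?G $ i $ j)" for s :: real
  have G: "(?G *v x) \<bullet> x = (norm (A x))\<^sup>2" for x
  proof -
    have Ax: "A x = (\<Sum>i\<in>UNIV. x $ i *\<^sub>R A (axis i 1))"
      using linear_sum [OF assms(1), of "\<lambda>i. x $ i *\<^sub>R axis i 1" UNIV] basis_expansion [of x]
      by (simp add: linear_cmul [OF assms(1)] scalar_mult_eq_scaleR)
    have "(norm (A x))\<^sup>2 = (\<Sum>i\<in>UNIV. \<Sum>j\<in>UNIV. x $ i * x $ j * (A (axis i 1) \<bullet> A (axis j 1)))"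
      by (simp add: power2_norm_eq_inner Ax inner_sum_left inner_sum_right sum_distrib_left ac_simps inner_commute)
    also have "\<dots> = (?G *v x) \<bullet> x"
      by (simp add: inner_vec_def matrix_vector_mult_def sum_distrib_left sum_distrib_right ac_simps)
    finally show ?thesis by simp
  qed
  have H: "(H s *v x) \<bullet> x = (1 - s) * (norm x)\<^sup>2 + s * (norm (A x))\<^sup>2" for s x
  proof -
    have "H s = (1 - s) *\<^sub>R mat 1 + s *\<^sub>R ?G"
      by (simp add: H_def vec_eq_iff mat_def)
    then show ?thesis
      by (simp add: matrix_vector_mult_add_rdistrib scaleR_matrix_vector_assoc [symmetric]
          inner_add_left G power2_norm_eq_inner)
  qed
  have nz: "det (H s) \<noteq> 0" if "0 \<le> s" "s \<le> 1" for s
  proof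
    assume "det (H s) = 0"
    then obtain x where "H s *v x = 0" "x \<noteq> 0"
      by (metis invertible_det_nz invertible_left_inverse matrix_left_invertible_ker)
    moreover have "A x \<noteq> 0"
      using assms \<open>x \<noteq> 0\<close> by (metis linear_injective_0)
    ultimately have "(1 - s) * (norm x)\<^sup>2 + s * (norm (A x))\<^sup>2 = 0" "(norm x)\<^sup>2 > 0" "(norm (A x))\<^sup>2 > 0"
      using H [of s x] by auto
    moreover have "0 \<le> (1 - s) * (norm x)\<^sup>2" "0 \<le> s * (norm (A x))\<^sup>2"
      using that by auto
    ultimately have "(1 - s) * (norm x)\<^sup>2 = 0" "s * (norm (A x))\<^sup>2 = 0"
      by linarith+
    with \<open>(norm x)\<^sup>2 > 0\<close> \<open>(norm (A x))\<^sup>2 > 0\<close> show False by simp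
  qed
  have "continuous_on {0..1} (\<lambda>s. det (H s))"
    unfolding det_def H_def by (auto intro!: continuous_intros)
  moreover have "det (H 0) = 1"
  proof -
    have "H 0 = mat 1" by (simp add: H_def mat_def vec_eq_iff)
    then show ?thesis by simp
  qed
  moreover have "det (H 1) \<le> 0"
  proof -
    have "H 1 = ?G" by (simp add: H_def vec_eq_iff)
    then show ?thesis using neg by simp
  qed
  ultimately obtain s where "0 \<le> s" "s \<le> 1" "det (H s) = 0"
    using IVT2' [of "\<lambda>s. det (H s)" 1 0 0] by auto
  then show False
    using nz by blast
qed

text \<open>The usual proof that an inverse map is differentiable, adapted to a map into a larger
  space: composing with a left inverse \<open>P\<close> of \<open>B\<close> gives
  \<open>P \<circ> \<psi>\<close> the identity as derivative at \<open>\<tau> t0\<close>, and \<tau>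
  then inherits the derivative of \<open>P \<circ> \<phi>\<close>. Continuity of \<tau> is the only
  regularity available beforehand.\<close>

lemma transition_derivative:
  fixes \<phi> :: "'a::euclidean_space \<Rightarrow> 'b::euclidean_space" and \<psi> :: "'a \<Rightarrow> 'b"
  assumes \<phi>: "(\<phi> has_derivative A) (at t0)" and \<psi>: "(\<psi> has_derivative B) (at (\<tau> t0))"
    and inj: "inj B" and \<tau>: "isCont \<tau> t0" and S: "open S" "t0 \<in> S"
    and eq: "\<And>t. t \<in> S \<Longrightarrow> \<psi> (\<tau> t) = \<phi> t"
  obtains L where "(\<tau> has_derivative L) (at t0)" "B \<circ> L = A"
proof -
  have linB: "linear B"
    using \<psi> by (rule has_derivative_linear)
  obtain P where P: "linear P" "P \<circ> B = id"
    using linear_injective_left_inverse [OF linB inj] by auto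
  have blP: "bounded_linear P"
    using P(1) by (simp add: linear_conv_bounded_linear)
  have F: "((\<lambda>s. P (\<psi> s)) has_derivative (\<lambda>s. s)) (at (\<tau> t0))"
    using bounded_linear.has_derivative [OF blP \<psi>] P(2) by (simp add: fun_eq_iff)
  have G: "((\<lambda>t. P (\<phi> t)) has_derivative (\<lambda>v. P (A v))) (at t0)"
    by (rule bounded_linear.has_derivative [OF blP \<phi>])
  have blG: "bounded_linear (\<lambda>v. P (A v))"
    using G by (rule has_derivative_bounded_linear)
  obtain K where K: "K > 0" "\<And>v. norm (P (A v)) \<le> norm v * K"
    using bounded_linear.pos_bounded [OF blG] by blast
  have "(\<tau> has_derivative (\<lambda>v. P (A v))) (at t0)"
    unfolding has_derivative_at_alt
  proof (intro conjI allI impI blG)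
    fix e :: real assume "0 < e"
    \<comment> \<open>The bound 1/2 absorbs the error of \<open>P \<circ> \<psi>\<close>, giving
      \<open>norm x \<le> 2 * norm y\<close> and then
      \<open>norm x \<le> (2 + 2 * K) * norm (t - t0)\<close>. The errors of
      \<open>P \<circ> \<psi>\<close> and \<open>P \<circ> \<phi>\<close> add up to
      \<open>\<epsilon> * (2 + 2 * K) + \<epsilon>\<close>, whence the denominator
      \<open>3 + 2 * K\<close>.\<close>
    define \<epsilon> where "\<epsilon> = min (1/2) (e / (3 + 2 * K))"
    have \<epsilon>: "0 < \<epsilon>" "\<epsilon> \<le> 1/2" "\<epsilon> \<le> e / (3 + 2 * K)"
      using \<open>0 < e\<close> K(1) unfolding \<epsilon>_def by (simp, intro min.cobounded1, intro min.cobounded2)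
    then have \<epsilon>_le: "\<epsilon> * (3 + 2 * K) \<le> e"
      using K(1) by (simp add: pos_le_divide_eq)
    obtain d1 where d1: "d1 > 0"
      "\<And>s. norm (s - \<tau> t0) < d1 \<Longrightarrow> norm (P (\<psi> s) - P (\<psi> (\<tau> t0)) - (s - \<tau> t0)) \<le> \<epsilon> * norm (s - \<tau> t0)"
      using F \<epsilon>(1) unfolding has_derivative_at_alt by meson
    obtain d2 where d2: "d2 > 0"
      "\<And>t. norm (t - t0) < d2 \<Longrightarrow> norm (P (\<phi> t) - P (\<phi> t0) - P (A (t - t0))) \<le> \<epsilon> * norm (t - t0)"
      using G \<epsilon>(1) unfolding has_derivative_at_alt by meson
    obtain d3 where d3: "d3 > 0" "\<And>t. norm (t - t0) < d3 \<Longrightarrow> norm (\<tau> t - \<tau> t0) < d1"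
      using \<tau> d1(1) unfolding continuous_at_eps_delta dist_norm by meson
    obtain d4 where d4: "d4 > 0" "ball t0 d4 \<subseteq> S"
      using S by (meson open_contains_ball)
    show "\<exists>d>0. \<forall>y. norm (y - t0) < d \<longrightarrow> norm (\<tau> y - \<tau> t0 - P (A (y - t0))) \<le> e * norm (y - t0)"
    proof (intro exI conjI allI impI)
      show "min (min d2 d3) d4 > 0" using d2 d3 d4 by simp
      fix t assume t: "norm (t - t0) < min (min d2 d3) d4"
      then have "t \<in> S"
        using d4(2) by (auto simp: dist_norm norm_minus_commute subset_iff)
      define x where "x = \<tau> t - \<tau> t0"
      define y where "y = P (\<phi> t) - P (\<phi> t0)"
      have x: "norm (y - x) \<le> \<epsilon> * norm x"
        using d1(2) [of "\<tau> t"] d3(2) [of t] t eq \<open>t \<in> S\<close> \<open>t0 \<in> S\<close> by (simp add: x_def y_def)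
      have y: "norm (y - P (A (t - t0))) \<le> \<epsilon> * norm (t - t0)"
        using d2(2) t by (simp add: y_def)
      have "\<epsilon> * norm (t - t0) \<le> 1 * norm (t - t0)"
        using \<epsilon> by (intro mult_right_mono) auto
      then have "norm y \<le> (1 + K) * norm (t - t0)"
        using y K(2) [of "t - t0"] norm_triangle_sub [of y "P (A (t - t0))"] by (simp add: algebra_simps)
      moreover have "\<epsilon> * norm x \<le> 1/2 * norm x"
        using \<epsilon> by (intro mult_right_mono) auto
      then have "norm x \<le> 2 * norm y"
        using x norm_triangle_sub [of x y] by (simp add: norm_minus_commute)
      ultimately have "norm x \<le> (2 + 2 * K) * norm (t - t0)"
        by (simp add: algebra_simps)
      then have "\<epsilon> * norm x \<le> \<epsilon> * ((2 + 2 * K) * norm (t - t0))"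
        using \<epsilon>(1) by (intro mult_left_mono) auto
      moreover have "norm (x - P (A (t - t0))) \<le> norm (y - x) + norm (y - P (A (t - t0)))"
        by (metis add.commute diff_add_cancel norm_minus_commute norm_triangle_ineq add_diff_eq)
      ultimately have "norm (x - P (A (t - t0))) \<le> \<epsilon> * (3 + 2 * K) * norm (t - t0)"
        using x y by (simp add: algebra_simps)
      also have "\<dots> \<le> e * norm (t - t0)"
        using \<epsilon>_le by (intro mult_right_mono) auto
      finally show "norm (\<tau> t - \<tau> t0 - P (A (t - t0))) \<le> e * norm (t - t0)"
        by (simp add: x_def)
    qed
  qed
  moreover have "B \<circ> (\<lambda>v. P (A v)) = A"
  proof -
    have "((\<lambda>t. \<psi> (\<tau> t)) has_derivative (\<lambda>v. B (P (A v)))) (at t0)"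
      by (rule has_derivative_compose [OF calculation \<psi>])
    moreover have "((\<lambda>t. \<psi> (\<tau> t)) has_derivative A) (at t0)"
      using \<phi> by (rule has_derivative_transform_within_open [OF _ S]) (simp add: eq)
    ultimately have "(\<lambda>v. B (P (A v))) = A"
      by (rule has_derivative_unique)
    then show ?thesis by (simp add: o_def)
  qed
  ultimately show ?thesis
    by (rule that)
qed

section \<open>Regularity of patches and of the area element\<close>

lemma surface_patchD:
  assumes "surface_patch \<Gamma> D \<phi>"
  shows surface_patch_open: "open D"
    and surface_patch_openin: "openin (top_of_set \<Gamma>) (\<phi> ` D)"
    and surface_patch_subset: "\<phi> ` D \<subseteq> \<Gamma>"
    and surface_patch_continuous: "continuous_on D \<phi>"
    and surface_patch_inj: "inj_on \<phi> D"
    and surface_patch_derivative: "t \<in> D \<Longrightarrow> (\<phi> has_derivative frechet_derivative \<phi> (at t)) (at t)"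
    and surface_patch_linear: "t \<in> D \<Longrightarrow> linear (frechet_derivative \<phi> (at t))"
    and surface_patch_immersion: "t \<in> D \<Longrightarrow> inj (frechet_derivative \<phi> (at t))"
    and surface_patch_inverse: "continuous_on (\<phi> ` D) (the_inv_into D \<phi>)"
    and surface_patch_derivative_continuous: "continuous_on D (\<lambda>t. frechet_derivative \<phi> (at t) v)"
proof -
  show D: "open D" and "openin (top_of_set \<Gamma>) (\<phi> ` D)" and "t \<in> D \<Longrightarrow> inj (frechet_derivative \<phi> (at t))"
    using assms by (auto simp: surface_patch_def)
  then show "\<phi> ` D \<subseteq> \<Gamma>"
    using openin_imp_subset by blast
  obtain \<psi> where \<psi>: "homeomorphism D (\<phi> ` D) \<phi> \<psi>"
    using assms by (auto simp: surface_patch_def)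
  then show "continuous_on D \<phi>" and inj: "inj_on \<phi> D"
    by (auto simp: homeomorphism_def inj_on_def) metis
  have "the_inv_into D \<phi> y = \<psi> y" if "y \<in> \<phi> ` D" for y
    using that \<psi> inj by (metis homeomorphism_apply1 imageE the_inv_into_f_f)
  then show "continuous_on (\<phi> ` D) (the_inv_into D \<phi>)"
    using homeomorphism_cont2 [OF \<psi>] by (simp cong: continuous_on_cong)
  obtain \<phi>' where \<phi>': "continuous_on D \<phi>'" "\<And>x. x \<in> D \<Longrightarrow> (\<phi> has_derivative blinfun_apply (\<phi>' x)) (at x within D)"
    using assms by (auto simp: surface_patch_def C1_on_def)
  have der: "(\<phi> has_derivative blinfun_apply (\<phi>' x)) (at x)" if "x \<in> D" for x
    using \<phi>'(2) [OF that] unfolding at_within_open [OF that D] .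
  then show *: "(\<phi> has_derivative frechet_derivative \<phi> (at t)) (at t)" if "t \<in> D" for t
    using that by (simp add: differentiableI [OF der] flip: frechet_derivative_works)
  show "linear (frechet_derivative \<phi> (at t))" if "t \<in> D" for t
    using * [OF that] by (rule has_derivative_linear)
  have "frechet_derivative \<phi> (at x) v = blinfun_apply (\<phi>' x) v" if "x \<in> D" for x
    using has_derivative_unique [OF der [OF that] * [OF that]] by simp
  moreover have "continuous_on D (\<lambda>x. blinfun_apply (\<phi>' x) v)"
    using \<phi>'(1) by (intro continuous_intros)
  ultimately show "continuous_on D (\<lambda>t. frechet_derivative \<phi> (at t) v)"
    by (simp cong: continuous_on_cong)
qed

lemma continuous_on_area_element:
  fixes \<phi> :: "real^'m::finite \<Rightarrow> 'a::euclidean_space"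
  assumes "surface_patch \<Gamma> D \<phi>"
  shows "continuous_on D (area_element \<phi>)"
  unfolding area_element_def [abs_def] det_def
  by (auto intro!: continuous_intros surface_patch_derivative_continuous [OF assms])

lemma area_element_pos:
  fixes \<phi> :: "real^'m::finite \<Rightarrow> 'a::euclidean_space"
  assumes "surface_patch \<Gamma> D \<phi>" "t \<in> D"
  shows "area_element \<phi> t > 0"
  unfolding area_element_def using assms
  by (auto intro!: det_gram_pos surface_patch_linear surface_patch_immersion)

text \<open>With \<open>M = matrix L\<close>, the Gram matrix of \<open>B \<circ> L\<close> is the
  Gram matrix of \<open>B\<close> multiplied by the transpose of \<open>M\<close> on the left and by
  \<open>M\<close> on the right. Taking square roots, area elements transform by
  \<open>\<bar>det M\<bar>\<close>.\<close>

lemma det_gram_compose: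
  fixes B :: "real^'m::finite \<Rightarrow> 'a::euclidean_space"
  assumes B: "linear B" and L: "linear L"
  shows "det (\<chi> i j. B (L (axis i 1)) \<bullet> B (L (axis j 1))) =
    (det (matrix L))\<^sup>2 * det (\<chi> i j. B (axis i 1) \<bullet> B (axis j 1))"
proof -
  let ?G = "(\<chi> i j. B (axis i 1) \<bullet> B (axis j 1)) :: real^'m^'m"
  have BL: "B (L (axis j 1)) = (\<Sum>k\<in>UNIV. matrix L $ k $ j *\<^sub>R B (axis k 1))" for j
  proof -
    have "L (axis j 1) = (\<Sum>k\<in>UNIV. matrix L $ k $ j *\<^sub>R axis k 1)"
      using basis_expansion [of "L (axis j 1)"] by (simp add: matrix_def scalar_mult_eq_scaleR)
    then show ?thesis
      using linear_sum [OF B, of "\<lambda>k. matrix L $ k $ j *\<^sub>R axis k 1" UNIV]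
      by (simp add: linear_cmul [OF B])
  qed
  have "(\<chi> i j. B (L (axis i 1)) \<bullet> B (L (axis j 1))) = Finite_Cartesian_Product.transpose (matrix L) ** ?G ** matrix L"
    by (simp add: vec_eq_iff BL matrix_matrix_mult_def Finite_Cartesian_Product.transpose_def
        inner_sum_left inner_sum_right sum_distrib_left sum_distrib_right ac_simps)
  then show ?thesis
    by (simp add: det_mul det_transpose power2_eq_square)
qed

text \<open>A relatively open part of a compact set is Borel, and on it the inverse of \<phi> is
  continuous; so the image is a Borel preimage under that inverse.\<close>

lemma surface_patch_borel_image:
  fixes \<phi> :: "real^'m::finite \<Rightarrow> 'a::euclidean_space"
  assumes patch: "surface_patch \<Gamma> D \<phi>" and \<Gamma>: "compact \<Gamma>" and B: "B \<in> sets borel" "B \<subseteq> D"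
  shows "\<phi> ` B \<in> sets borel"
proof -
  obtain T where T: "open T" "\<phi> ` D = \<Gamma> \<inter> T"
    using surface_patch_openin [OF patch] by (auto simp: openin_open)
  then have D: "\<phi> ` D \<in> sets borel"
    using \<Gamma> by (metis borel_closed borel_open compact_imp_closed sets.Int)
  let ?\<psi> = "\<lambda>y. indicator (\<phi> ` D) y *\<^sub>R the_inv_into D \<phi> y"
  have "?\<psi> \<in> borel_measurable borel"
    using D surface_patch_inverse [OF patch] by (rule borel_measurable_continuous_on_indicator)
  from measurable_sets [OF this B(1)] have "?\<psi> -` B \<in> sets borel"
    by simp
  moreover have "\<phi> ` B = \<phi> ` D \<inter> ?\<psi> -` B"
    using B(2) surface_patch_inj [OF patch] by (auto simp: the_inv_into_f_f subset_iff)
  ultimately show ?thesis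
    using D by auto
qed

text \<open>This makes surface measure independent of the parametrization: on the overlap the
  transition map \<tau> is an injective change of parameters whose Jacobian is exactly the quotient
  of the two area elements.\<close>

lemma emeasure_push_patch_compatible:
  fixes \<phi> \<psi> :: "real^'m::finite \<Rightarrow> 'a::euclidean_space"
  assumes \<phi>: "surface_patch \<Gamma> D \<phi>" and \<psi>: "surface_patch \<Gamma> E \<psi>"
    and C: "C \<in> sets borel" "C \<subseteq> \<phi> ` D" "C \<subseteq> \<psi> ` E"
  shows "emeasure (push_measure D (area_element \<phi>) \<phi>) C = emeasure (push_measure E (area_element \<psi>) \<psi>) C"
proof -
  note D = surface_patch_open [OF \<phi>] continuous_on_area_element [OF \<phi>] surface_patch_continuous [OF \<phi>]
  note E = surface_patch_open [OF \<psi>] continuous_on_area_element [OF \<psi>] surface_patch_continuous [OF \<psi>]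
  have pos: "t \<in> D \<Longrightarrow> 0 \<le> area_element \<phi> t" "s \<in> E \<Longrightarrow> 0 \<le> area_element \<psi> s" for s t
    using area_element_pos [OF \<phi>] area_element_pos [OF \<psi>] by (auto intro: less_imp_le)
  define S where "S = {t\<in>D. \<phi> t \<in> \<psi> ` E}"
  define \<tau> where "\<tau> = the_inv_into E \<psi> \<circ> \<phi>"
  obtain T where T: "open T" "\<psi> ` E = \<Gamma> \<inter> T"
    using surface_patch_openin [OF \<psi>] by (auto simp: openin_open)
  have "S = D \<inter> \<phi> -` T"
    using T surface_patch_subset [OF \<phi>] by (auto simp: S_def)
  then have S: "open S" "S \<subseteq> D"
    using continuous_open_preimage [OF D(3) D(1) T(1)] by auto
  have \<tau>: "\<tau> t \<in> E" "\<psi> (\<tau> t) = \<phi> t" if "t \<in> S" for t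
    using that surface_patch_inj [OF \<psi>]
    by (auto simp: S_def \<tau>_def f_the_inv_into_f intro: the_inv_into_into)
  have cont_\<tau>: "continuous_on S \<tau>"
    unfolding \<tau>_def by (rule continuous_on_compose [OF continuous_on_subset [OF D(3) S(2)]
          continuous_on_subset [OF surface_patch_inverse [OF \<psi>]]]) (auto simp: S_def)
  have inj_\<tau>: "inj_on \<tau> S"
    using \<tau>(2) S(2) surface_patch_inj [OF \<phi>] by (metis inj_on_def subset_iff)
  have "\<exists>L. (\<tau> has_derivative L) (at t) \<and> frechet_derivative \<psi> (at (\<tau> t)) \<circ> L = frechet_derivative \<phi> (at t)"
    if "t \<in> S" for t
  proof (rule transition_derivative)
    show "(\<phi> has_derivative frechet_derivative \<phi> (at t)) (at t)"
      using that S by (auto intro: surface_patch_derivative [OF \<phi>])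
    show "(\<psi> has_derivative frechet_derivative \<psi> (at (\<tau> t))) (at (\<tau> t))"
      using \<tau> that by (auto intro: surface_patch_derivative [OF \<psi>])
    show "inj (frechet_derivative \<psi> (at (\<tau> t)))"
      using \<tau> that by (auto intro: surface_patch_immersion [OF \<psi>])
    show "isCont \<tau> t"
      using cont_\<tau> S(1) that continuous_on_eq_continuous_at by blast
  qed (use S that \<tau> in auto)
  then obtain L where L: "\<And>t. t \<in> S \<Longrightarrow> (\<tau> has_derivative L t) (at t)"
    "\<And>t. t \<in> S \<Longrightarrow> frechet_derivative \<psi> (at (\<tau> t)) \<circ> L t = frechet_derivative \<phi> (at t)"
    by metis
  have area: "area_element \<phi> t = \<bar>det (matrix (L t))\<bar> * area_element \<psi> (\<tau> t)" if t: "t \<in> S" for t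
  proof -
    have "frechet_derivative \<phi> (at t) v = frechet_derivative \<psi> (at (\<tau> t)) (L t v)" for v
      using L(2) [OF t] by (auto simp: fun_eq_iff)
    then show ?thesis
      unfolding area_element_def
      using det_gram_compose [OF surface_patch_linear [OF \<psi> \<tau>(1) [OF t]] has_derivative_linear [OF L(1) [OF t]]]
      by (simp add: real_sqrt_mult)
  qed
  \<comment> \<open>The quotient agrees with \<open>\<bar>det (matrix (L t))\<bar>\<close>, but its
    continuity is immediate, whereas \<open>L\<close> is known only as a pointwise
    derivative.\<close>
  define J where "J t = area_element \<phi> t / area_element \<psi> (\<tau> t)" for t
  have J: "J t = \<bar>det (matrix (L t))\<bar>" if "t \<in> S" for t
    using area [OF that] area_element_pos [OF \<psi> \<tau>(1) [OF that]] by (simp add: J_def)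
  have cont_J: "continuous_on S J"
    unfolding J_def
  proof (intro continuous_on_divide continuous_on_subset [OF D(2) S(2)])
    show "continuous_on S (\<lambda>t. area_element \<psi> (\<tau> t))"
      using \<tau>(1) by (intro continuous_on_compose2 [OF E(2) cont_\<tau>]) auto
    show "\<forall>t\<in>S. area_element \<psi> (\<tau> t) \<noteq> 0"
      using \<tau>(1) area_element_pos [OF \<psi>] by (metis less_irrefl)
  qed
  define h where "h s = ennreal (indicator {s\<in>E. \<psi> s \<in> C} s * area_element \<psi> s)" for s
  have CE: "{s\<in>E. \<psi> s \<in> C} \<in> sets borel"
    by (rule borel_preimage_continuous [OF E(1,3) C(1)])
  have "(\<lambda>s. indicator {s\<in>E. \<psi> s \<in> C} s * (indicator E s * area_element \<psi> s)) \<in> borel_measurable borel"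
    using CE borel_measurable_indicator_times [OF E(1,2)] by simp
  also have "(\<lambda>s. indicator {s\<in>E. \<psi> s \<in> C} s * (indicator E s * area_element \<psi> s)) =
      (\<lambda>s. indicator {s\<in>E. \<psi> s \<in> C} s * area_element \<psi> s)"
    by (intro ext) (auto simp: indicator_def)
  finally have h: "h \<in> borel_measurable borel"
    unfolding h_def by measurable
  have open_\<tau>S: "open (\<tau> ` S)"
    by (rule invariance_of_domain [OF cont_\<tau> S(1) inj_\<tau>])
  have in_\<tau>S: "s \<in> \<tau> ` S" if s: "s \<in> E" "\<psi> s \<in> C" for s
  proof -
    obtain t where t: "t \<in> D" "\<phi> t = \<psi> s"
      using s(2) C(2) by force
    then have "t \<in> S" "\<tau> t = s"
      using s surface_patch_inj [OF \<psi>] by (auto simp: S_def \<tau>_def the_inv_into_f_f)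
    then show ?thesis by blast
  qed
  have "emeasure (push_measure E (area_element \<psi>) \<psi>) C = (\<integral>\<^sup>+s. h s \<partial>lborel)"
    unfolding h_def by (rule emeasure_push_measure) (use E pos C in auto)
  also have "\<dots> = (\<integral>\<^sup>+s. indicator (\<tau> ` S) s * h s \<partial>lborel)"
    using in_\<tau>S by (intro nn_integral_cong) (auto simp: h_def indicator_def)
  also have "\<dots> = (\<integral>\<^sup>+s. h s \<partial>density lborel (indicator (\<tau> ` S)))"
    using h open_\<tau>S by (subst nn_integral_density) auto
  also have "\<dots> = (\<integral>\<^sup>+s. h s \<partial>push_measure S J \<tau>)"
    by (subst push_measure_change_of_variables [OF S(1) inj_\<tau> L(1) cont_J J]) auto
  also have "\<dots> = (\<integral>\<^sup>+t. ennreal (indicator S t * J t) * h (\<tau> t) \<partial>lborel)"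
    by (rule nn_integral_push_measure) (use S cont_J cont_\<tau> h J in auto)
  also have "\<dots> = (\<integral>\<^sup>+t. ennreal (indicator {t\<in>D. \<phi> t \<in> C} t * area_element \<phi> t) \<partial>lborel)"
  proof (rule nn_integral_cong)
    fix t
    show "ennreal (indicator S t * J t) * h (\<tau> t) = ennreal (indicator {t\<in>D. \<phi> t \<in> C} t * area_element \<phi> t)"
    proof (cases "t \<in> S")
      case True
      then have "J t * area_element \<psi> (\<tau> t) = area_element \<phi> t" "J t \<ge> 0"
        using area J by simp_all
      then show ?thesis
        using True \<tau>[OF True] S(2) by (auto simp: h_def indicator_def subset_iff simp flip: ennreal_mult')
    next
      case False
      then have "\<not> (t \<in> D \<and> \<phi> t \<in> C)"
        using C(3) by (auto simp: S_def)
      then show ?thesis using False by simp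
    qed
  qed
  also have "\<dots> = emeasure (push_measure D (area_element \<phi>) \<phi>) C"
    by (rule emeasure_push_measure [symmetric]) (use D pos C in auto)
  finally show ?thesis by simp
qed

lemma emeasure_push_patch_image:
  fixes \<phi> :: "real^'m::finite \<Rightarrow> 'a::euclidean_space"
  assumes \<phi>: "surface_patch \<Gamma> D \<phi>" and "compact \<Gamma>" and B: "B \<in> sets borel" "B \<subseteq> D"
  shows "emeasure (push_measure D (area_element \<phi>) \<phi>) (\<phi> ` B) = (\<integral>\<^sup>+t\<in>B. ennreal (area_element \<phi> t) \<partial>lborel)"
proof -
  have eq: "{t\<in>D. \<phi> t \<in> \<phi> ` B} = B"
    using B(2) surface_patch_inj [OF \<phi>] by (auto simp: inj_on_def)
  have pos: "t \<in> D \<Longrightarrow> 0 \<le> area_element \<phi> t" for t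
    using area_element_pos [OF \<phi>] by (auto intro: less_imp_le)
  have "emeasure (push_measure D (area_element \<phi>) \<phi>) (\<phi> ` B) =
      (\<integral>\<^sup>+t. ennreal (indicator {t\<in>D. \<phi> t \<in> \<phi> ` B} t * area_element \<phi> t) \<partial>lborel)"
    by (rule emeasure_push_measure) (use surface_patchD [OF \<phi>] continuous_on_area_element [OF \<phi>]
        surface_patch_borel_image [OF assms] pos in auto)
  also have "\<dots> = (\<integral>\<^sup>+t\<in>B. ennreal (area_element \<phi> t) \<partial>lborel)"
    unfolding eq by (intro nn_integral_cong) (auto simp: indicator_def)
  finally show ?thesis .
qed

lemma compact_C1_surface_patches:
  fixes \<Gamma> :: "'a::euclidean_space set"
  assumes "compact \<Gamma>" "C1_surface TYPE('m::finite) \<Gamma>"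
  obtains N and D :: "nat \<Rightarrow> (real^'m) set" and \<phi> where
    "\<And>i. i < N \<Longrightarrow> surface_patch \<Gamma> (D i) (\<phi> i)" "\<Gamma> = (\<Union>i<N. \<phi> i ` D i)"
proof -
  define I where "I = {(D :: (real^'m) set, \<phi>). surface_patch \<Gamma> D \<phi>}"
  have "\<exists>T. open T \<and> snd P ` fst P = \<Gamma> \<inter> T" if "P \<in> I" for P
    using that by (auto simp: I_def openin_open dest: surface_patch_openin)
  then obtain T where T: "\<And>P. P \<in> I \<Longrightarrow> open (T P) \<and> snd P ` fst P = \<Gamma> \<inter> T P"
    by metis
  have cover: "\<Gamma> \<subseteq> (\<Union>P\<in>I. T P)"
  proof
    fix y assume "y \<in> \<Gamma>"
    then obtain D :: "(real^'m) set" and \<phi> where "surface_patch \<Gamma> D \<phi>" "y \<in> \<phi> ` D"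
      using assms(2) by (auto simp: C1_surface_def)
    then show "y \<in> (\<Union>P\<in>I. T P)"
      using T [of "(D, \<phi>)"] by (auto simp: I_def)
  qed
  obtain F where F: "F \<subseteq> I" "finite F" "\<Gamma> \<subseteq> (\<Union>P\<in>F. T P)"
    using compactE_image [OF assms(1), of I T] T cover by metis
  obtain h where h: "bij_betw h {..<card F} F"
    using ex_bij_betw_nat_finite [OF F(2)] by (metis atLeast0LessThan)
  show ?thesis
  proof (rule that [of "card F" "fst \<circ> h" "snd \<circ> h"])
    have hF: "h i \<in> F" if "i < card F" for i
      using h that by (auto simp: bij_betw_def)
    then show "surface_patch \<Gamma> ((fst \<circ> h) i) ((snd \<circ> h) i)" if "i < card F" for i
      using F(1) that by (force simp: I_def)
    have "\<Gamma> = (\<Union>P\<in>F. snd P ` fst P)"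
      using F T by blast
    also have "F = h ` {..<card F}"
      using h by (simp add: bij_betw_def)
    finally show "\<Gamma> = (\<Union>i<card F. (snd \<circ> h) i ` (fst \<circ> h) i)"
      by simp
  qed
qed

text \<open>Existence: cut a finite cover by patches into disjoint Borel pieces and add the
  pushed-forward densities. Uniqueness: on each piece the value is dictated by its patch, and off
  \<Gamma> it is 0.\<close>

theorem is_surface_measure_surface_measure:
  fixes \<Gamma> :: "'a::euclidean_space set"
  assumes \<Gamma>: "compact \<Gamma>" and C1: "C1_surface TYPE('m::finite) \<Gamma>"
  shows "is_surface_measure TYPE('m) \<Gamma> (surface_measure TYPE('m) \<Gamma>)"
proof -
  obtain N and D :: "nat \<Rightarrow> (real^'m) set" and \<phi> where
    patch: "\<And>i. i < N \<Longrightarrow> surface_patch \<Gamma> (D i) (\<phi> i)" and cover: "\<Gamma> = (\<Union>i<N. \<phi> i ` D i)"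
    by (rule compact_C1_surface_patches [OF \<Gamma> C1]) blast
  define P where "P i = push_measure (D i) (area_element (\<phi> i)) (\<phi> i)" for i
  \<comment> \<open>Removing the earlier patches keeps points of overlaps from being counted
    twice.\<close>
  define A where "A i = \<phi> i ` D i - (\<Union>j<i. \<phi> j ` D j)" for i
  have sets_P [simp]: "sets (P i) = sets borel" for i
    by (simp add: P_def)
  have image_sets: "\<phi> i ` D i \<in> sets borel" if "i < N" for i
    using surface_patch_open [OF patch [OF that]] surface_patch_borel_image [OF patch [OF that] \<Gamma>] by simp
  have A_sets [measurable]: "A i \<in> sets borel" if "i < N" for i
    unfolding A_def using that by (auto intro!: sets.Diff sets.finite_UN image_sets)
  have A_sub: "A i \<subseteq> \<phi> i ` D i" for i
    by (auto simp: A_def)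
  have A_cover: "(\<Union>i<N. A i) = \<Gamma>"
  proof -
    have "(\<Union>i\<in>{0..<N}. A i) = (\<Union>i\<in>{0..<N}. \<phi> i ` D i)"
      using finite_UN_disjointed_eq [of "\<lambda>i. \<phi> i ` D i" N] by (simp add: A_def disjointed_def atLeast0LessThan)
    then show ?thesis by (simp add: cover atLeast0LessThan)
  qed
  have A_disj: "disjoint_family_on A {..<N}"
    unfolding disjoint_family_on_def
  proof (intro ballI impI)
    fix i j :: nat assume "i \<noteq> j"
    then consider "i < j" | "j < i" by linarith
    then show "A i \<inter> A j = {}"
      by cases (auto simp: A_def)
  qed
  define M where "M = (\<lambda>B. \<Sum>i<N. emeasure (P i) (B \<inter> A i))"
  define \<mu>0 where "\<mu>0 = measure_of (UNIV :: 'a set) (sets borel) M"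
  have "countably_additive (sets borel) M"
  proof (rule countably_additiveI)
    fix B :: "nat \<Rightarrow> 'a set" assume B: "range B \<subseteq> sets borel" "disjoint_family B"
    have "(\<Sum>k. M (B k)) = (\<Sum>i<N. \<Sum>k. emeasure (P i) (B k \<inter> A i))"
      unfolding M_def by (rule suminf_sum) auto
    also have "\<dots> = (\<Sum>i<N. emeasure (P i) (\<Union>k. B k \<inter> A i))"
      using B A_sets by (intro sum.cong refl suminf_emeasure) (auto simp: disjoint_family_on_def)
    also have "\<dots> = M (\<Union>k. B k)"
      unfolding M_def by (simp only: Int_UN_distrib2 [symmetric] UN_extend_simps)
    finally show "(\<Sum>k. M (B k)) = M (\<Union>k. B k)" .
  qed
  then have \<mu>0: "emeasure \<mu>0 B = M B" if "B \<in> sets borel" for B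
    unfolding \<mu>0_def using that sets.sigma_algebra_axioms [of "borel :: 'a measure"]
    by (intro emeasure_measure_of_sigma) (auto simp: positive_def M_def)
  have sets_\<mu>0: "sets \<mu>0 = sets borel"
    unfolding \<mu>0_def using sets.sets_measure_of_eq [of "borel :: 'a measure"] by simp
  have "is_surface_measure TYPE('m) \<Gamma> \<mu>0"
    unfolding is_surface_measure_def
  proof (intro conjI allI impI)
    have "- \<Gamma> \<inter> A i = {}" if "i < N" for i
      using A_cover that by blast
    then have "M (- \<Gamma>) = 0"
      by (simp add: M_def)
    then show "emeasure \<mu>0 (- \<Gamma>) = 0"
      using \<Gamma> by (subst \<mu>0) (auto intro!: borel_open dest: compact_imp_closed)
  next
    fix E :: "(real^'m) set" and \<psi> B
    assume \<psi>: "surface_patch \<Gamma> E \<psi>" and B: "B \<in> sets borel" "B \<subseteq> E"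
    let ?Q = "push_measure E (area_element \<psi>) \<psi>"
    have \<psi>B: "\<psi> ` B \<in> sets borel"
      by (rule surface_patch_borel_image [OF \<psi> \<Gamma> B])
    have "emeasure \<mu>0 (\<psi> ` B) = (\<Sum>i<N. emeasure (P i) (\<psi> ` B \<inter> A i))"
      by (simp add: \<mu>0 \<psi>B M_def)
    \<comment> \<open>Each piece of \<open>\<psi>\<close> B\<open>lies in two patches, so its
      measure may be taken in the chart \<psi>; there the disjoint pieces reassemble
      to\<close>\<psi> \<open>B\<close>.\<close>
    also have "\<dots> = (\<Sum>i<N. emeasure ?Q (\<psi> ` B \<inter> A i))"
      unfolding P_def using \<psi>B A_sub B(2)
      by (intro sum.cong refl emeasure_push_patch_compatible [OF patch \<psi>]) (auto simp: subset_iff)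
    also have "\<dots> = emeasure ?Q (\<Union>i<N. \<psi> ` B \<inter> A i)"
      using \<psi>B A_disj A_sets by (intro sum_emeasure) (auto simp: disjoint_family_on_def)
    also have "(\<Union>i<N. \<psi> ` B \<inter> A i) = \<psi> ` B"
      using A_cover surface_patch_subset [OF \<psi>] B(2) by blast
    also have "emeasure ?Q (\<psi> ` B) = (\<integral>\<^sup>+t\<in>B. ennreal (area_element \<psi> t) \<partial>lborel)"
      by (rule emeasure_push_patch_image [OF \<psi> \<Gamma> B])
    finally show "emeasure \<mu>0 (\<psi> ` B) = (\<integral>\<^sup>+t\<in>B. ennreal (area_element \<psi> t) \<partial>lborel)" .
  qed (rule sets_\<mu>0)
  \<comment> \<open>Every Borel set splits, up to a null set outside \<Gamma>, into parts of the
    pieces \<open>A i\<close>; each part is the image of a Borel set of parameters, where both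
    measures equal the same integral.\<close>
  moreover have "\<mu> = \<mu>0" if \<mu>: "is_surface_measure TYPE('m) \<Gamma> \<mu>" for \<mu>
  proof (rule measure_eqI)
    have sets_\<mu>: "sets \<mu> = sets borel" and null: "emeasure \<mu> (- \<Gamma>) = 0"
      using \<mu> by (auto simp: is_surface_measure_def)
    show "sets \<mu> = sets \<mu>0" by (simp add: sets_\<mu> sets_\<mu>0)
    fix B assume "B \<in> sets \<mu>"
    then have B: "B \<in> sets borel" by (simp add: sets_\<mu>)
    have \<Gamma>_sets: "\<Gamma> \<in> sets borel"
      using \<Gamma> by (auto intro: borel_closed compact_imp_closed)
    have piece: "emeasure \<mu> (B \<inter> A i) = emeasure (P i) (B \<inter> A i)" if i: "i < N" for i
    proof -
      define C where "C = {t\<in>D i. \<phi> i t \<in> B \<inter> A i}"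
      have C: "C \<in> sets borel" "C \<subseteq> D i"
        unfolding C_def using A_sets [OF i] B
        by (intro borel_preimage_continuous surface_patch_open [OF patch [OF i]] surface_patch_continuous [OF patch [OF i]])
          auto
      have image: "\<phi> i ` C = B \<inter> A i"
        using A_sub by (auto simp: C_def)
      show ?thesis
        using \<mu> patch [OF i] C emeasure_push_patch_image [OF patch [OF i] \<Gamma> C]
        unfolding is_surface_measure_def P_def image by (metis image)
    qed
    have "emeasure \<mu> B = emeasure \<mu> (B - - \<Gamma>)"
      using null B \<Gamma>_sets by (intro emeasure_Diff_null_set [symmetric]) (auto simp: sets_\<mu> null_sets_def)
    also have "B - - \<Gamma> = (\<Union>i<N. B \<inter> A i)"
      using A_cover by blast
    also have "emeasure \<mu> (\<Union>i<N. B \<inter> A i) = (\<Sum>i<N. emeasure \<mu> (B \<inter> A i))"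
      using A_disj A_sets B by (intro sum_emeasure [symmetric]) (auto simp: disjoint_family_on_def sets_\<mu>)
    also have "\<dots> = emeasure \<mu>0 B"
      by (simp add: \<mu>0 B M_def piece)
    finally show "emeasure \<mu> B = emeasure \<mu>0 B" .
  qed
  ultimately show ?thesis
    unfolding surface_measure_def by (rule theI2)
qed

text \<open>The defining property only measures images of Borel sets. It identifies \<mu> restricted
  to the patch with a \<open>push_measure\<close>, after which integrals can be pulled back to the
  parameters.\<close>

lemma has_bochner_integral_surface_patch:
  fixes \<phi> :: "real^'m::finite \<Rightarrow> 'a::euclidean_space" and f :: "'a \<Rightarrow> 'b::euclidean_space"
  assumes \<mu>: "is_surface_measure TYPE('m) \<Gamma> \<mu>" and \<Gamma>: "compact \<Gamma>" and \<phi>: "surface_patch \<Gamma> D \<phi>"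
    and f: "continuous_on (\<phi> ` D) f"
  shows "has_bochner_integral \<mu> (\<lambda>y. indicator (\<phi> ` D) y *\<^sub>R f y) i \<longleftrightarrow>
    has_bochner_integral lborel (\<lambda>t. indicator D t *\<^sub>R area_element \<phi> t *\<^sub>R f (\<phi> t)) i"
proof -
  let ?Q = "push_measure D (area_element \<phi>) \<phi>"
  have sets_\<mu>: "sets \<mu> = sets borel"
    using \<mu> by (auto simp: is_surface_measure_def)
  have D: "D \<in> sets borel"
    using surface_patch_open [OF \<phi>] by simp
  have \<phi>D: "\<phi> ` D \<in> sets borel"
    using surface_patch_borel_image [OF \<phi> \<Gamma> D] by simp
  have pos: "t \<in> D \<Longrightarrow> 0 \<le> area_element \<phi> t" for t
    using area_element_pos [OF \<phi>] by (auto intro: less_imp_le)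
  have Q: "density \<mu> (\<lambda>y. ennreal (indicator (\<phi> ` D) y)) = ?Q"
  proof (rule measure_eqI)
    fix B assume "B \<in> sets (density \<mu> (\<lambda>y. ennreal (indicator (\<phi> ` D) y)))"
    then have B: "B \<in> sets borel" by (simp add: sets_\<mu>)
    define C where "C = {t\<in>D. \<phi> t \<in> B}"
    have C: "C \<in> sets borel" "C \<subseteq> D"
      unfolding C_def using B
      by (intro borel_preimage_continuous surface_patch_open [OF \<phi>] surface_patch_continuous [OF \<phi>]) auto
    have image: "\<phi> ` C = \<phi> ` D \<inter> B"
      by (auto simp: C_def)
    have "emeasure (density \<mu> (\<lambda>y. ennreal (indicator (\<phi> ` D) y))) B = emeasure \<mu> (\<phi> ` D \<inter> B)"
      using B \<phi>D by (subst emeasure_density) (auto simp: sets_\<mu> ennreal_indicator simp flip: indicator_inter_arith cong: measurable_cong_sets)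
    also have "\<dots> = (\<integral>\<^sup>+t\<in>C. ennreal (area_element \<phi> t) \<partial>lborel)"
      using \<mu> \<phi> C unfolding is_surface_measure_def by (metis image)
    also have "\<dots> = emeasure ?Q B"
      by (subst emeasure_push_measure)
        (use surface_patchD [OF \<phi>] continuous_on_area_element [OF \<phi>] pos B in
          \<open>auto intro!: nn_integral_cong simp: C_def indicator_def\<close>)
    finally show "emeasure (density \<mu> (\<lambda>y. ennreal (indicator (\<phi> ` D) y))) B = emeasure ?Q B" .
  qed (simp add: sets_\<mu>)
  define g where "g y = indicator (\<phi> ` D) y *\<^sub>R f y" for y
  have g: "g \<in> borel_measurable borel"
    unfolding g_def using \<phi>D f by (rule borel_measurable_continuous_on_indicator)
  have [measurable]: "g \<in> borel_measurable \<mu>" "(\<lambda>y. indicator (\<phi> ` D) y :: real) \<in> borel_measurable \<mu>"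
    using g \<phi>D by (simp_all add: measurable_cong_sets [OF sets_\<mu> refl])
  have gg: "(\<lambda>y. indicator (\<phi> ` D) y *\<^sub>R g y) = g"
    by (auto simp: g_def indicator_def)
  have "has_bochner_integral \<mu> g i \<longleftrightarrow> has_bochner_integral (density \<mu> (\<lambda>y. ennreal (indicator (\<phi> ` D) y))) g i"
    by (simp add: has_bochner_integral_iff integrable_density integral_density gg)
  also have "\<dots> \<longleftrightarrow> has_bochner_integral ?Q g i"
    by (simp add: Q)
  also have "\<dots> \<longleftrightarrow> has_bochner_integral lborel (\<lambda>t. indicator D t *\<^sub>R area_element \<phi> t *\<^sub>R g (\<phi> t)) i"
    by (rule has_bochner_integral_push_measure)
      (use surface_patchD [OF \<phi>] continuous_on_area_element [OF \<phi>] pos g in auto)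
  also have "(\<lambda>t. indicator D t *\<^sub>R area_element \<phi> t *\<^sub>R g (\<phi> t)) =
      (\<lambda>t. indicator D t *\<^sub>R area_element \<phi> t *\<^sub>R f (\<phi> t))"
    by (auto simp: g_def indicator_def)
  finally show ?thesis
    unfolding g_def .
qed

section \<open>The divergence theorem near a boundary point\<close>

lemma surface_patch_mono:
  fixes \<phi> :: "real^'m::finite \<Rightarrow> 'a::euclidean_space"
  assumes patch: "surface_patch \<Gamma> D \<phi>" and B: "open B" "B \<subseteq> D"
  shows "surface_patch \<Gamma> B \<phi>"
  unfolding surface_patch_def
proof (intro conjI)
  obtain \<psi> where \<psi>: "homeomorphism D (\<phi> ` D) \<phi> \<psi>"
    using patch by (auto simp: surface_patch_def)
  have "openin (top_of_set D) B"
    using B by (auto simp: openin_open)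
  then have "openin (top_of_set (\<phi> ` D)) (\<phi> ` B)"
    using homeomorphism_imp_open_map [OF \<psi>] by blast
  then show "openin (top_of_set \<Gamma>) (\<phi> ` B)"
    using surface_patch_openin [OF patch] openin_trans by blast
  show "\<exists>\<psi>. homeomorphism B (\<phi> ` B) \<phi> \<psi>"
    using homeomorphism_of_subsets [OF \<psi> B(2)] by blast
  show "C1_on B \<phi>"
    using patch B(2) unfolding surface_patch_def C1_on_def
    by (meson continuous_on_subset has_derivative_subset subsetD)
  show "\<forall>t\<in>B. inj (frechet_derivative \<phi> (at t))"
    using patch B(2) by (auto simp: surface_patch_def)
qed (rule B(1))

lemma norm_join_vec [simp]: "norm (join_vec z) = norm z"
proof -
  have "join_vec z \<bullet> join_vec z = z \<bullet> z"
    by (simp add: inner_vec_def UNIV_option_conv sum.reindex inner_prod_def)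
  then show ?thesis
    by (simp add: norm_eq_sqrt_inner)
qed

lemma norm_le_tpart: "norm x \<le> norm (tpart x) + \<bar>x $ None\<bar>"
  using norm_Pair_le [of "tpart x" "x $ None"] norm_join_vec [of "(tpart x, x $ None)"] by simp

text \<open>A box in straightened coordinates. The sign of the \<open>None\<close> coordinate will
  distinguish the sides of \<Gamma>, so \<open>a\<close> and \<open>b\<close> are chosen as
  -\<delta>, 0 or \<delta>.\<close>

definition flow_box :: "(real^'m) set \<Rightarrow> real \<Rightarrow> real \<Rightarrow> (real^('m::finite option)) set" where
  "flow_box B a b = {z. tpart z \<in> B \<and> a < z $ None \<and> z $ None < b}"

lemma open_flow_box:
  fixes B :: "(real^'m::finite) set"
  assumes "open B"
  shows "open (flow_box B a b)"
proof -
  have "open (tpart -` B)"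
    using assms continuous_on_tpart continuous_open_vimage continuous_on_eq_continuous_at open_UNIV UNIV_I by metis
  moreover have "open {z :: real^('m option). a < z $ None}" "open {z :: real^('m option). z $ None < b}"
    by (intro open_Collect_less continuous_intros)+
  moreover have "flow_box B a b = tpart -` B \<inter> {z. a < z $ None} \<inter> {z. z $ None < b}"
    by (auto simp: flow_box_def)
  ultimately show ?thesis by auto
qed

lemma convex_flow_box:
  fixes B :: "(real^'m::finite) set"
  assumes "convex B"
  shows "convex (flow_box B a b)"
proof -
  have "convex (tpart -` B)"
    using convex_linear_vimage [OF linear_tpart assms] .
  moreover have "convex {z :: real^('m option). a < z $ None}" "convex {z :: real^('m option). z $ None < b}"
    using convex_halfspace_gt [of a "axis None 1 :: real^('m option)"] convex_halfspace_lt [of "axis None 1 :: real^('m option)" b]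
    by (simp_all add: inner_axis')
  moreover have "flow_box B a b = tpart -` B \<inter> {z. a < z $ None} \<inter> {z. z $ None < b}"
    by (auto simp: flow_box_def)
  ultimately show ?thesis
    by (simp add: convex_Int)
qed

text \<open>Up to a tangent vector, \<open>v\<close> equals
  \<open>(n \<bullet> v) *\<^sub>R n\<close>, and adding to one row a combination of the others
  leaves the determinant unchanged. For \<open>v = n\<close> the matrix times its transpose is the
  Gram matrix bordered by a 1, so the squared determinant is the Gram determinant.\<close>

lemma det_normal_frame:
  fixes A :: "real^'m::finite \<Rightarrow> real^('m option)"
  assumes A: "linear A" "inj A" and n: "norm n = 1" "\<And>a. n \<bullet> A a = 0"
  shows "\<bar>det (matrix (\<lambda>w. A (tpart w) + w $ None *\<^sub>R v))\<bar> =
    sqrt (det (\<chi> i j. A (axis i 1) \<bullet> A (axis j 1))) * \<bar>n \<bullet> v\<bar>"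
proof -
  define T :: "real^('m option) \<Rightarrow> real^('m option)^('m option)" where
    "T v = (\<chi> k. case k of None \<Rightarrow> v | Some j \<Rightarrow> A (axis j 1))" for v
  have T_None: "T v = (\<chi> k. if k = None then v else T 0 $ k)" for v
    by (simp add: T_def vec_eq_iff split: option.split)
  have axis: "tpart (axis None 1 :: real^('m option)) = 0" "tpart (axis (Some j) 1 :: real^('m option)) = axis j 1" for j
    by (simp_all add: vec_eq_iff axis_def)
  have "matrix (\<lambda>w. A (tpart w) + w $ None *\<^sub>R v) = Finite_Cartesian_Product.transpose (T v)"
    unfolding vec_eq_iff
  proof (intro allI)
    fix i j
    show "matrix (\<lambda>w. A (tpart w) + w $ None *\<^sub>R v) $ i $ j = Finite_Cartesian_Product.transpose (T v) $ i $ j"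
      by (cases j) (auto simp: matrix_def T_def Finite_Cartesian_Product.transpose_def axis linear_0 [OF A(1)], simp_all add: axis_def)
  qed
  then have "\<bar>det (matrix (\<lambda>w. A (tpart w) + w $ None *\<^sub>R v))\<bar> = \<bar>det (T v)\<bar>"
    by (simp add: det_transpose)
  also have "det (T v) = (n \<bullet> v) * det (T n)"
  proof -
    define u where "u = v - (n \<bullet> v) *\<^sub>R n"
    have "n \<bullet> u = 0"
      using n(1) by (simp add: u_def inner_diff_right norm_eq_1)
    \<comment> \<open>Both are subspaces of dimension \<open>CARD('m)\<close>, so the orthogonality
      hypothesis, which gives one inclusion, already gives equality.\<close>
    have "range A = {x. n \<bullet> x = 0}"
    proof (rule subspace_dim_equal)
      show "subspace (range A)"
        by (simp add: A(1) linear_subspace_image)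
      have "n \<noteq> 0"
        using n(1) by auto
      then have "dim {x. n \<bullet> x = 0} = CARD('m)"
        by (simp add: dim_hyperplane)
      moreover have "dim (range A) = CARD('m)"
        using dim_image_eq [OF A(1), of UNIV] A(2) by simp
      ultimately show "dim (range A) \<ge> dim {x. n \<bullet> x = 0}" by simp
    qed (use n(2) in \<open>auto simp: subspace_hyperplane\<close>)
    then obtain a where a: "u = A a"
      using \<open>n \<bullet> u = 0\<close> by blast
    have "u = (\<Sum>i\<in>UNIV. a $ i *\<^sub>R A (axis i 1))"
      using linear_sum [OF A(1), of "\<lambda>i. a $ i *\<^sub>R axis i 1" UNIV] basis_expansion [of a]
      by (simp add: a linear_cmul [OF A(1)] scalar_mult_eq_scaleR)
    also have "\<dots> \<in> span {row j (T ((n \<bullet> v) *\<^sub>R n)) |j. j \<noteq> None}"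
    proof (intro span_sum span_scale span_base)
      fix i
      have "A (axis i 1) = row (Some i) (T ((n \<bullet> v) *\<^sub>R n))"
        by (simp add: row_def T_def vec_eq_iff)
      then show "A (axis i 1) \<in> {row j (T ((n \<bullet> v) *\<^sub>R n)) |j. j \<noteq> None}" by blast
    qed
    finally have u: "u \<in> span {row j (T ((n \<bullet> v) *\<^sub>R n)) |j. j \<noteq> None}" .
    have row: "row k (T w) = T w $ k" for k w
      by (simp add: row_def vec_eq_iff)
    have "(\<chi> k. if k = None then row None (T ((n \<bullet> v) *\<^sub>R n)) + u else row k (T ((n \<bullet> v) *\<^sub>R n))) = T v"
      unfolding row by (simp add: vec_eq_iff T_def u_def split: option.split)
    then have "det (T v) = det (T ((n \<bullet> v) *\<^sub>R n))"
      using det_row_span [of u "T ((n \<bullet> v) *\<^sub>R n)" None] u by (simp add: span_vec_eq)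
    also have "\<dots> = (n \<bullet> v) * det (T n)"
      using det_row_mul [of None "n \<bullet> v" "\<lambda>_. n" "\<lambda>k. T 0 $ k"]
      unfolding scalar_mult_eq_scaleR T_None [of n] T_None [of "(n \<bullet> v) *\<^sub>R n"] .
    finally show ?thesis .
  qed
  also have "\<bar>(n \<bullet> v) * det (T n)\<bar> = \<bar>det (T n)\<bar> * \<bar>n \<bullet> v\<bar>"
    by (simp add: abs_mult mult.commute)
  also have "\<bar>det (T n)\<bar> = sqrt (det (\<chi> i j. A (axis i 1) \<bullet> A (axis j 1)))"
  proof -
    let ?G = "(\<chi> i j. A (axis i 1) \<bullet> A (axis j 1)) :: real^'m^'m"
    have "T n ** Finite_Cartesian_Product.transpose (T n) = extend_matrix Some ?G"
      unfolding vec_eq_iff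
    proof (intro allI)
      fix i j
      have "(T n ** Finite_Cartesian_Product.transpose (T n)) $ i $ j = T n $ i \<bullet> T n $ j"
        by (simp add: matrix_matrix_mult_def Finite_Cartesian_Product.transpose_def inner_vec_def)
      also have "\<dots> = extend_matrix Some ?G $ i $ j"
        using n by (cases i; cases j) (auto simp: T_def extend_matrix_def norm_eq_1 inner_commute)
      finally show "(T n ** Finite_Cartesian_Product.transpose (T n)) $ i $ j = extend_matrix Some ?G $ i $ j" .
    qed
    then have "(det (T n))\<^sup>2 = det ?G"
      using det_mul [of "T n" "Finite_Cartesian_Product.transpose (T n)"]
      by (simp add: det_extend_matrix det_transpose power2_eq_square)
    then show ?thesis
      by (metis real_sqrt_abs)
  qed
  finally show ?thesis .
qed

section \<open>The flow along a transversal direction\<close>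

definition flow :: "(real^'m \<Rightarrow> real^('m option)) \<Rightarrow> real^('m option) \<Rightarrow> real^('m option) \<Rightarrow> real^('m::finite option)" where
  "flow \<phi> v z = \<phi> (tpart z) + z $ None *\<^sub>R v"

definition flow_derivative ::
  "(real^'m \<Rightarrow> real^('m option)) \<Rightarrow> real^('m option) \<Rightarrow> real^'m \<Rightarrow> real^('m option) \<Rightarrow> real^('m::finite option)" where
  "flow_derivative \<phi> v t w = frechet_derivative \<phi> (at t) (tpart w) + w $ None *\<^sub>R v"

lemma flow_join_vec [simp]: "flow \<phi> v (join_vec (t, s)) = \<phi> t + s *\<^sub>R v"
  by (simp add: flow_def)

lemma flow_has_derivative:
  fixes \<phi> :: "real^'m::finite \<Rightarrow> real^('m option)"
  assumes "surface_patch \<Gamma> D \<phi>" "tpart z \<in> D"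
  shows "(flow \<phi> v has_derivative flow_derivative \<phi> v (tpart z)) (at z)"
proof -
  have "((\<lambda>z. \<phi> (tpart z)) has_derivative (\<lambda>w. frechet_derivative \<phi> (at (tpart z)) (tpart w))) (at z)"
    by (rule has_derivative_compose [OF linear_imp_has_derivative [OF linear_tpart] surface_patch_derivative [OF assms]])
  moreover have "((\<lambda>z. z $ None *\<^sub>R v) has_derivative (\<lambda>w. w $ None *\<^sub>R v)) (at z)"
    by (intro derivative_eq_intros linear_imp_has_derivative) (auto intro: linearI simp: algebra_simps)
  ultimately show ?thesis
    unfolding flow_def [abs_def] flow_derivative_def [abs_def] by (rule has_derivative_add)
qed

text \<open>Normals are defined through curves in \<Gamma>; the curve
  \<open>s \<mapsto> \<phi> (t + s *\<^sub>R a)\<close>, which stays in the patch for small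
  \<open>s\<close>, turns this into orthogonality to the range of the derivative of \<phi>.\<close>

lemma tangent_vectors_patch:
  fixes \<phi> :: "real^'m::finite \<Rightarrow> 'a::euclidean_space"
  assumes patch: "surface_patch \<Gamma> D \<phi>" and t: "t \<in> D"
  shows "frechet_derivative \<phi> (at t) a \<in> tangent_vectors \<Gamma> (\<phi> t)"
proof -
  have "open {s. t + s *\<^sub>R a \<in> D}"
    using surface_patch_open [OF patch] continuous_open_vimage [of D "\<lambda>s. t + s *\<^sub>R a"]
    by (auto simp: vimage_def intro!: continuous_intros)
  then obtain \<epsilon> where \<epsilon>: "\<epsilon> > 0" "ball 0 \<epsilon> \<subseteq> {s. t + s *\<^sub>R a \<in> D}"
    using t by (metis (mono_tags, lifting) add.right_neutral mem_Collect_eq open_contains_ball scaleR_zero_left)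
  have "((\<lambda>s. t + s *\<^sub>R a) has_derivative (\<lambda>s. s *\<^sub>R a)) (at 0)"
    by (auto intro!: derivative_eq_intros)
  moreover have "(\<phi> has_derivative frechet_derivative \<phi> (at t)) (at (t + 0 *\<^sub>R a))"
    using surface_patch_derivative [OF patch t] by simp
  ultimately have "((\<lambda>s. \<phi> (t + s *\<^sub>R a)) has_derivative (\<lambda>s. frechet_derivative \<phi> (at t) (s *\<^sub>R a))) (at 0)"
    by (rule has_derivative_compose)
  then have "((\<lambda>s. \<phi> (t + s *\<^sub>R a)) has_vector_derivative frechet_derivative \<phi> (at t) a) (at 0)"
    by (simp add: has_vector_derivative_def linear_cmul [OF surface_patch_linear [OF patch t]])
  moreover have "\<phi> (t + s *\<^sub>R a) \<in> \<Gamma>" if "\<bar>s\<bar> < \<epsilon>" for s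
    using that \<epsilon>(2) surface_patch_subset [OF patch] by (auto simp: subset_iff)
  ultimately show ?thesis
    unfolding tangent_vectors_def using \<epsilon>(1)
    by (intro CollectI exI [of _ "\<lambda>s. \<phi> (t + s *\<^sub>R a)"] exI [of _ \<epsilon>]) auto
qed

text \<open>The Jordan surface after an isometry has turned the slice into the whole of
  \<open>real^('m option)\<close>: the two domains become open sets, and the normal is a normal in
  the full space.\<close>

locale jordan_domain =
  fixes \<Gamma> Up Um :: "(real^('m::finite option)) set"
    and n :: "real^('m option) \<Rightarrow> real^('m option)" and \<mu> :: "(real^('m option)) measure"
  assumes compact_\<Gamma>: "compact \<Gamma>" and C1_\<Gamma>: "C1_surface TYPE('m) \<Gamma>"
    and open_Up: "open Up" and open_Um: "open Um" and disjoint: "Up \<inter> Um = {}" and partition: "Up \<union> Um = - \<Gamma>"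
    and closure_Up: "\<Gamma> \<subseteq> closure Up"
    and normal: "\<And>y. y \<in> \<Gamma> \<Longrightarrow> unit_normal_towards UNIV \<Gamma> Um y (n y)"
    and measure_\<mu>: "is_surface_measure TYPE('m) \<Gamma> \<mu>"
begin

lemma normal_patch:
  fixes \<phi> :: "real^'m \<Rightarrow> real^('m option)"
  assumes "surface_patch \<Gamma> D \<phi>" "t \<in> D"
  shows "norm (n (\<phi> t)) = 1" "n (\<phi> t) \<bullet> frechet_derivative \<phi> (at t) a = 0"
    "\<exists>\<epsilon>>0. \<forall>s. 0 < s \<and> s < \<epsilon> \<longrightarrow> \<phi> t + s *\<^sub>R n (\<phi> t) \<in> Um"
proof -
  have "\<phi> t \<in> \<Gamma>"
    using surface_patch_subset [OF assms(1)] assms(2) by blast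
  then show "norm (n (\<phi> t)) = 1" "n (\<phi> t) \<bullet> frechet_derivative \<phi> (at t) a = 0"
    "\<exists>\<epsilon>>0. \<forall>s. 0 < s \<and> s < \<epsilon> \<longrightarrow> \<phi> t + s *\<^sub>R n (\<phi> t) \<in> Um"
    using normal [of "\<phi> t"] tangent_vectors_patch [OF assms] by (auto simp: unit_normal_towards_def)
qed

lemma det_flow_derivative:
  fixes \<phi> :: "real^'m \<Rightarrow> real^('m option)"
  assumes "surface_patch \<Gamma> D \<phi>" "t \<in> D"
  shows "\<bar>det (matrix (flow_derivative \<phi> v t))\<bar> = area_element \<phi> t * \<bar>n (\<phi> t) \<bullet> v\<bar>"
  unfolding flow_derivative_def [abs_def] area_element_def
  by (rule det_normal_frame [OF surface_patch_linear [OF assms] surface_patch_immersion [OF assms]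
      normal_patch(1,2) [OF assms]])

text \<open>The flow is a local homeomorphism by the inverse function theorem, and inside a small
  box \<Gamma> is exactly the level \<open>None = 0\<close>. The half boxes are connected and miss
  \<Gamma>, so each lies entirely in \<open>Up\<close> or in \<open>Um\<close>; the direction of the
  normal and \<open>\<Gamma> \<subseteq> closure Up\<close> decide which is which.\<close>

lemma straighten:
  fixes \<phi> :: "real^'m \<Rightarrow> real^('m option)"
  assumes patch: "surface_patch \<Gamma> D \<phi>" and t0: "t0 \<in> D" and v: "n (\<phi> t0) \<bullet> v > 0"
  obtains B \<delta> where "open B" "B \<subseteq> D" "t0 \<in> B" "\<delta> > 0"
    "inj_on (flow \<phi> v) (flow_box B (- \<delta>) \<delta>)"
    "flow \<phi> v ` flow_box B 0 \<delta> \<subseteq> Um" "flow \<phi> v ` flow_box B (- \<delta>) 0 \<subseteq> Up"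
    "\<And>t. t \<in> B \<Longrightarrow> n (\<phi> t) \<bullet> v > 0"
proof -
  let ?\<Phi> = "flow \<phi> v"
  define U where "U = (tpart -` D :: (real^('m option)) set)"
  define F where "F z = Blinfun (flow_derivative \<phi> v (tpart z))" for z
  define z0 where "z0 = join_vec (t0, 0)"
  have z0: "tpart z0 = t0" "z0 $ None = 0" "?\<Phi> z0 = \<phi> t0"
    by (simp_all add: z0_def)
  have "open U"
    unfolding U_def using surface_patch_open [OF patch] continuous_on_tpart continuous_open_vimage
      continuous_on_eq_continuous_at open_UNIV UNIV_I by metis
  have der: "(?\<Phi> has_derivative flow_derivative \<phi> v (tpart z)) (at z)" if "z \<in> U" for z
    using flow_has_derivative [OF patch] that by (simp add: U_def)
  have F: "blinfun_apply (F z) = flow_derivative \<phi> v (tpart z)" if "z \<in> U" for z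
    unfolding F_def using has_derivative_bounded_linear [OF der [OF that]] by (rule bounded_linear_Blinfun_apply)
  have contF: "continuous_on U F"
  proof (rule continuous_on_blinfun_componentwise)
    fix i :: "real^('m option)"
    have "continuous_on U (\<lambda>z. flow_derivative \<phi> v (tpart z) i)"
      unfolding flow_derivative_def
      by (intro continuous_intros continuous_on_compose2 [OF surface_patch_derivative_continuous [OF patch] continuous_on_tpart])
        (auto simp: U_def)
    then show "continuous_on U (\<lambda>z. blinfun_apply (F z) i)"
      by (simp add: F cong: continuous_on_cong)
  qed
  have inj_\<Phi>': "inj (flow_derivative \<phi> v t0)"
  proof -
    have lin: "linear (flow_derivative \<phi> v t0)"
      using has_derivative_linear [OF der [of z0]] t0 by (simp add: U_def z0)
    have "w = 0" if "flow_derivative \<phi> v t0 w = 0" for w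
    proof -
      have "n (\<phi> t0) \<bullet> flow_derivative \<phi> v t0 w = 0"
        using that by simp
      then have "w $ None = 0"
        using v normal_patch(2) [OF patch t0] by (simp add: flow_derivative_def inner_add_right)
      with that have "frechet_derivative \<phi> (at t0) (tpart w) = 0"
        by (simp add: flow_derivative_def)
      then have "tpart w = 0"
        using surface_patch_linear [OF patch t0] surface_patch_immersion [OF patch t0] by (metis linear_injective_0)
      with \<open>w $ None = 0\<close> have "join_vec (tpart w, w $ None) = join_vec (0, 0)"
        by simp
      moreover have "join_vec (0, 0) = 0"
        by (metis linear_0 linear_join_vec zero_prod_def)
      ultimately show "w = 0"
        by simp
    qed
    then show ?thesis
      using lin by (simp add: linear_injective_0)
  qed
  obtain invf where "invf o\<^sub>L F z0 = id_blinfun"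
  proof -
    have lin: "linear (flow_derivative \<phi> v t0)"
      using has_derivative_linear [OF der [of z0]] t0 by (simp add: U_def z0)
    obtain G where G: "linear G" "G \<circ> flow_derivative \<phi> v t0 = id"
      using linear_injective_left_inverse [OF lin inj_\<Phi>'] by auto
    have "Blinfun G o\<^sub>L F z0 = id_blinfun"
    proof (rule blinfun_eqI)
      fix w
      have "blinfun_apply (Blinfun G) = G"
        using G(1) by (simp add: bounded_linear_Blinfun_apply linear_conv_bounded_linear)
      moreover have "G (flow_derivative \<phi> v t0 w) = w"
        using G(2) by (simp add: fun_eq_iff)
      ultimately show "blinfun_apply (Blinfun G o\<^sub>L F z0) w = blinfun_apply id_blinfun w"
        using t0 by (simp add: F U_def z0)
    qed
    then show ?thesis by (rule that)
  qed
  moreover have "(?\<Phi> has_derivative blinfun_apply (F z)) (at z)" if "z \<in> U" for z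
    using der [OF that] by (simp add: F that)
  moreover have "z0 \<in> U"
    using t0 by (simp add: U_def z0)
  ultimately obtain U' V g g' where U': "open U'" "U' \<subseteq> U" "z0 \<in> U'" and V: "open V" "?\<Phi> z0 \<in> V"
    and hom: "homeomorphism U' V ?\<Phi> g"
    and g: "\<And>y. y \<in> V \<Longrightarrow> (g has_derivative g' y) (at y)"
    and g': "\<And>y. y \<in> V \<Longrightarrow> g' y = inv (blinfun_apply (F (g y)))"
    and bij: "\<And>y. y \<in> V \<Longrightarrow> bij (blinfun_apply (F (g y)))"
    using inverse_function_theorem [OF \<open>open U\<close> _ contF] by blast
  have \<Phi>_g: "?\<Phi> (g y) = y" "g y \<in> U'" if "y \<in> V" for y
    using hom that by (auto simp: homeomorphism_def)
  have g_\<Phi>: "g (?\<Phi> z) = z" "?\<Phi> z \<in> V" if "z \<in> U'" for z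
    using hom that by (auto simp: homeomorphism_def)
  have cont_\<Phi>: "continuous_on U' ?\<Phi>"
    using hom by (simp add: homeomorphism_def)
  define D1 where "D1 = {t\<in>D. join_vec (t, 0) \<in> U'}"
  have "open D1"
  proof -
    have "open ((\<lambda>t. join_vec (t, 0)) -` U')"
      using U'(1) by (intro open_vimage) (auto intro!: continuous_intros continuous_on_compose2 [OF continuous_on_join_vec])
    then show ?thesis
      unfolding D1_def using surface_patch_open [OF patch] by (auto simp: Collect_conj_eq vimage_def)
  qed
  then have "openin (top_of_set \<Gamma>) (\<phi> ` D1)"
    by (intro surface_patch_openin [OF surface_patch_mono [OF patch]]) (auto simp: D1_def)
  then obtain T where T: "open T" "\<phi> ` D1 = \<Gamma> \<inter> T"
    by (auto simp: openin_open)
  have "open (U' \<inter> ?\<Phi> -` T)"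
    using continuous_open_preimage [OF cont_\<Phi> U'(1) T(1)] .
  moreover have "z0 \<in> U' \<inter> ?\<Phi> -` T"
  proof -
    have "t0 \<in> D1"
      using t0 U'(3) by (simp add: D1_def z0_def)
    then show ?thesis
      using T(2) U'(3) z0(3) by auto
  qed
  ultimately obtain e where e: "e > 0" "ball z0 e \<subseteq> U' \<inter> ?\<Phi> -` T"
    by (meson open_contains_ball)
  \<comment> \<open>Half of \<open>e\<close>, because the norm of a joined vector is estimated by
    the sum of the norms of its two parts.\<close>
  define r where "r = e / 2"
  define B where "B = ball t0 r"
  have r: "r > 0" and B: "open B" "t0 \<in> B" "convex B"
    using e(1) by (auto simp: r_def B_def)
  have box: "flow_box B (-r) r \<subseteq> U' \<inter> ?\<Phi> -` T"
  proof
    fix z assume "z \<in> flow_box B (-r) r"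
    then have "norm (tpart z - t0) < r" "\<bar>z $ None\<bar> < r"
      by (auto simp: flow_box_def B_def dist_norm norm_minus_commute)
    moreover have "tpart (z - z0) = tpart z - t0" "(z - z0) $ None = z $ None"
      using z0 by (simp_all add: linear_diff [OF linear_tpart])
    ultimately have "norm (z - z0) < e"
      using norm_le_tpart [of "z - z0"] by (simp add: r_def)
    then show "z \<in> U' \<inter> ?\<Phi> -` T"
      using e(2) by (auto simp: dist_norm norm_minus_commute subset_iff)
  qed
  have BD: "B \<subseteq> D"
  proof
    fix t assume "t \<in> B"
    then have "join_vec (t, 0) \<in> flow_box B (-r) r"
      using r by (simp add: flow_box_def)
    then have "join_vec (t, 0) \<in> U"
      using box U'(2) by blast
    then show "t \<in> D" by (simp add: U_def)
  qed
  have on_\<Gamma>: "z $ None = 0" if "z \<in> flow_box B (-r) r" "?\<Phi> z \<in> \<Gamma>" for z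
  proof -
    have "?\<Phi> z \<in> \<phi> ` D1"
      using that box T(2) by blast
    then obtain t where "t \<in> D1" "?\<Phi> z = ?\<Phi> (join_vec (t, 0))"
      by auto
    moreover have "z \<in> U'"
      using that(1) box by blast
    ultimately have "z = join_vec (t, 0)"
      using g_\<Phi>(1) by (metis (mono_tags, lifting) D1_def mem_Collect_eq)
    then show ?thesis by simp
  qed
  have inj: "inj_on ?\<Phi> (flow_box B (-r) r)"
    by (rule inj_on_inverseI [where g = g]) (use box g_\<Phi>(1) in blast)
  have sides: "?\<Phi> ` flow_box B a b \<subseteq> Um \<or> ?\<Phi> ` flow_box B a b \<subseteq> Up"
    if ab: "flow_box B a b \<subseteq> flow_box B (-r) r" "\<And>z. z \<in> flow_box B a b \<Longrightarrow> z $ None \<noteq> 0" for a b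
  proof -
    have "connected (?\<Phi> ` flow_box B a b)"
      using box ab(1) by (intro connected_continuous_image continuous_on_subset [OF cont_\<Phi>]
          convex_connected convex_flow_box B(3)) auto
    moreover have sub: "?\<Phi> ` flow_box B a b \<subseteq> Um \<union> Up"
      using ab on_\<Gamma> partition by fastforce
    ultimately have "Um \<inter> ?\<Phi> ` flow_box B a b = {} \<or> Up \<inter> ?\<Phi> ` flow_box B a b = {}"
      using disjoint open_Um open_Up by (intro connectedD) auto
    then show ?thesis
      using sub by blast
  qed
  have upper: "?\<Phi> ` flow_box B 0 r \<subseteq> Um \<or> ?\<Phi> ` flow_box B 0 r \<subseteq> Up"
    by (rule sides) (use r in \<open>auto simp: flow_box_def\<close>)
  have lower: "?\<Phi> ` flow_box B (-r) 0 \<subseteq> Um \<or> ?\<Phi> ` flow_box B (-r) 0 \<subseteq> Up"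
    by (rule sides) (use r in \<open>auto simp: flow_box_def\<close>)
  \<comment> \<open>Follow the normal ray in straightened coordinates. Its \<open>None\<close>
    coordinate starts at 0 with derivative \<open>w $ None\<close>, where
    \<open>w $ None * (n y \<bullet> v) = 1\<close>; so the ray, which runs into \<open>Um\<close>,
    leaves on the side given by the sign of \<open>n y \<bullet> v\<close>. The same equation shows
    that this number is not 0.\<close>
  have transversal: "n (\<phi> t) \<bullet> v \<noteq> 0 \<and>
      (\<exists>z\<in>flow_box B (-r) r. ?\<Phi> z \<in> Um \<and> (if n (\<phi> t) \<bullet> v > 0 then z $ None > 0 else z $ None < 0))"
    if t: "t \<in> B" for t
  proof -
    define z where "z = join_vec (t, 0)"
    define y where "y = \<phi> t"
    have z: "z \<in> flow_box B (-r) r" "?\<Phi> z = y" "tpart z = t"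
      using t r by (auto simp: flow_box_def z_def y_def)
    then have "z \<in> U'" using box by blast
    then have y: "y \<in> V" "g y = z"
      using g_\<Phi> [of z] z by auto
    have tD: "t \<in> D" using t BD by blast
    have F_z: "blinfun_apply (F z) = flow_derivative \<phi> v t"
      using F [of z] U'(2) \<open>z \<in> U'\<close> z(3) by auto
    define w where "w = g' y (n y)"
    have "flow_derivative \<phi> v t w = n y"
      using bij [OF y(1)] g' [OF y(1)] F_z y(2) by (simp add: w_def bij_is_surj surj_f_inv_f)
    then have "n y \<bullet> flow_derivative \<phi> v t w = 1"
      using normal_patch(1) [OF patch tD] by (simp add: y_def norm_eq_1)
    then have w: "w $ None * (n y \<bullet> v) = 1"
      using normal_patch(2) [OF patch tD] by (simp add: flow_derivative_def y_def inner_add_right)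
    define k where "k \<tau> = g (y + \<tau> *\<^sub>R n y) $ None" for \<tau>
    have "((\<lambda>\<tau>. y + \<tau> *\<^sub>R n y) has_derivative (\<lambda>\<tau>. \<tau> *\<^sub>R n y)) (at 0)"
      by (auto intro!: derivative_eq_intros)
    moreover have "(g has_derivative g' y) (at (y + 0 *\<^sub>R n y))"
      using g [OF y(1)] by simp
    ultimately have gder: "((\<lambda>\<tau>. g (y + \<tau> *\<^sub>R n y)) has_derivative (\<lambda>\<tau>. g' y (\<tau> *\<^sub>R n y))) (at 0)"
      by (rule has_derivative_compose)
    have "(k has_derivative (\<lambda>\<tau>. g' y (\<tau> *\<^sub>R n y) $ None)) (at 0)"
      unfolding k_def by (rule bounded_linear.has_derivative [OF bounded_linear_vec_nth gder])
    moreover have "(\<lambda>\<tau>. g' y (\<tau> *\<^sub>R n y) $ None) = (*) (w $ None)"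
      using has_derivative_linear [OF g [OF y(1)]] by (auto simp: w_def linear_cmul)
    ultimately have k: "(k has_real_derivative w $ None) (at 0)"
      by (simp add: has_field_derivative_def)
    have k0: "k 0 = 0"
      by (simp add: k_def y z_def)
    have "open (flow_box B (-r) r)"
      using B(1) by (rule open_flow_box)
    moreover have "isCont (\<lambda>\<tau>. g (y + \<tau> *\<^sub>R n y)) 0"
      using gder has_derivative_continuous by blast
    ultimately have "\<forall>\<^sub>F \<tau> in at 0. g (y + \<tau> *\<^sub>R n y) \<in> flow_box B (-r) r"
      using z(1) y(2) by (intro topological_tendstoD [of _ z]) (auto simp: isCont_def)
    moreover have "\<forall>\<^sub>F \<tau> in at (0::real). y + \<tau> *\<^sub>R n y \<in> V"
      using y(1) V(1) by (intro topological_tendstoD [of _ y]) (auto intro!: tendsto_eq_intros)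
    ultimately have "\<forall>\<^sub>F \<tau> in at 0. g (y + \<tau> *\<^sub>R n y) \<in> flow_box B (-r) r \<and> y + \<tau> *\<^sub>R n y \<in> V"
      by (rule eventually_conj)
    then obtain d where d: "d > 0" "\<And>\<tau>. 0 < \<tau> \<Longrightarrow> \<tau> < d \<Longrightarrow> g (y + \<tau> *\<^sub>R n y) \<in> flow_box B (-r) r \<and> y + \<tau> *\<^sub>R n y \<in> V"
      unfolding eventually_at by (auto simp: dist_real_def)
    obtain \<epsilon> where \<epsilon>: "\<epsilon> > 0" "\<And>\<tau>. 0 < \<tau> \<Longrightarrow> \<tau> < \<epsilon> \<Longrightarrow> y + \<tau> *\<^sub>R n y \<in> Um"
      using normal_patch(3) [OF patch tD] by (auto simp: y_def)
    have *: "g (y + \<tau> *\<^sub>R n y) \<in> flow_box B (-r) r \<and> ?\<Phi> (g (y + \<tau> *\<^sub>R n y)) \<in> Um"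
      if "0 < \<tau>" "\<tau> < d" "\<tau> < \<epsilon>" for \<tau>
      using d(2) [of \<tau>] \<epsilon>(2) [of \<tau>] that \<Phi>_g by auto
    show ?thesis
    proof (cases "n y \<bullet> v > 0")
      case True
      then have "w $ None > 0"
        using w by (metis mult_less_0_iff not_less_iff_gr_or_eq zero_less_one mult_zero_left less_asym)
      then obtain d' where d': "d' > 0" "\<And>h. 0 < h \<Longrightarrow> h < d' \<Longrightarrow> k 0 < k (0 + h)"
        using DERIV_pos_inc_right [OF k] by metis
      define \<tau> where "\<tau> = min (min d \<epsilon>) d' / 2"
      have "0 < \<tau>" "\<tau> < d" "\<tau> < \<epsilon>" "\<tau> < d'"
        using d(1) \<epsilon>(1) d'(1) by (auto simp: \<tau>_def min_def)
      then have "g (y + \<tau> *\<^sub>R n y) $ None > 0"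
        using d'(2) [of \<tau>] k0 by (simp add: k_def)
      then show ?thesis
        using True * [OF \<open>0 < \<tau>\<close> \<open>\<tau> < d\<close> \<open>\<tau> < \<epsilon>\<close>] by (auto simp: y_def)
    next
      case False
      with w have neg: "n y \<bullet> v < 0"
        by (metis linorder_neqE_linordered_idom mult_zero_right zero_neq_one)
      then have "w $ None < 0"
        using w by (metis mult_less_0_iff not_less_iff_gr_or_eq zero_less_one mult_zero_left less_asym)
      then obtain d' where d': "d' > 0" "\<And>h. 0 < h \<Longrightarrow> h < d' \<Longrightarrow> k 0 > k (0 + h)"
        using DERIV_neg_dec_right [OF k] by metis
      define \<tau> where "\<tau> = min (min d \<epsilon>) d' / 2"
      have "0 < \<tau>" "\<tau> < d" "\<tau> < \<epsilon>" "\<tau> < d'"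
        using d(1) \<epsilon>(1) d'(1) by (auto simp: \<tau>_def min_def)
      then have "g (y + \<tau> *\<^sub>R n y) $ None < 0"
        using d'(2) [of \<tau>] k0 by (simp add: k_def)
      then show ?thesis
        using False neg * [OF \<open>0 < \<tau>\<close> \<open>\<tau> < d\<close> \<open>\<tau> < \<epsilon>\<close>] by (auto simp: y_def)
    qed
  qed
  have upper_Um: "?\<Phi> ` flow_box B 0 r \<subseteq> Um"
  proof -
    obtain z where "z \<in> flow_box B 0 r" "?\<Phi> z \<in> Um"
      using transversal [OF B(2)] v by (auto simp: flow_box_def)
    then show ?thesis
      using upper disjoint by blast
  qed
  \<comment> \<open>\<open>Up\<close> accumulates at \<open>\<phi> t0\<close>, so it meets the open
    image of the box; neither the level 0, which is \<Gamma>, nor the upper half, which lies in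
    \<open>Um\<close>, can contain such a point.\<close>
  have lower_Up: "?\<Phi> ` flow_box B (-r) 0 \<subseteq> Up"
  proof -
    have "open (?\<Phi> ` flow_box B (-r) r)"
      using box by (intro invariance_of_domain inj open_flow_box B(1) continuous_on_subset [OF cont_\<Phi>]) auto
    moreover have "\<phi> t0 \<in> ?\<Phi> ` flow_box B (-r) r"
      using B(2) r z0 by (intro image_eqI [of _ _ z0]) (auto simp: flow_box_def)
    moreover have "\<phi> t0 \<in> closure Up"
      using closure_Up surface_patch_subset [OF patch] t0 by blast
    ultimately have "?\<Phi> ` flow_box B (-r) r \<inter> Up \<noteq> {}"
      using open_Int_closure_eq_empty by blast
    then obtain z where z: "z \<in> flow_box B (-r) r" "?\<Phi> z \<in> Up"
      by blast
    moreover have "z $ None \<noteq> 0"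
    proof
      assume "z $ None = 0"
      then have "?\<Phi> z \<in> \<Gamma>"
        using z(1) BD surface_patch_subset [OF patch] by (auto simp: flow_def flow_box_def)
      then show False using z(2) partition by blast
    qed
    moreover have "\<not> z $ None > 0"
      using z upper_Um disjoint by (auto simp: flow_box_def)
    ultimately have "z \<in> flow_box B (-r) 0"
      by (auto simp: flow_box_def)
    then show ?thesis
      using lower z(2) disjoint by blast
  qed
  show ?thesis
  proof (rule that [OF B(1) BD B(2) r inj upper_Um lower_Up])
    fix t assume t: "t \<in> B"
    show "n (\<phi> t) \<bullet> v > 0"
    proof (rule ccontr)
      assume "\<not> ?thesis"
      \<comment> \<open>With a negative normal component the ray at \<open>t\<close> would carry
        points of \<open>Um\<close> into the lower half box.\<close>
      then obtain z where "z \<in> flow_box B (-r) 0" "?\<Phi> z \<in> Um"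
        using transversal [OF t] by (auto simp: flow_box_def)
      then show False
        using lower_Up disjoint by blast
    qed
  qed
qed

end

context jordan_domain
begin

lemma closed_domain: "closed (Um \<union> \<Gamma>)"
proof -
  have "Um \<union> \<Gamma> = - Up"
    using disjoint partition by blast
  then show ?thesis
    using open_Up by auto
qed

text \<open>\<open>K\<close> may meet \<Gamma>, so \<open>u\<close> keeps its boundary values.
  Differentiability is taken within the closed domain, and at points of \<Gamma> the derivative is
  given as a continuous choice \<open>u'\<close>.\<close>

definition C1_supported ::
  "(real^('m option) \<Rightarrow> 'b::euclidean_space) \<Rightarrow> (real^('m option) \<Rightarrow> (real^('m option)) \<Rightarrow>\<^sub>L 'b) \<Rightarrow> (real^('m option)) set \<Rightarrow> bool" where
  "C1_supported u u' K \<longleftrightarrow> compact K \<and> continuous_on (Um \<union> \<Gamma>) u' \<and>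
     (\<forall>y\<in>Um \<union> \<Gamma>. (u has_derivative blinfun_apply (u' y)) (at y within Um \<union> \<Gamma>)) \<and>
     (\<forall>y\<in>(Um \<union> \<Gamma>) - K. u y = 0)"

text \<open>The divergence theorem for the field \<open>u\<close> times the constant vector
  \<open>v\<close>. The minus sign appears because \<open>n\<close> points into \<open>Um\<close>,
  hence is the inner normal of the domain of integration.\<close>

definition gauss ::
  "real^('m option) \<Rightarrow> (real^('m option) \<Rightarrow> 'b::euclidean_space) \<Rightarrow> (real^('m option) \<Rightarrow> (real^('m option)) \<Rightarrow>\<^sub>L 'b) \<Rightarrow> bool" where
  "gauss v u u' \<longleftrightarrow> has_bochner_integral \<mu> (\<lambda>y. indicator \<Gamma> y *\<^sub>R (n y \<bullet> v) *\<^sub>R u y)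
     (- (\<integral>y. indicator Um y *\<^sub>R u' y v \<partial>lborel))"

lemma C1_supportedD:
  fixes u :: "real^('m option) \<Rightarrow> 'b::euclidean_space"
  assumes "C1_supported u u' K"
  shows C1_supported_compact: "compact K"
    and C1_supported_continuous_derivative: "continuous_on (Um \<union> \<Gamma>) u'"
    and C1_supported_derivative: "y \<in> Um \<Longrightarrow> (u has_derivative blinfun_apply (u' y)) (at y)"
    and C1_supported_zero: "y \<in> Um \<union> \<Gamma> \<Longrightarrow> y \<notin> K \<Longrightarrow> u y = 0"
    and C1_supported_continuous: "continuous_on (Um \<union> \<Gamma>) u"
    and C1_supported_derivative_zero: "y \<in> Um \<Longrightarrow> y \<notin> K \<Longrightarrow> u' y = 0"
proof -
  show "compact K" and "continuous_on (Um \<union> \<Gamma>) u'" and zero: "y \<in> Um \<union> \<Gamma> \<Longrightarrow> y \<notin> K \<Longrightarrow> u y = 0" for y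
    using assms by (auto simp: C1_supported_def)
  show der: "(u has_derivative blinfun_apply (u' y)) (at y)" if "y \<in> Um" for y
  proof -
    have "(u has_derivative blinfun_apply (u' y)) (at y within Um)"
      using assms that unfolding C1_supported_def by (meson UnI1 Un_upper1 has_derivative_subset)
    then show ?thesis
      unfolding at_within_open [OF that open_Um] .
  qed
  show "continuous_on (Um \<union> \<Gamma>) u"
    using assms unfolding C1_supported_def continuous_on_eq_continuous_within
    by (meson has_derivative_continuous)
  show "u' y = 0" if "y \<in> Um" "y \<notin> K" for y
  proof -
    have "open (Um - K)"
      using open_Um assms by (auto simp: C1_supported_def intro: open_Diff compact_imp_closed)
    from has_derivative_transform_within_open [OF der [OF that(1)] this, of "\<lambda>_. 0"]
    have "((\<lambda>_. 0) has_derivative blinfun_apply (u' y)) (at y)"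
      using that zero by auto
    then have "blinfun_apply (u' y) = (\<lambda>_. 0)"
      using has_derivative_unique [OF _ has_derivative_const] by blast
    then show ?thesis
      by (simp add: blinfun_eqI)
  qed
qed

lemma C1_supported_bounded:
  fixes u :: "real^('m option) \<Rightarrow> 'b::euclidean_space"
  assumes "C1_supported u u' K"
  obtains M where "\<And>y. y \<in> Um \<Longrightarrow> norm (u' y v) \<le> M"
proof -
  note u = C1_supportedD [OF assms]
  have "compact ((Um \<union> \<Gamma>) \<inter> K)"
    using closed_domain u(1) by (simp add: closed_Int_compact)
  then have "compact ((\<lambda>y. u' y v) ` ((Um \<union> \<Gamma>) \<inter> K))"
    by (intro compact_continuous_image continuous_intros continuous_on_subset [OF u(2)]) auto
  from compact_imp_bounded [OF this]
  obtain M where M: "\<forall>y\<in>(Um \<union> \<Gamma>) \<inter> K. norm (u' y v) \<le> M"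
    unfolding bounded_iff ball_simps by (elim exE) (rule that)
  have "norm (u' y v) \<le> max M 0" if "y \<in> Um" for y
    using M u(6) [of y] that by (cases "y \<in> K") (auto simp: le_max_iff_disj)
  then show ?thesis by (rule that)
qed

lemma C1_supported_derivative_borel:
  fixes u :: "real^('m option) \<Rightarrow> 'b::euclidean_space"
  assumes "C1_supported u u' K"
  shows "(\<lambda>y. indicator Um y *\<^sub>R u' y v) \<in> borel_measurable borel"
  by (intro borel_measurable_indicator_times open_Um continuous_intros
      continuous_on_subset [OF C1_supported_continuous_derivative [OF assms]]) auto

lemma C1_supported_integrable:
  fixes u :: "real^('m option) \<Rightarrow> 'b::euclidean_space"
  assumes "C1_supported u u' K"
  shows "integrable lborel (\<lambda>y. indicator Um y *\<^sub>R u' y v)"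
proof -
  note u = C1_supportedD [OF assms]
  obtain M where M: "\<And>y. y \<in> Um \<Longrightarrow> norm (u' y v) \<le> M"
    using C1_supported_bounded [OF assms] by blast
  show ?thesis
  proof (rule integrableI_bounded_set)
    show "K \<in> sets lborel" using u(1) by (simp add: borel_compact)
    show "emeasure lborel K < \<infinity>" using u(1) by (rule emeasure_compact_finite)
    show "AE y in lborel. y \<in> K \<longrightarrow> norm (indicator Um y *\<^sub>R u' y v) \<le> max M 0"
      using M by (auto simp: indicator_def le_max_iff_disj)
    show "AE y in lborel. y \<notin> K \<longrightarrow> indicator Um y *\<^sub>R u' y v = 0"
      using u(6) by (auto simp: indicator_def)
    show "(\<lambda>y. indicator Um y *\<^sub>R u' y v) \<in> borel_measurable lborel"
      using C1_supported_derivative_borel [OF assms] by simp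
  qed
qed

text \<open>
  For a constant transversal direction \<open>v\<close> the Jacobian of \<open>(t, s) \<mapsto> \<phi> t + s v\<close> does not depend on
  \<open>s\<close>, so that the fundamental theorem of calculus in \<open>s\<close> applies.
\<close>

lemma gauss_transversal:
  fixes \<phi> :: "real^'m \<Rightarrow> real^('m option)" and u :: "real^('m option) \<Rightarrow> 'b::euclidean_space"
  assumes patch: "surface_patch \<Gamma> D \<phi>" and B: "open B" "B \<subseteq> D" and \<delta>: "0 < \<delta>" "\<delta> < \<epsilon>"
    and inj: "inj_on (flow \<phi> v) (flow_box B (- \<epsilon>) \<epsilon>)"
    and Um: "flow \<phi> v ` flow_box B 0 \<epsilon> \<subseteq> Um" and Up: "flow \<phi> v ` flow_box B (- \<epsilon>) 0 \<subseteq> Up"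
    and n: "\<And>t. t \<in> B \<Longrightarrow> n (\<phi> t) \<bullet> v > 0"
    and u: "C1_supported u u' K" and K: "K \<subseteq> flow \<phi> v ` flow_box B (- \<delta>) \<delta>"
  shows "gauss v u u'"
proof -
  let ?\<Phi> = "flow \<phi> v" and ?S = "flow_box B 0 \<delta>"
  note uD = C1_supportedD [OF u]
  have patchB: "surface_patch \<Gamma> B \<phi>"
    by (rule surface_patch_mono [OF patch B])
  define f where "f y = indicator Um y *\<^sub>R u' y v" for y
  define I where "I = (\<integral>y. f y \<partial>lborel)"
  have f_borel: "f \<in> borel_measurable borel"
    unfolding f_def [abs_def] by (rule C1_supported_derivative_borel [OF u])
  have f_int: "has_bochner_integral lborel f I"
    unfolding I_def f_def [abs_def] using C1_supported_integrable [OF u] by (rule has_bochner_integral_integrable)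
  obtain M where M: "\<And>y. y \<in> Um \<Longrightarrow> norm (u' y v) \<le> M"
    using C1_supported_bounded [OF u] by blast
  have on_\<Gamma>: "?\<Phi> z = \<phi> (tpart z)" "?\<Phi> z \<in> \<Gamma>" if "z \<in> flow_box B (-\<epsilon>) \<epsilon>" "z $ None = 0" for z
    using that B surface_patch_subset [OF patch] by (auto simp: flow_def flow_box_def)
  have K_side: "\<exists>z\<in>flow_box B (-\<delta>) \<delta>. y = ?\<Phi> z \<and> (y \<in> Um \<longrightarrow> z $ None > 0) \<and> (y \<in> \<Gamma> \<longrightarrow> z $ None = 0)" if y: "y \<in> K" for y
  proof -
    obtain z where z: "z \<in> flow_box B (-\<delta>) \<delta>" "y = ?\<Phi> z"
      using K y by blast
    then have z\<epsilon>: "z \<in> flow_box B (-\<epsilon>) \<epsilon>"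
      using \<delta> by (auto simp: flow_box_def)
    consider "z $ None > 0" | "z $ None = 0" | "z $ None < 0" by linarith
    then show ?thesis
    proof cases
      case 1
      then have "z \<in> flow_box B 0 \<epsilon>" using z\<epsilon> by (auto simp: flow_box_def)
      then show ?thesis using 1 z Um partition by blast
    next
      case 2
      then show ?thesis using on_\<Gamma> [OF z\<epsilon>] z partition by blast
    next
      case 3
      then have "z \<in> flow_box B (-\<epsilon>) 0" using z\<epsilon> by (auto simp: flow_box_def)
      then have "y \<in> Up" using z Up by blast
      then show ?thesis using z partition disjoint by blast
    qed
  qed
  have openS: "open ?S" by (rule open_flow_box [OF B(1)])
  \<comment> \<open>\<open>u'\<close> vanishes on \<open>Um\<close> off \<open>K\<close>, and points
    of \<open>K\<close> in \<open>Um\<close> have positive \<open>None\<close> coordinate; so the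
    volume integral lives on the image of the upper half box.\<close>
  have f_restrict: "indicator (?\<Phi> ` ?S) y *\<^sub>R f y = f y" for y
  proof (cases "y \<in> ?\<Phi> ` ?S")
    case False
    have "f y = 0"
    proof (cases "y \<in> Um \<and> y \<in> K")
      case True
      then have "y \<in> ?\<Phi> ` ?S"
        using K_side [of y] by (auto simp: flow_box_def)
      with False show ?thesis by simp
    qed (use uD(6) in \<open>auto simp: f_def indicator_def\<close>)
    then show ?thesis by simp
  qed simp
  define J where "J t = area_element \<phi> t * (n (\<phi> t) \<bullet> v)" for t
  have J: "J t = \<bar>det (matrix (flow_derivative \<phi> v t))\<bar>" if "t \<in> B" for t
    using det_flow_derivative [OF patchB that] n [OF that] by (simp add: J_def)
  \<comment> \<open>Continuity is read off the determinant, as \<open>n\<close> is not assumed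
    continuous. Dividing \<open>J\<close> by the area element will later give continuity of
    \<open>n y \<bullet> v\<close> along the patch.\<close>
  have cont_J: "continuous_on B J"
  proof -
    have "continuous_on B (\<lambda>t. \<bar>det (matrix (flow_derivative \<phi> v t))\<bar>)"
      unfolding det_def matrix_def flow_derivative_def
      by (auto intro!: continuous_intros surface_patch_derivative_continuous [OF patchB])
    then show ?thesis
      by (simp add: J cong: continuous_on_cong)
  qed
  have h_int: "has_bochner_integral lborel (\<lambda>z. indicator ?S z *\<^sub>R J (tpart z) *\<^sub>R f (?\<Phi> z)) I"
  proof (subst has_bochner_integral_change_of_variables [symmetric])
    show "inj_on ?\<Phi> ?S"
      using inj by (rule inj_on_subset) (use \<delta> in \<open>auto simp: flow_box_def\<close>)
    show "(?\<Phi> has_derivative flow_derivative \<phi> v (tpart z)) (at z)" if "z \<in> ?S" for z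
      using that by (intro flow_has_derivative [OF patchB]) (auto simp: flow_box_def)
    show "continuous_on ?S (\<lambda>z. J (tpart z))"
      by (rule continuous_on_compose2 [OF cont_J continuous_on_tpart]) (auto simp: flow_box_def)
    show "J (tpart z) = \<bar>det (matrix (flow_derivative \<phi> v (tpart z)))\<bar>" if "z \<in> ?S" for z
      using that by (intro J) (auto simp: flow_box_def)
    show "has_bochner_integral lborel (\<lambda>y. indicator (?\<Phi> ` ?S) y *\<^sub>R f y) I"
      using f_int by (simp add: f_restrict)
  qed (use openS f_borel in auto)
  define h where "h z = indicator ?S z *\<^sub>R J (tpart z) *\<^sub>R f (?\<Phi> z)" for z
  have h_join: "h (join_vec (t, s)) = indicator B t *\<^sub>R J t *\<^sub>R indicator {0<..<\<delta>} s *\<^sub>R f (\<phi> t + s *\<^sub>R v)" for t s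
    by (auto simp: h_def indicator_def flow_box_def)
  have join_meas: "join_vec \<in> lborel \<Otimes>\<^sub>M lborel \<rightarrow>\<^sub>M (borel :: (real^('m option)) measure)"
    by (simp add: lborel_prod borel_measurable_continuous_onI continuous_on_join_vec)
  have h_borel: "h \<in> borel_measurable borel"
    using h_int has_bochner_integral_iff borel_measurable_integrable unfolding h_def [abs_def] by fastforce
  have hj_int: "integrable (lborel \<Otimes>\<^sub>M lborel) (\<lambda>z. h (join_vec z))"
    and hj_I: "(\<integral>z. h (join_vec z) \<partial>(lborel \<Otimes>\<^sub>M lborel)) = I"
    using h_int integrable_distr_eq [OF join_meas h_borel] integral_distr [OF join_meas h_borel]
    by (simp_all add: distr_lborel_join_vec has_bochner_integral_iff h_def [abs_def])
  \<comment> \<open>Integrating the derivative along the segment from \<open>\<phi> t\<close> to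
    \<open>\<phi> t + \<delta> *\<^sub>R v\<close> leaves only the boundary value at the lower end,
    weighted by a Jacobian independent of \<open>s\<close>.\<close>
  have inner: "(\<integral>s. h (join_vec (t, s)) \<partial>lborel) = indicator B t *\<^sub>R J t *\<^sub>R (- u (\<phi> t))" for t
  proof (cases "t \<in> B")
    case t: True
    have in_Um: "\<phi> t + s *\<^sub>R v \<in> Um" if "0 < s" "s < \<epsilon>" for s
    proof -
      have "join_vec (t, s) \<in> flow_box B 0 \<epsilon>"
        using that t by (simp add: flow_box_def)
      then have "?\<Phi> (join_vec (t, s)) \<in> Um"
        using Um by blast
      then show ?thesis by simp
    qed
    have \<phi>t: "\<phi> t \<in> \<Gamma>"
      using t surface_patch_subset [OF patchB] by blast
    let ?g = "\<lambda>s. indicator {0<..<\<delta>} s *\<^sub>R f (\<phi> t + s *\<^sub>R v)"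
    have cont_u: "continuous_on {0..\<delta>} (\<lambda>s. u (\<phi> t + s *\<^sub>R v))"
    proof (rule continuous_on_compose2 [OF uD(5)])
      show "(\<lambda>s. \<phi> t + s *\<^sub>R v) ` {0..\<delta>} \<subseteq> Um \<union> \<Gamma>"
      proof
        fix y assume "y \<in> (\<lambda>s. \<phi> t + s *\<^sub>R v) ` {0..\<delta>}"
        then obtain s where s: "0 \<le> s" "s \<le> \<delta>" "y = \<phi> t + s *\<^sub>R v" by auto
        then show "y \<in> Um \<union> \<Gamma>"
          using in_Um [of s] \<phi>t \<delta> by (cases "s = 0") auto
      qed
    qed (intro continuous_intros)
    have "((\<lambda>s. f (\<phi> t + s *\<^sub>R v)) has_integral u (\<phi> t + \<delta> *\<^sub>R v) - u (\<phi> t + 0 *\<^sub>R v)) {0..\<delta>}"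
    proof (rule fundamental_theorem_of_calculus_interior [OF _ cont_u])
      fix s assume "s \<in> {0<..<\<delta>}"
      then have s: "\<phi> t + s *\<^sub>R v \<in> Um"
        using in_Um \<delta> by auto
      have "((\<lambda>s. \<phi> t + s *\<^sub>R v) has_derivative (\<lambda>s. s *\<^sub>R v)) (at s)"
        by (auto intro!: derivative_eq_intros)
      then have "((\<lambda>s. u (\<phi> t + s *\<^sub>R v)) has_derivative (\<lambda>r. u' (\<phi> t + s *\<^sub>R v) (r *\<^sub>R v))) (at s)"
        by (rule has_derivative_compose) (rule uD(3) [OF s])
      then show "((\<lambda>s. u (\<phi> t + s *\<^sub>R v)) has_vector_derivative f (\<phi> t + s *\<^sub>R v)) (at s)"
        using s by (simp add: has_vector_derivative_def f_def blinfun.scaleR_right)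
    qed (use \<delta> in simp)
    \<comment> \<open>The reason for the larger box of height \<epsilon>: the flow is injective
      there, so the point at height exactly \<delta> cannot coincide with a point of the open
      \<delta>-box that contains the preimage of \<open>K\<close>.\<close>
    moreover have "u (\<phi> t + \<delta> *\<^sub>R v) = 0"
    proof (rule uD(4))
      show "\<phi> t + \<delta> *\<^sub>R v \<in> Um \<union> \<Gamma>"
        using in_Um \<delta> by blast
      show "\<phi> t + \<delta> *\<^sub>R v \<notin> K"
      proof
        assume "\<phi> t + \<delta> *\<^sub>R v \<in> K"
        then obtain z where z: "z \<in> flow_box B (-\<delta>) \<delta>" "?\<Phi> (join_vec (t, \<delta>)) = ?\<Phi> z"
          using K by force
        moreover have "z \<in> flow_box B (-\<epsilon>) \<epsilon>" "join_vec (t, \<delta>) \<in> flow_box B (-\<epsilon>) \<epsilon>"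
          using z(1) t \<delta> by (auto simp: flow_box_def)
        ultimately have "join_vec (t, \<delta>) = z"
          using inj_onD [OF inj z(2)] by blast
        then show False
          using z(1) by (auto simp: flow_box_def)
      qed
    qed
    ultimately have HK: "((\<lambda>s. f (\<phi> t + s *\<^sub>R v)) has_integral - u (\<phi> t)) {0<..<\<delta>}"
      by (simp add: has_integral_Icc_iff_Ioo)
    have g_eq: "?g = (\<lambda>s. if s \<in> {0<..<\<delta>} then f (\<phi> t + s *\<^sub>R v) else 0)"
      by (auto simp: indicator_def)
    have HK': "(?g has_integral - u (\<phi> t)) UNIV"
      unfolding g_eq has_integral_restrict_UNIV by (rule HK)
    have "integrable lborel ?g"
    proof (rule integrableI_bounded_set)
      show "AE s in lborel. s \<in> {0<..<\<delta>} \<longrightarrow> norm (?g s) \<le> M"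
        using M in_Um \<delta> by (auto simp: f_def)
      show "?g \<in> borel_measurable lborel"
        using f_borel by measurable
    qed (use \<delta> in auto)
    then have "(\<integral>s. ?g s \<partial>lborel) = - u (\<phi> t)"
      using HK' integral_lborel integral_unique by metis
    then show ?thesis
      by (simp add: h_join del: scaleR_scaleR)
  qed (simp add: h_join)
  have outer: "has_bochner_integral lborel (\<lambda>t. indicator B t *\<^sub>R J t *\<^sub>R (- u (\<phi> t))) I"
    using lborel_pair.integrable_fst' [OF hj_int] lborel_pair.integral_fst' [OF hj_int] hj_I
    by (simp only: inner has_bochner_integral_iff)
  let ?w = "\<lambda>y. (n y \<bullet> v) *\<^sub>R u y"
  have "has_bochner_integral lborel (\<lambda>t. indicator B t *\<^sub>R area_element \<phi> t *\<^sub>R ?w (\<phi> t)) (- I)"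
    using has_bochner_integral_minus [OF outer] by (simp add: J_def)
  moreover have "continuous_on (\<phi> ` B) ?w"
  proof (rule continuous_on_scaleR)
    have "continuous_on B (\<lambda>t. J t / area_element \<phi> t)"
      using area_element_pos [OF patchB]
      by (intro continuous_intros cont_J continuous_on_area_element [OF patchB]) (metis less_irrefl)
    moreover have "the_inv_into B \<phi> ` \<phi> ` B \<subseteq> B"
      using surface_patch_inj [OF patchB] by (auto simp: the_inv_into_f_f)
    ultimately have "continuous_on (\<phi> ` B) (\<lambda>y. J (the_inv_into B \<phi> y) / area_element \<phi> (the_inv_into B \<phi> y))"
      by (rule continuous_on_compose2 [OF _ surface_patch_inverse [OF patchB]])
    moreover have "J (the_inv_into B \<phi> y) / area_element \<phi> (the_inv_into B \<phi> y) = n y \<bullet> v" if "y \<in> \<phi> ` B" for y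
      using that surface_patch_inj [OF patchB] area_element_pos [OF patchB]
      by (auto simp: J_def the_inv_into_f_f less_imp_neq [symmetric])
    ultimately show "continuous_on (\<phi> ` B) (\<lambda>y. n y \<bullet> v)"
      by (simp cong: continuous_on_cong)
    show "continuous_on (\<phi> ` B) u"
      using surface_patch_subset [OF patchB] by (intro continuous_on_subset [OF uD(5)]) auto
  qed
  ultimately have surface: "has_bochner_integral \<mu> (\<lambda>y. indicator (\<phi> ` B) y *\<^sub>R ?w y) (- I)"
    by (subst has_bochner_integral_surface_patch [OF measure_\<mu> compact_\<Gamma> patchB])
  have indicator_eq: "indicator (\<phi> ` B) y *\<^sub>R ?w y = indicator \<Gamma> y *\<^sub>R ?w y" for y
  proof (cases "y \<in> \<Gamma> - \<phi> ` B")
    case True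
    have "u y = 0"
    proof (rule uD(4))
      show "y \<notin> K"
      proof
        assume "y \<in> K"
        then obtain z where z: "z \<in> flow_box B (-\<delta>) \<delta>" "y = ?\<Phi> z" "z $ None = 0"
          using K_side True by blast
        then show False
          using True on_\<Gamma>(1) [of z] \<delta> by (auto simp: flow_box_def)
      qed
    qed (use True in simp)
    then show ?thesis by simp
  qed (use surface_patch_subset [OF patchB] in \<open>auto simp: indicator_def\<close>)
  show ?thesis
    using surface unfolding indicator_eq by (simp only: gauss_def I_def f_def)
qed

lemma gauss_boundary_point:
  assumes y0: "y0 \<in> \<Gamma>"
  obtains N where "open N" "y0 \<in> N"
    "\<And>(u :: real^('m option) \<Rightarrow> 'b::euclidean_space) u' K. C1_supported u u' K \<Longrightarrow> K \<subseteq> N \<Longrightarrow> gauss v u u'"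
proof -
  obtain D :: "(real^'m) set" and \<phi> where patch: "surface_patch \<Gamma> D \<phi>" and "y0 \<in> \<phi> ` D"
    using C1_\<Gamma> y0 by (auto simp: C1_surface_def)
  then obtain t0 where t0: "t0 \<in> D" "y0 = \<phi> t0" by auto
  have transversal: "\<exists>N. open N \<and> y0 \<in> N \<and>
      (\<forall>(u :: real^('m option) \<Rightarrow> 'b) u' K. C1_supported u u' K \<longrightarrow> K \<subseteq> N \<longrightarrow> gauss w u u')"
    if w: "n (\<phi> t0) \<bullet> w > 0" for w
  proof -
    obtain B \<epsilon> where B: "open B" "B \<subseteq> D" "t0 \<in> B" "\<epsilon> > 0"
      and inj: "inj_on (flow \<phi> w) (flow_box B (- \<epsilon>) \<epsilon>)"
      and *: "flow \<phi> w ` flow_box B 0 \<epsilon> \<subseteq> Um" "flow \<phi> w ` flow_box B (- \<epsilon>) 0 \<subseteq> Up"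
        "\<And>t. t \<in> B \<Longrightarrow> n (\<phi> t) \<bullet> w > 0"
      using straighten [OF patch t0(1) w] by blast
    define \<delta> where "\<delta> = \<epsilon> / 2"
    have \<delta>: "0 < \<delta>" "\<delta> < \<epsilon>" using B(4) by (auto simp: \<delta>_def)
    let ?N = "flow \<phi> w ` flow_box B (- \<delta>) \<delta>"
    have sub: "flow_box B (- \<delta>) \<delta> \<subseteq> flow_box B (- \<epsilon>) \<epsilon>"
      using \<delta> by (auto simp: flow_box_def)
    have "open ?N"
    proof (rule invariance_of_domain)
      show "continuous_on (flow_box B (- \<delta>) \<delta>) (flow \<phi> w)"
        using flow_has_derivative [OF patch] B(2)
        by (intro continuous_at_imp_continuous_on ballI has_derivative_continuous) (auto simp: flow_box_def)
    qed (use inj sub inj_on_subset open_flow_box B in blast)+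
    moreover have "y0 \<in> ?N"
      using B(3) \<delta> t0 by (intro image_eqI [of _ _ "join_vec (t0, 0)"]) (auto simp: flow_box_def)
    ultimately show ?thesis
      using gauss_transversal [OF patch B(1,2) \<delta> inj *] by blast
  qed
  \<comment> \<open>This \<open>c\<close> makes both \<open>v + c *\<^sub>R n (\<phi> t0)\<close>
    and \<open>c *\<^sub>R n (\<phi> t0)\<close> transversal with positive normal component; their
    difference is \<open>v\<close>, and both sides of \<open>gauss\<close> are linear in the
    direction.\<close>
  define c where "c = \<bar>n (\<phi> t0) \<bullet> v\<bar> + 1"
  have n: "n (\<phi> t0) \<bullet> n (\<phi> t0) = 1"
    using normal_patch(1) [OF patch t0(1)] by (simp add: norm_eq_1)
  have "n (\<phi> t0) \<bullet> (v + c *\<^sub>R n (\<phi> t0)) > 0" "n (\<phi> t0) \<bullet> (c *\<^sub>R n (\<phi> t0)) > 0"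
    using n by (auto simp: c_def inner_add_right)
  then obtain N1 N2 where N: "open N1" "y0 \<in> N1" "open N2" "y0 \<in> N2"
    and N1: "\<And>(u :: real^('m option) \<Rightarrow> 'b) u' K. C1_supported u u' K \<Longrightarrow> K \<subseteq> N1 \<Longrightarrow> gauss (v + c *\<^sub>R n (\<phi> t0)) u u'"
    and N2: "\<And>(u :: real^('m option) \<Rightarrow> 'b) u' K. C1_supported u u' K \<Longrightarrow> K \<subseteq> N2 \<Longrightarrow> gauss (c *\<^sub>R n (\<phi> t0)) u u'"
    using transversal by metis
  show ?thesis
  proof (rule that [of "N1 \<inter> N2"])
    fix u :: "real^('m option) \<Rightarrow> 'b" and u' K
    assume u: "C1_supported u u' K" "K \<subseteq> N1 \<inter> N2"
    have "gauss (v + c *\<^sub>R n (\<phi> t0)) u u'" "gauss (c *\<^sub>R n (\<phi> t0)) u u'"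
      using N1 [OF u(1)] N2 [OF u(1)] u(2) by auto
    then have "has_bochner_integral \<mu> (\<lambda>y. indicator \<Gamma> y *\<^sub>R (n y \<bullet> (v + c *\<^sub>R n (\<phi> t0))) *\<^sub>R u y -
        indicator \<Gamma> y *\<^sub>R (n y \<bullet> (c *\<^sub>R n (\<phi> t0))) *\<^sub>R u y)
       (- (\<integral>y. indicator Um y *\<^sub>R u' y (v + c *\<^sub>R n (\<phi> t0)) \<partial>lborel) -
        - (\<integral>y. indicator Um y *\<^sub>R u' y (c *\<^sub>R n (\<phi> t0)) \<partial>lborel))"
      unfolding gauss_def by (rule has_bochner_integral_diff)
    moreover have "(\<integral>y. indicator Um y *\<^sub>R u' y (v + c *\<^sub>R n (\<phi> t0)) \<partial>lborel) =
        (\<integral>y. indicator Um y *\<^sub>R u' y v \<partial>lborel) + (\<integral>y. indicator Um y *\<^sub>R u' y (c *\<^sub>R n (\<phi> t0)) \<partial>lborel)"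
      using C1_supported_integrable [OF u(1)]
      by (subst Bochner_Integration.integral_add [symmetric]) (auto simp: blinfun.add_right scaleR_add_right)
    ultimately show "gauss v u u'"
      by (simp add: gauss_def inner_add_right algebra_simps)
  qed (use N in auto)
qed

end

section \<open>A continuously differentiable cutoff\<close>

lemma DERIV_square_pos_part: "((\<lambda>x::real. (max 0 x)\<^sup>2) has_real_derivative 2 * max 0 x) (at x)"
proof -
  consider "x > 0" | "x < 0" | "x = 0" by linarith
  then show ?thesis
  proof cases
    case 1
    have "((\<lambda>x::real. x\<^sup>2) has_real_derivative 2 * max 0 x) (at x)"
      using 1 by (auto intro!: derivative_eq_intros)
    then show ?thesis
      by (rule has_field_derivative_transform_within_open [where S = "{0<..}"]) (use 1 in auto)
  next
    case 2
    have "((\<lambda>x::real. 0) has_real_derivative 2 * max 0 x) (at x)"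
      using 2 by (auto intro!: derivative_eq_intros)
    then show ?thesis
      by (rule has_field_derivative_transform_within_open [where S = "{..<0}"]) (use 2 in auto)
  next
    case 3
    have "((\<lambda>h. ((max 0 (0 + h))\<^sup>2 - (max 0 0)\<^sup>2) / h) \<longlongrightarrow> (0::real)) (at 0)"
    proof (rule Lim_null_comparison [where g = "\<lambda>h. \<bar>h\<bar>"])
      show "\<forall>\<^sub>F h in at 0. norm (((max 0 (0 + h))\<^sup>2 - (max 0 0)\<^sup>2) / h) \<le> \<bar>h :: real\<bar>"
        by (auto intro!: always_eventually simp: max_def power2_eq_square)
      show "((\<lambda>h::real. \<bar>h\<bar>) \<longlongrightarrow> 0) (at 0)"
        by (rule tendsto_eq_intros refl)+ simp
    qed
    then show ?thesis
      using 3 by (simp add: DERIV_def)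
  qed
qed

text \<open>A quadratic spline: the antiderivative of a tent of base [0, 1] and height 2, hence of
  total mass 1. Being \<open>C1\<close> suffices, as the cutoffs are differentiated only
  once.\<close>

definition smooth_step :: "real \<Rightarrow> real" where
  "smooth_step x = 2 * (max 0 x)\<^sup>2 - 4 * (max 0 (x - 1/2))\<^sup>2 + 2 * (max 0 (x - 1))\<^sup>2"

definition tent :: "real \<Rightarrow> real" where
  "tent x = 4 * max 0 x - 8 * max 0 (x - 1/2) + 4 * max 0 (x - 1)"

lemma smooth_step_le_0: "x \<le> 0 \<Longrightarrow> smooth_step x = 0"
  by (simp add: smooth_step_def)

lemma smooth_step_ge_1: "x \<ge> 1 \<Longrightarrow> smooth_step x = 1"
  by (simp add: smooth_step_def power2_eq_square algebra_simps)

lemma tent_nonneg: "tent x \<ge> 0"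
  by (simp add: tent_def max_def)

lemma tent_eq_0: "x \<le> 0 \<or> x \<ge> 1 \<Longrightarrow> tent x = 0"
  by (auto simp: tent_def max_def)

lemma continuous_on_tent [continuous_intros]: "continuous_on S f \<Longrightarrow> continuous_on S (\<lambda>x. tent (f x))"
  unfolding tent_def by (intro continuous_intros)

lemma DERIV_smooth_step: "(smooth_step has_real_derivative tent x) (at x)"
proof -
  have shift: "((\<lambda>x::real. (max 0 (x - a))\<^sup>2) has_real_derivative 2 * max 0 (x - a)) (at x)" for a
  proof -
    have "((\<lambda>x. x - a) has_real_derivative 1) (at x)"
      by (auto intro!: derivative_eq_intros)
    from DERIV_chain2 [OF DERIV_square_pos_part this] show ?thesis by simp
  qed
  have "(smooth_step has_real_derivative
      2 * (2 * max 0 x) - 4 * (2 * max 0 (x - 1/2)) + 2 * (2 * max 0 (x - 1))) (at x)"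
    unfolding smooth_step_def [abs_def]
    by (intro DERIV_add DERIV_diff DERIV_cmult shift DERIV_square_pos_part)
  then show ?thesis
    by (simp add: tent_def)
qed

section \<open>The divergence theorem\<close>

context jordan_domain
begin

lemma C1_supportedI:
  fixes u :: "real^('m option) \<Rightarrow> 'b::euclidean_space"
  assumes "compact K"
    and der: "\<And>y. y \<in> Um \<union> \<Gamma> \<Longrightarrow> (u has_derivative U y) (at y within Um \<union> \<Gamma>)"
    and cont: "\<And>i. continuous_on (Um \<union> \<Gamma>) (\<lambda>y. U y i)"
    and zero: "\<And>y. y \<in> Um \<union> \<Gamma> \<Longrightarrow> y \<notin> K \<Longrightarrow> u y = 0"
  shows "C1_supported u (\<lambda>y. Blinfun (U y)) K"
    and "y \<in> Um \<union> \<Gamma> \<Longrightarrow> blinfun_apply (Blinfun (U y)) = U y"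
proof -
  show *: "blinfun_apply (Blinfun (U y)) = U y" if "y \<in> Um \<union> \<Gamma>" for y
    using der [OF that] has_derivative_bounded_linear bounded_linear_Blinfun_apply by blast
  show "C1_supported u (\<lambda>y. Blinfun (U y)) K"
    unfolding C1_supported_def
  proof (intro conjI ballI)
    show "continuous_on (Um \<union> \<Gamma>) (\<lambda>y. Blinfun (U y))"
      by (rule continuous_on_blinfun_componentwise, rule continuous_on_eq [OF cont]) (simp add: *)
  qed (use assms * in auto)
qed

text \<open>On the open set \<open>Um\<close> the derivative is determined by \<open>u\<close>, so
  \<open>gauss\<close> is a statement about \<open>u\<close> alone. This is used when
  \<open>u\<close> is reassembled from cut-off parts, whose derivatives are given by the product
  rule.\<close>

lemma gauss_cong:
  fixes u :: "real^('m option) \<Rightarrow> 'b::euclidean_space"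
  assumes u: "C1_supported u u' K" "C1_supported u u'' L" and "gauss v u u'"
  shows "gauss v u u''"
proof -
  have "u' y = u'' y" if "y \<in> Um" for y
    using has_derivative_unique [OF C1_supported_derivative [OF u(1) that] C1_supported_derivative [OF u(2) that]]
    by (simp add: blinfun_apply_inject)
  then have "(\<lambda>y. indicator Um y *\<^sub>R u' y v) = (\<lambda>y. indicator Um y *\<^sub>R u'' y v)"
    by (intro ext) (auto simp: indicator_def)
  then show ?thesis
    using assms(3) by (simp add: gauss_def)
qed

lemma gauss_add:
  fixes u w :: "real^('m option) \<Rightarrow> 'b::euclidean_space"
  assumes u: "C1_supported u u' K" "gauss v u u'" and w: "C1_supported w w' L" "gauss v w w'"
  shows "gauss v (\<lambda>y. u y + w y) (\<lambda>y. u' y + w' y)"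
proof -
  have "has_bochner_integral \<mu> (\<lambda>y. indicator \<Gamma> y *\<^sub>R (n y \<bullet> v) *\<^sub>R u y + indicator \<Gamma> y *\<^sub>R (n y \<bullet> v) *\<^sub>R w y)
     (- (\<integral>y. indicator Um y *\<^sub>R u' y v \<partial>lborel) + - (\<integral>y. indicator Um y *\<^sub>R w' y v \<partial>lborel))"
    using u(2) w(2) unfolding gauss_def by (rule has_bochner_integral_add)
  moreover have "(\<integral>y. indicator Um y *\<^sub>R (u' y + w' y) v \<partial>lborel) =
      (\<integral>y. indicator Um y *\<^sub>R u' y v \<partial>lborel) + (\<integral>y. indicator Um y *\<^sub>R w' y v \<partial>lborel)"
    using C1_supported_integrable [OF u(1)] C1_supported_integrable [OF w(1)]
    by (subst Bochner_Integration.integral_add [symmetric]) (auto simp: blinfun.add_left scaleR_add_right)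
  ultimately show ?thesis
    by (simp add: gauss_def algebra_simps)
qed

text \<open>Extended by 0, \<open>u\<close> is differentiable on the whole space. Translation
  invariance of Lebesgue measure makes the integral of every difference quotient in direction
  \<open>v\<close> vanish, and dominated convergence carries this over to the derivative; on
  \<Gamma> the function is 0.\<close>

lemma gauss_interior:
  fixes u :: "real^('m option) \<Rightarrow> 'b::euclidean_space"
  assumes u: "C1_supported u u' K" and K: "K \<subseteq> Um"
  shows "gauss v u u'"
proof -
  note uD = C1_supportedD [OF u]
  define w where "w y = indicator Um y *\<^sub>R u y" for y
  define W where "W y = indicator Um y *\<^sub>R u' y" for y
  have w_0: "w y = 0" if "y \<notin> K" for y
    using uD(4) [of y] that by (auto simp: w_def indicator_def)
  have W_0: "W y = 0" if "y \<notin> K" for y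
    using uD(6) [of y] that by (auto simp: W_def indicator_def)
  have w_der: "(w has_derivative blinfun_apply (W y)) (at y)" for y
  proof (cases "y \<in> Um")
    case True
    have "(w has_derivative blinfun_apply (u' y)) (at y)"
      by (rule has_derivative_transform_within_open [OF uD(3) [OF True] open_Um True]) (simp add: w_def)
    then show ?thesis using True by (simp add: W_def)
  next
    case False
    have "open (- K)"
      using uD(1) by (auto dest: compact_imp_closed)
    then have "(w has_derivative (\<lambda>_. 0)) (at y)"
      by (rule has_derivative_transform_within_open [OF has_derivative_const [of 0]]) (use False K w_0 in auto)
    then show ?thesis using False by (simp add: W_def zero_blinfun.rep_eq)
  qed
  have "compact (u' ` K)"
    using uD(1) K by (intro compact_continuous_image continuous_on_subset [OF uD(2)]) auto
  from compact_imp_bounded [OF this] obtain M0 where M0: "\<And>y. y \<in> K \<Longrightarrow> norm (u' y) \<le> M0"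
    unfolding bounded_iff ball_simps by auto
  define M where "M = max M0 0"
  have M: "norm (W y) \<le> M" for y
    using M0 [of y] W_0 [of y] K by (cases "y \<in> K") (auto simp: M_def W_def le_max_iff_disj)
  \<comment> \<open>The global Lipschitz constant bounds all difference quotients uniformly by
    \<open>M * norm v\<close>.\<close>
  have w_lip: "norm (w x - w y) \<le> M * norm (x - y)" for x y
    by (rule differentiable_bound [of UNIV w "\<lambda>y. blinfun_apply (W y)"])
      (use w_der M in \<open>auto simp flip: norm_blinfun.rep_eq\<close>)
  have w_cont: "continuous_on UNIV w"
    using w_der by (intro continuous_at_imp_continuous_on ballI has_derivative_continuous)
  then have w_borel: "w \<in> borel_measurable borel"
    by (rule borel_measurable_continuous_onI)
  have "bounded K"
    using uD(1) by (rule compact_imp_bounded)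
  then obtain R where R: "\<And>y. y \<in> K \<Longrightarrow> norm y \<le> R"
    unfolding bounded_iff by auto
  have "compact (w ` cball 0 R)"
    by (intro compact_continuous_image continuous_on_subset [OF w_cont]) auto
  from compact_imp_bounded [OF this] obtain C where C: "\<forall>y\<in>cball 0 R. norm (w y) \<le> C"
    unfolding bounded_iff ball_simps by blast
  have w_int: "integrable lborel w"
    by (rule integrableI_bounded_set [of "cball 0 R" _ _ C])
      (use C R w_0 w_borel in \<open>auto simp: emeasure_compact_finite [OF compact_cball, simplified]\<close>)
  define q where "q k y = real (Suc k) *\<^sub>R (w (y + (1 / real (Suc k)) *\<^sub>R v) - w y)" for k y
  have shift_int: "integrable lborel (\<lambda>y. w (y + a))" and shift: "(\<integral>y. w (y + a) \<partial>lborel) = (\<integral>y. w y \<partial>lborel)" for a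
  proof -
    have "integrable (distr lborel borel ((+) a)) w"
      unfolding lborel_distr_plus by (rule w_int)
    then show "integrable lborel (\<lambda>y. w (y + a))"
      using w_borel by (subst (asm) integrable_distr_eq) (auto simp: add.commute)
    have "(\<integral>y. w y \<partial>lborel) = (\<integral>y. w y \<partial>distr lborel borel ((+) a))"
      by (simp add: lborel_distr_plus)
    then show "(\<integral>y. w (y + a) \<partial>lborel) = (\<integral>y. w y \<partial>lborel)"
      using w_borel by (subst (asm) integral_distr) (auto simp: add.commute)
  qed
  have q_int: "(\<integral>y. q k y \<partial>lborel) = 0" for k
    unfolding q_def using shift_int w_int shift by simp
  have "(\<lambda>k. \<integral>y. q k y \<partial>lborel) \<longlonglongrightarrow> (\<integral>y. W y v \<partial>lborel)"
  proof (rule integral_dominated_convergence)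
    show "(\<lambda>y. W y v) \<in> borel_measurable lborel"
      using C1_supported_derivative_borel [OF u, of v]
      by (simp add: W_def blinfun.scaleR_left)
    show "q k \<in> borel_measurable lborel" for k
      unfolding q_def using w_borel by measurable
    \<comment> \<open>The step lengths \<open>1 / real (Suc k)\<close> are at most 1; so if
      \<open>y\<close> lies outside the ball of radius \<open>R + norm v\<close>, both
      \<open>y\<close> and the shifted point avoid \<open>K\<close> and the quotient is 0.\<close>
    show "integrable lborel (\<lambda>y. indicator (cball 0 (R + norm v)) y *\<^sub>R (M * norm v))"
      by (intro integrable_scaleR_left integrable_real_indicator emeasure_compact_finite compact_cball) auto
    show "AE y in lborel. (\<lambda>k. q k y) \<longlonglongrightarrow> W y v"
    proof (intro AE_I2)
      fix y
      have "((\<lambda>h. (1 / h) *\<^sub>R (w (y + h *\<^sub>R v) - w y)) \<longlongrightarrow> W y v) (at 0)"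
      proof -
        have "((\<lambda>h. y + h *\<^sub>R v) has_derivative (\<lambda>h. h *\<^sub>R v)) (at 0)"
          by (auto intro!: derivative_eq_intros)
        moreover have "(w has_derivative blinfun_apply (W y)) (at (y + 0 *\<^sub>R v))"
          using w_der by simp
        ultimately have "((\<lambda>h. w (y + h *\<^sub>R v)) has_derivative (\<lambda>h. W y (h *\<^sub>R v))) (at 0)"
          by (rule has_derivative_compose)
        then have "((\<lambda>h. norm (w (y + h *\<^sub>R v) - w y - W y (h *\<^sub>R v)) / norm h) \<longlongrightarrow> 0) (at 0)"
          by (simp add: has_derivative_at)
        then have "((\<lambda>h. norm ((1 / h) *\<^sub>R (w (y + h *\<^sub>R v) - w y) - W y v)) \<longlongrightarrow> 0) (at 0)"
        proof (rule Lim_transform_eventually)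
          have "norm (w (y + h *\<^sub>R v) - w y - W y (h *\<^sub>R v)) / norm h =
              norm ((1 / h) *\<^sub>R (w (y + h *\<^sub>R v) - w y) - W y v)" if "h \<noteq> 0" for h
          proof -
            have "(1 / h) *\<^sub>R (w (y + h *\<^sub>R v) - w y) - W y v = (1 / h) *\<^sub>R (w (y + h *\<^sub>R v) - w y - W y (h *\<^sub>R v))"
              using that by (simp add: blinfun.scaleR_right scaleR_diff_right)
            then show ?thesis by simp
          qed
          then show "\<forall>\<^sub>F h in at 0. norm (w (y + h *\<^sub>R v) - w y - W y (h *\<^sub>R v)) / norm h =
              norm ((1 / h) *\<^sub>R (w (y + h *\<^sub>R v) - w y) - W y v)"
            by (auto simp: eventually_at_filter)
        qed
        then show ?thesis
          by (simp add: tendsto_norm_zero_iff LIM_zero_iff)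
      qed
      moreover have "(\<lambda>k. 1 / real (Suc k)) \<longlonglongrightarrow> 0"
        using LIMSEQ_inverse_real_of_nat by (simp add: inverse_eq_divide)
      then have "filterlim (\<lambda>k. 1 / real (Suc k)) (at 0) sequentially"
        by (simp add: filterlim_at)
      ultimately have "((\<lambda>k. (1 / (1 / real (Suc k))) *\<^sub>R (w (y + (1 / real (Suc k)) *\<^sub>R v) - w y)) \<longlonglongrightarrow> W y v)"
        by (rule filterlim_compose)
      then show "(\<lambda>k. q k y) \<longlonglongrightarrow> W y v"
        by (simp add: q_def)
    qed
    show "AE y in lborel. norm (q k y) \<le> indicator (cball 0 (R + norm v)) y *\<^sub>R (M * norm v)" for k
    proof (intro AE_I2)
      fix y
      let ?a = "(1 / real (Suc k)) *\<^sub>R v"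
      show "norm (q k y) \<le> indicator (cball 0 (R + norm v)) y *\<^sub>R (M * norm v)"
      proof (cases "y \<in> cball 0 (R + norm v)")
        case True
        have "norm (w (y + ?a) - w y) \<le> M * norm ?a"
          using w_lip [of "y + ?a" y] by simp
        then have "real (Suc k) * norm (w (y + ?a) - w y) \<le> real (Suc k) * (M * norm ?a)"
          by (intro mult_left_mono) auto
        also have "\<dots> = M * norm v" by simp
        finally show ?thesis
          using True by (simp add: q_def)
      next
        case False
        have "norm ?a \<le> norm v"
          using mult_left_mono [of 1 "1 + real k" "norm v"] by (simp add: divide_le_eq)
        moreover have "norm y \<le> norm (y + ?a) + norm ?a"
          using norm_triangle_ineq4 [of "y + ?a" ?a] by simp
        ultimately have "norm y > R" "norm (y + ?a) > R"
          using False by auto (smt (verit) norm_ge_zero)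
        then have "w y = 0" "w (y + ?a) = 0"
          using R w_0 by fastforce+
        then show ?thesis using False by (simp add: q_def)
      qed
    qed
  qed
  then have "(\<integral>y. W y v \<partial>lborel) = 0"
    unfolding q_int by (simp add: LIMSEQ_const_iff)
  then have *: "(\<integral>y. indicator Um y *\<^sub>R u' y v \<partial>lborel) = 0"
    by (simp add: W_def blinfun.scaleR_left)
  have **: "indicator \<Gamma> y *\<^sub>R (n y \<bullet> v) *\<^sub>R u y = 0" for y
    using uD(4) [of y] K partition by (auto simp: indicator_def)
  show ?thesis
    unfolding gauss_def * ** by (simp add: has_bochner_integral_zero)
qed

lemma C1_supported_scaleR:
  fixes u :: "real^('m option) \<Rightarrow> 'b::euclidean_space" and \<psi> :: "real^('m option) \<Rightarrow> real"
  assumes u: "C1_supported u u' K"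
    and \<psi>: "\<And>y. (\<psi> has_derivative \<psi>' y) (at y)" "\<And>i. continuous_on UNIV (\<lambda>y. \<psi>' y i)"
    and L: "compact L" "\<And>y. y \<in> K \<Longrightarrow> y \<notin> L \<Longrightarrow> \<psi> y = 0"
  shows "C1_supported (\<lambda>y. \<psi> y *\<^sub>R u y) (\<lambda>y. Blinfun (\<lambda>h. \<psi> y *\<^sub>R u' y h + \<psi>' y h *\<^sub>R u y)) L"
proof (rule C1_supportedI)
  note uD = C1_supportedD [OF u]
  show "((\<lambda>y. \<psi> y *\<^sub>R u y) has_derivative (\<lambda>h. \<psi> y *\<^sub>R u' y h + \<psi>' y h *\<^sub>R u y)) (at y within Um \<union> \<Gamma>)"
    if "y \<in> Um \<union> \<Gamma>" for y
    using that u by (intro has_derivative_scaleR has_derivative_at_withinI [OF \<psi>(1)]) (auto simp: C1_supported_def)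
  have "continuous_on UNIV \<psi>"
    using \<psi>(1) by (intro continuous_at_imp_continuous_on ballI has_derivative_continuous)
  then show "continuous_on (Um \<union> \<Gamma>) (\<lambda>y. \<psi> y *\<^sub>R u' y i + \<psi>' y i *\<^sub>R u y)" for i
    by (intro continuous_intros uD(2,5) continuous_on_subset [OF \<psi>(2)]) (auto intro: continuous_on_subset)
  show "\<psi> y *\<^sub>R u y = 0" if "y \<in> Um \<union> \<Gamma>" "y \<notin> L" for y
    using that uD(4) [of y] L(2) [of y] by (cases "y \<in> K") auto
qed (rule L(1))

text \<open>An induction that peels off one ball at a time replaces a partition of unity. A cutoff
  vanishing on the half ball around \<open>x\<close> splits \<open>u\<close> into a part supported
  in \<open>ball x (e x)\<close> and a rest whose support is covered by the remaining half
  balls.\<close>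

lemma gauss_cover:
  fixes u :: "real^('m option) \<Rightarrow> 'b::euclidean_space"
  assumes "finite F"
    and "\<And>x. x \<in> F \<Longrightarrow> e x > 0"
    and "\<And>x (u :: real^('m option) \<Rightarrow> 'b) u' K. x \<in> F \<Longrightarrow> C1_supported u u' K \<Longrightarrow> K \<subseteq> ball x (e x) \<Longrightarrow> gauss v u u'"
    and "C1_supported u u' K" "K \<subseteq> (\<Union>x\<in>F. ball x (e x / 2))"
  shows "gauss v u u'"
  using assms
proof (induction F arbitrary: u u' K rule: finite_induct)
  case empty
  have *: "indicator \<Gamma> y *\<^sub>R (n y \<bullet> v) *\<^sub>R u y = 0" "indicator Um y *\<^sub>R u' y v = 0" for y
    using C1_supportedD(4,6) [OF empty.prems(3), of y] empty.prems(4) by (auto simp: indicator_def)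
  show ?case
    unfolding gauss_def * by (simp add: has_bochner_integral_zero)
next
  case (insert x F)
  note u = insert.prems(3)
  have e: "e x > 0" using insert.prems(1) by simp
  \<comment> \<open>Thus \<psi> is 0 for squared distance up to \<open>a\<close> and 1 from
    \<open>2 * a\<close> on. The radius \<open>3/4 * e x\<close> is safe, since 9/16 exceeds 1/2 and
    it still lies below \<open>e x\<close>.\<close>
  define a where "a = (e x / 2)\<^sup>2"
  have a: "a > 0" using e by (simp add: a_def)
  define \<psi> where "\<psi> y = smooth_step (((y - x) \<bullet> (y - x) - a) / a)" for y
  define \<psi>' where "\<psi>' y h = tent (((y - x) \<bullet> (y - x) - a) / a) * (2 * ((y - x) \<bullet> h) / a)" for y h
  have \<psi>_der: "(\<psi> has_derivative \<psi>' y) (at y)" for y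
  proof -
    have "((\<lambda>y. ((y - x) \<bullet> (y - x) - a) / a) has_derivative (\<lambda>h. 2 * ((y - x) \<bullet> h) / a)) (at y)"
      using a by (auto intro!: derivative_eq_intros simp: inner_commute)
    from has_derivative_compose [OF this DERIV_smooth_step [unfolded has_field_derivative_def]]
    show ?thesis
      unfolding \<psi>_def \<psi>'_def .
  qed
  have \<psi>_cont: "continuous_on UNIV (\<lambda>y. \<psi>' y i)" for i
    unfolding \<psi>'_def by (intro continuous_intros) (use a in auto)
  have \<psi>_0: "\<psi> y = 0" if "y \<in> ball x (e x / 2)" for y
  proof -
    have "norm (y - x) < e x / 2"
      using that by (simp add: dist_norm norm_minus_commute)
    then have "(norm (y - x))\<^sup>2 \<le> a"
      unfolding a_def by (intro power_mono) auto
    then show ?thesis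
      unfolding \<psi>_def using a by (intro smooth_step_le_0) (simp add: power2_norm_eq_inner divide_nonpos_pos)
  qed
  have \<psi>_1: "\<psi> y = 1" if "y \<notin> cball x (3/4 * e x)" for y
  proof -
    have "norm (y - x) > 3/4 * e x"
      using that by (simp add: dist_norm norm_minus_commute)
    then have "(norm (y - x))\<^sup>2 \<ge> (3/4 * e x)\<^sup>2"
      using e by (intro power_mono) auto
    moreover have "(3/4 * e x)\<^sup>2 \<ge> 2 * a"
      by (simp add: a_def power2_eq_square)
    ultimately show ?thesis
      unfolding \<psi>_def using a by (intro smooth_step_ge_1) (simp add: power2_norm_eq_inner)
  qed
  have K: "compact K" using C1_supported_compact [OF u] .
  define U1 where "U1 = (\<lambda>y. Blinfun (\<lambda>h. (1 - \<psi> y) *\<^sub>R u' y h + - \<psi>' y h *\<^sub>R u y))"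
  have 1: "C1_supported (\<lambda>y. (1 - \<psi> y) *\<^sub>R u y) U1 (K \<inter> cball x (3/4 * e x))"
    unfolding U1_def
  proof (rule C1_supported_scaleR [OF u])
    show "((\<lambda>y. 1 - \<psi> y) has_derivative (\<lambda>h. - \<psi>' y h)) (at y)" for y
      using has_derivative_diff [OF has_derivative_const \<psi>_der, of 1 y] by simp
    show "continuous_on UNIV (\<lambda>y. - \<psi>' y i)" for i
      by (intro continuous_intros \<psi>_cont)
  qed (use K \<psi>_1 in \<open>auto intro: compact_Int_closed\<close>)
  have "K \<inter> cball x (3/4 * e x) \<subseteq> ball x (e x)"
    using e by auto
  then have g1: "gauss v (\<lambda>y. (1 - \<psi> y) *\<^sub>R u y) U1"
    using insert.prems(2) [of x, OF _ 1] by simp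
  define U2 where "U2 = (\<lambda>y. Blinfun (\<lambda>h. \<psi> y *\<^sub>R u' y h + \<psi>' y h *\<^sub>R u y))"
  have 2: "C1_supported (\<lambda>y. \<psi> y *\<^sub>R u y) U2 (K - ball x (e x / 2))"
    unfolding U2_def
    by (rule C1_supported_scaleR [OF u \<psi>_der \<psi>_cont]) (use K \<psi>_0 in \<open>auto intro: compact_diff\<close>)
  have g2: "gauss v (\<lambda>y. \<psi> y *\<^sub>R u y) U2"
  proof (rule insert.IH [OF _ _ 2])
    show "e z > 0" if "z \<in> F" for z
      using insert.prems(1) that by blast
    show "gauss v u u'" if "z \<in> F" "C1_supported u u' K" "K \<subseteq> ball z (e z)"
      for z and u :: "real^('m option) \<Rightarrow> 'b" and u' K
      by (rule insert.prems(2) [OF _ that(2,3)]) (use that(1) in blast)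
  qed (use insert.prems(4) in auto)
  have eq: "(\<lambda>y. (1 - \<psi> y) *\<^sub>R u y + \<psi> y *\<^sub>R u y) = u"
    by (simp add: algebra_simps)
  have "gauss v u (\<lambda>y. U1 y + U2 y)"
    using gauss_add [OF 1 g1 2 g2] unfolding eq .
  moreover have "C1_supported u (\<lambda>y. U1 y + U2 y) K"
    unfolding C1_supported_def
  proof (intro conjI ballI)
    show "continuous_on (Um \<union> \<Gamma>) (\<lambda>y. U1 y + U2 y)"
      by (intro continuous_intros C1_supportedD(2) [OF 1] C1_supportedD(2) [OF 2])
    fix y assume "y \<in> Um \<union> \<Gamma>"
    then have "((\<lambda>y. (1 - \<psi> y) *\<^sub>R u y + \<psi> y *\<^sub>R u y) has_derivative (\<lambda>h. U1 y h + U2 y h)) (at y within Um \<union> \<Gamma>)"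
      using 1 2 unfolding C1_supported_def by (intro has_derivative_add) auto
    then show "(u has_derivative blinfun_apply (U1 y + U2 y)) (at y within Um \<union> \<Gamma>)"
      unfolding eq by (simp add: plus_blinfun.rep_eq)
  qed (use K C1_supportedD(4) [OF u] in auto)
  ultimately show ?case
    using gauss_cong u by blast
qed

text \<open>Every point of the closed domain has a ball in which \<open>gauss\<close> holds for
  functions supported there: translation invariance provides it in \<open>Um\<close>, the
  straightened boundary on \<Gamma>. Compactness of the support reduces to finitely many
  balls.\<close>

theorem gauss_theorem:
  fixes u :: "real^('m option) \<Rightarrow> 'b::euclidean_space"
  assumes "compact K"
    and "\<And>y. y \<in> Um \<union> \<Gamma> \<Longrightarrow> (u has_derivative U y) (at y within Um \<union> \<Gamma>)"
    and "\<And>i. continuous_on (Um \<union> \<Gamma>) (\<lambda>y. U y i)"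
    and "\<And>y. y \<in> Um \<union> \<Gamma> \<Longrightarrow> y \<notin> K \<Longrightarrow> u y = 0"
  shows "integrable lborel (\<lambda>y. indicator Um y *\<^sub>R U y v)"
    and "has_bochner_integral \<mu> (\<lambda>y. indicator \<Gamma> y *\<^sub>R (n y \<bullet> v) *\<^sub>R u y)
      (- (\<integral>y. indicator Um y *\<^sub>R U y v \<partial>lborel))"
proof -
  \<comment> \<open>Intersecting with \<open>Um \<union> \<Gamma>\<close> ensures that every centre
    of the cover is a point where one of the two local results applies.\<close>
  let ?U = "\<lambda>y. Blinfun (U y)" and ?K = "K \<inter> (Um \<union> \<Gamma>)"
  have "compact ?K"
    using assms(1) closed_domain by (rule compact_Int_closed)
  have u: "C1_supported u ?U ?K" and U: "\<And>y. y \<in> Um \<union> \<Gamma> \<Longrightarrow> blinfun_apply (?U y) = U y"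
    using assms(4) by (auto intro!: C1_supportedI [OF \<open>compact ?K\<close> assms(2,3)])
  have "\<exists>e>0. \<forall>(u :: real^('m option) \<Rightarrow> 'b) u' K. C1_supported u u' K \<longrightarrow> K \<subseteq> ball x e \<longrightarrow> gauss v u u'"
    if "x \<in> Um \<union> \<Gamma>" for x
  proof -
    obtain N where N: "open N" "x \<in> N"
      "\<And>(u :: real^('m option) \<Rightarrow> 'b) u' K. C1_supported u u' K \<Longrightarrow> K \<subseteq> N \<Longrightarrow> gauss v u u'"
    proof (cases "x \<in> Um")
      case True
      show thesis
        by (rule that [OF open_Um True]) (rule gauss_interior)
    next
      case False
      then have "x \<in> \<Gamma>" using \<open>x \<in> Um \<union> \<Gamma>\<close> by blast
      from gauss_boundary_point [OF this, where v = v and 'b = 'b] show thesis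
        using that by blast
    qed
    obtain e where "e > 0" "ball x e \<subseteq> N"
      using N(1,2) by (meson open_contains_ball)
    then show ?thesis
      using N(3) by (meson order_trans)
  qed
  then obtain e where e: "\<And>x. x \<in> Um \<union> \<Gamma> \<Longrightarrow> e x > 0"
    "\<And>x (u :: real^('m option) \<Rightarrow> 'b) u' K. x \<in> Um \<union> \<Gamma> \<Longrightarrow> C1_supported u u' K \<Longrightarrow> K \<subseteq> ball x (e x) \<Longrightarrow> gauss v u u'"
    by metis
  obtain F where F: "F \<subseteq> ?K" "finite F" "?K \<subseteq> (\<Union>x\<in>F. ball x (e x / 2))"
  proof (rule compactE_image [OF \<open>compact ?K\<close>, of ?K "\<lambda>x. ball x (e x / 2)"])
    show "?K \<subseteq> (\<Union>x\<in>?K. ball x (e x / 2))"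
      using e(1) by (auto intro!: bexI)
  qed auto
  have g: "gauss v u ?U"
  proof (rule gauss_cover [OF F(2) _ _ u F(3)])
    show "e x > 0" if "x \<in> F" for x
      using e(1) F(1) that by blast
    show "gauss v u u'" if "x \<in> F" "C1_supported u u' K" "K \<subseteq> ball x (e x)"
      for x and u :: "real^('m option) \<Rightarrow> 'b" and u' K
      using e(2) [OF _ that(2,3)] F(1) that(1) by blast
  qed
  have eq: "(\<lambda>y. indicator Um y *\<^sub>R ?U y v) = (\<lambda>y. indicator Um y *\<^sub>R U y v)"
    using U by (intro ext) (auto simp: indicator_def)
  show "integrable lborel (\<lambda>y. indicator Um y *\<^sub>R U y v)"
    using C1_supported_integrable [OF u, of v] unfolding eq .
  show "has_bochner_integral \<mu> (\<lambda>y. indicator \<Gamma> y *\<^sub>R (n y \<bullet> v) *\<^sub>R u y)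
      (- (\<integral>y. indicator Um y *\<^sub>R U y v \<partial>lborel))"
    using g unfolding gauss_def eq .
qed

end

section \<open>Radial cutoffs\<close>

text \<open>The ball \<open>norm (z - x) ^ DIM('a) \<le> a\<close> has volume linear in
  \<open>a\<close>, and half lines generate the Borel sets. This is the substitute for polar
  coordinates.\<close>

lemma distr_norm_power:
  fixes x :: "'a::euclidean_space"
  shows "distr lborel borel (\<lambda>z. norm (z - x) ^ DIM('a)) =
    density lborel (\<lambda>r. ennreal (unit_ball_vol (real DIM('a)) * indicator {0..} r))"
    (is "?M = ?N")
proof -
  let ?d = "DIM('a)" and ?V = "unit_ball_vol (real DIM('a))"
  have pos: "0 < ?d" "0 \<le> ?V" by auto
  have eq: "emeasure ?M {..a} = emeasure ?N {..a}" and fin: "emeasure ?M {..a} \<noteq> \<infinity>" for a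
  proof -
    have M: "emeasure ?M {..a} = emeasure lborel {z. norm (z - x) ^ ?d \<le> a}"
      by (subst emeasure_distr) (auto simp: vimage_def)
    have N: "emeasure ?N {..a} = ennreal ?V * emeasure lborel {0..a}"
    proof -
      have "emeasure ?N {..a} = (\<integral>\<^sup>+r. ennreal ?V * indicator {0..a} r \<partial>lborel)"
        by (subst emeasure_density) (auto intro!: nn_integral_cong simp: indicator_def)
      then show ?thesis
        by (simp add: nn_integral_cmult)
    qed
    have "emeasure ?M {..a} = emeasure ?N {..a} \<and> emeasure ?M {..a} \<noteq> \<infinity>"
    proof (cases "a \<ge> 0")
      case True
      have "norm (z - x) ^ ?d \<le> a \<longleftrightarrow> norm (z - x) \<le> root ?d a" for z
        using real_root_le_iff [OF pos(1), of "norm (z - x) ^ ?d" a] pos(1) by (simp add: real_root_power_cancel)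
      then have "{z. norm (z - x) ^ ?d \<le> a} = cball x (root ?d a)"
        unfolding cball_def dist_norm norm_minus_commute [of x] by simp
      then have "emeasure ?M {..a} = ennreal (?V * root ?d a ^ ?d)"
        unfolding M using True by (simp add: emeasure_cball)
      also have "\<dots> = ennreal (?V * a)"
        using True pos(1) by simp
      finally have "emeasure ?M {..a} = ennreal (?V * a)" .
      moreover have "emeasure ?N {..a} = ennreal (?V * a)"
        unfolding N using True pos by (simp add: ennreal_mult)
      ultimately show ?thesis by simp
    next
      case False
      then have "{z. norm (z - x) ^ ?d \<le> a} = {}" "{0..a} = {}"
        using zero_le_power [OF norm_ge_zero, of _ ?d] by (auto simp: not_le intro: less_le_trans)
      then show ?thesis
        unfolding M N by simp
    qed
    then show "emeasure ?M {..a} = emeasure ?N {..a}" "emeasure ?M {..a} \<noteq> \<infinity>"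
      by auto
  qed
  show ?thesis
  proof (rule measure_eqI_generator_eq [of "range atMost" UNIV _ _ "\<lambda>i. {..real i}"])
    show "Int_stable (range (atMost :: real \<Rightarrow> _))"
      by (auto simp: Int_stable_def)
    show "sets ?M = sigma_sets UNIV (range atMost)" "sets ?N = sigma_sets UNIV (range atMost)"
      by (simp_all add: borel_eq_atMost)
    show "(\<Union>i. {..real i}) = UNIV"
      using real_arch_simple by auto
  qed (use eq fin in auto)
qed

text \<open>A radial bump on the region where the power of the norm lies between \<open>a\<close>
  and \<open>2 * a\<close>. Division by \<open>a\<close> gives all these bumps the same
  integral.\<close>

definition shell :: "'a::euclidean_space \<Rightarrow> real \<Rightarrow> 'a \<Rightarrow> real" where
  "shell x a z = tent (norm (z - x) ^ DIM('a) / a - 1) / a"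

lemma shell_nonneg: "a > 0 \<Longrightarrow> shell x a z \<ge> 0"
  by (simp add: shell_def tent_nonneg)

lemma shell_eq_0: "a > 0 \<Longrightarrow> norm (z - x) ^ DIM('a) \<le> a \<or> norm (z - x) ^ DIM('a) \<ge> 2 * a \<Longrightarrow> shell x a z = 0"
  for x z :: "'a::euclidean_space"
  by (auto simp: shell_def field_simps intro!: tent_eq_0)

lemma borel_measurable_shell [measurable]: "shell x a \<in> borel_measurable borel"
  unfolding shell_def [abs_def] divide_inverse
  by (intro borel_measurable_continuous_onI continuous_intros)

text \<open>In the variable \<open>r = norm (z - x) ^ DIM('a)\<close> the measure has constant
  density, and the integral becomes the increase of \<open>smooth_step\<close> from -1 to 1, which
  is 1.\<close>

lemma has_bochner_integral_shell:
  fixes x :: "'a::euclidean_space"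
  assumes a: "a > 0"
  shows "has_bochner_integral lborel (shell x a) (unit_ball_vol (real DIM('a)))"
proof (rule has_bochner_integral_nn_integral)
  let ?V = "unit_ball_vol (real DIM('a))"
  define k where "k r = tent (r / a - 1) / a" for r
  have k: "k \<in> borel_measurable borel"
    unfolding k_def [abs_def] divide_inverse by (intro borel_measurable_continuous_onI continuous_intros)
  have k_nonneg: "0 \<le> k r" for r
    using a by (simp add: k_def tent_nonneg)
  have "(\<integral>\<^sup>+z. ennreal (shell x a z) \<partial>lborel) = (\<integral>\<^sup>+z. ennreal (k (norm (z - x) ^ DIM('a))) \<partial>lborel)"
    by (simp add: shell_def k_def)
  also have "\<dots> = (\<integral>\<^sup>+r. ennreal (k r) \<partial>distr lborel borel (\<lambda>z. norm (z - x) ^ DIM('a)))"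
    using k by (subst nn_integral_distr) auto
  also have "\<dots> = (\<integral>\<^sup>+r. ennreal (?V * indicator {0..} r) * ennreal (k r) \<partial>lborel)"
    unfolding distr_norm_power using k by (subst nn_integral_density) auto
  also have "\<dots> = (\<integral>\<^sup>+r. ennreal ?V * (ennreal (k r) * indicator {0..2*a} r) \<partial>lborel)"
    using a by (intro nn_integral_cong) (auto simp: indicator_def k_def tent_eq_0 field_simps)
  also have "\<dots> = ennreal ?V * (\<integral>\<^sup>+r. ennreal (k r) * indicator {0..2*a} r \<partial>lborel)"
    using k by (subst nn_integral_cmult) auto
  also have "(\<integral>\<^sup>+r. ennreal (k r) * indicator {0..2*a} r \<partial>lborel) =
      ennreal (smooth_step (2 * a / a - 1) - smooth_step (0 / a - 1))"
  proof (rule nn_integral_FTC_Icc)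
    fix r :: real
    have "((\<lambda>r. r / a - 1) has_real_derivative 1 / a) (at r)"
      using a by (auto intro!: derivative_eq_intros)
    from DERIV_chain2 [OF DERIV_smooth_step this]
    show "((\<lambda>r. smooth_step (r / a - 1)) has_real_derivative k r) (at r)"
      by (simp add: k_def)
  qed (use a k k_nonneg in auto)
  also have "\<dots> = 1"
    using a by (simp add: smooth_step_le_0 smooth_step_ge_1)
  finally show "(\<integral>\<^sup>+z. ennreal (shell x a z) \<partial>lborel) = ennreal ?V" by simp
qed (use a shell_nonneg in auto)

text \<open>Used at both ends: with small \<open>a\<close> and \<open>c\<close> the value near the
  centre, and with a large radius and \<open>c\<close> the limit at infinity.\<close>

lemma shell_average:
  fixes x :: "'a::euclidean_space" and g :: "'a \<Rightarrow> 'b::euclidean_space"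
  assumes a: "a > 0" and g: "g \<in> borel_measurable borel" and \<epsilon>: "0 \<le> \<epsilon>"
    and close: "\<And>z. a \<le> norm (z - x) ^ DIM('a) \<Longrightarrow> norm (z - x) ^ DIM('a) \<le> 2 * a \<Longrightarrow> norm (g z - c) \<le> \<epsilon>"
  shows "integrable lborel (\<lambda>z. shell x a z *\<^sub>R g z)"
    and "norm ((\<integral>z. shell x a z *\<^sub>R g z \<partial>lborel) - unit_ball_vol (real DIM('a)) *\<^sub>R c)
      \<le> unit_ball_vol (real DIM('a)) * \<epsilon>"
proof -
  let ?V = "unit_ball_vol (real DIM('a))"
  have int: "integrable lborel (shell x a)" and V: "(\<integral>z. shell x a z \<partial>lborel) = ?V"
    using has_bochner_integral_shell [OF a, of x] by (auto simp: has_bochner_integral_iff)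
  have bound: "norm (shell x a z *\<^sub>R (g z - c)) \<le> shell x a z * \<epsilon>" for z
  proof (cases "a \<le> norm (z - x) ^ DIM('a) \<and> norm (z - x) ^ DIM('a) \<le> 2 * a")
    case True
    then show ?thesis
      using close [of z] shell_nonneg [OF a, of x z] by (simp add: mult_left_mono)
  next
    case False
    then show ?thesis
      using shell_eq_0 [OF a, of z x] by auto
  qed
  have int': "integrable lborel (\<lambda>z. shell x a z *\<^sub>R (g z - c))"
  proof (rule Bochner_Integration.integrable_bound)
    show "integrable lborel (\<lambda>z. shell x a z * \<epsilon>)"
      using int by simp
    show "(\<lambda>z. shell x a z *\<^sub>R (g z - c)) \<in> borel_measurable lborel"
      using g by measurable
    show "AE z in lborel. norm (shell x a z *\<^sub>R (g z - c)) \<le> norm (shell x a z * \<epsilon>)"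
      by (intro AE_I2 order_trans [OF bound]) simp
  qed
  have c: "has_bochner_integral lborel (\<lambda>z. shell x a z *\<^sub>R c) (?V *\<^sub>R c)"
    using has_bochner_integral_scaleR_left [OF has_bochner_integral_shell [OF a]] by blast
  have eq: "(\<lambda>z. shell x a z *\<^sub>R g z) = (\<lambda>z. shell x a z *\<^sub>R (g z - c) + shell x a z *\<^sub>R c)"
    by (simp add: algebra_simps)
  show "integrable lborel (\<lambda>z. shell x a z *\<^sub>R g z)"
    unfolding eq using int' c by (auto simp: has_bochner_integral_iff)
  have "(\<integral>z. shell x a z *\<^sub>R g z \<partial>lborel) = (\<integral>z. shell x a z *\<^sub>R (g z - c) \<partial>lborel) + ?V *\<^sub>R c"
    unfolding eq using int' c by (subst Bochner_Integration.integral_add) (auto simp: has_bochner_integral_iff)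
  moreover have "norm (\<integral>z. shell x a z *\<^sub>R (g z - c) \<partial>lborel) \<le> (\<integral>z. shell x a z * \<epsilon> \<partial>lborel)"
    by (rule Bochner_Integration.integral_norm_bound_integral) (use int' int bound in auto)
  ultimately show "norm ((\<integral>z. shell x a z *\<^sub>R g z \<partial>lborel) - ?V *\<^sub>R c) \<le> ?V * \<epsilon>"
    by (simp add: V)
qed

section \<open>Transport along isometries\<close>

text \<open>The left inverse is required on \<Gamma> only, so that the lemma serves for the isometry
  into the Clifford algebra and for its left inverse, which need not be injective on the whole
  algebra. Injectivity of the new derivative follows by differentiating
  \<open>B \<circ> A \<circ> \<phi> = \<phi>\<close>.\<close>

lemma surface_patch_linear_image:
  fixes A :: "'a::euclidean_space \<Rightarrow> 'b::euclidean_space" and \<phi> :: "real^'m::finite \<Rightarrow> 'a"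
  assumes A: "linear A" and B: "linear B" and BA: "\<And>y. y \<in> \<Gamma> \<Longrightarrow> B (A y) = y"
    and patch: "surface_patch \<Gamma> D \<phi>"
  shows "surface_patch (A ` \<Gamma>) D (A \<circ> \<phi>)"
    and "t \<in> D \<Longrightarrow> frechet_derivative (A \<circ> \<phi>) (at t) = A \<circ> frechet_derivative \<phi> (at t)"
proof -
  note D = surface_patch_open [OF patch]
  have blA: "bounded_linear A" and blB: "bounded_linear B"
    using A B by (simp_all add: linear_conv_bounded_linear)
  have contA: "continuous_on S A" and contB: "continuous_on T B" for S T
    using blA blB by (simp_all add: linear_continuous_on)
  have sub: "\<phi> t \<in> \<Gamma>" if "t \<in> D" for t
    using that surface_patch_subset [OF patch] by blast
  have der: "(A \<circ> \<phi> has_derivative A \<circ> frechet_derivative \<phi> (at t)) (at t)" if "t \<in> D" for t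
    unfolding o_def by (rule bounded_linear.has_derivative [OF blA surface_patch_derivative [OF patch that]])
  show fd: "frechet_derivative (A \<circ> \<phi>) (at t) = A \<circ> frechet_derivative \<phi> (at t)" if "t \<in> D" for t
    using frechet_derivative_at [OF der [OF that]] by simp
  have hom: "homeomorphism \<Gamma> (A ` \<Gamma>) A B"
    using BA contA contB by (intro homeomorphismI) auto
  obtain \<psi> where \<psi>: "homeomorphism D (\<phi> ` D) \<phi> \<psi>"
    using patch by (auto simp: surface_patch_def)
  have hom': "homeomorphism (\<phi> ` D) (A ` \<phi> ` D) A B"
    using hom sub by (intro homeomorphism_of_subsets [OF hom]) auto
  obtain \<phi>' where \<phi>': "continuous_on D \<phi>'" "\<And>t. t \<in> D \<Longrightarrow> (\<phi> has_derivative blinfun_apply (\<phi>' t)) (at t within D)"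
    using patch by (auto simp: surface_patch_def C1_on_def)
  show "surface_patch (A ` \<Gamma>) D (A \<circ> \<phi>)"
    unfolding surface_patch_def
  proof (intro conjI)
    show "openin (top_of_set (A ` \<Gamma>)) ((A \<circ> \<phi>) ` D)"
      using homeomorphism_imp_open_map [OF hom surface_patch_openin [OF patch]] by (simp add: image_comp)
    show "\<exists>\<psi>. homeomorphism D ((A \<circ> \<phi>) ` D) (A \<circ> \<phi>) \<psi>"
      using homeomorphism_compose [OF \<psi> hom'] by (auto simp: image_comp)
    show "C1_on D (A \<circ> \<phi>)"
      unfolding C1_on_def
    proof (intro exI conjI ballI)
      show "continuous_on D (\<lambda>t. Blinfun A o\<^sub>L \<phi>' t)"
        by (intro continuous_intros \<phi>'(1))
      fix t assume "t \<in> D"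
      then show "(A \<circ> \<phi> has_derivative blinfun_apply (Blinfun A o\<^sub>L \<phi>' t)) (at t within D)"
        using bounded_linear.has_derivative [OF blA \<phi>'(2)] blA
        by (simp add: blinfun_compose.rep_eq bounded_linear_Blinfun_apply o_def)
    qed
    show "\<forall>t\<in>D. inj (frechet_derivative (A \<circ> \<phi>) (at t))"
    proof
      fix t assume t: "t \<in> D"
      have "(B \<circ> (A \<circ> \<phi>) has_derivative B \<circ> (A \<circ> frechet_derivative \<phi> (at t))) (at t)"
        unfolding o_def [of B] by (rule bounded_linear.has_derivative [OF blB der [OF t]])
      then have "(\<phi> has_derivative B \<circ> (A \<circ> frechet_derivative \<phi> (at t))) (at t)"
        by (rule has_derivative_transform_within_open [OF _ D t]) (simp add: BA sub)
      then have "B \<circ> (A \<circ> frechet_derivative \<phi> (at t)) = frechet_derivative \<phi> (at t)"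
        by (rule has_derivative_unique [OF _ surface_patch_derivative [OF patch t]])
      then show "inj (frechet_derivative (A \<circ> \<phi>) (at t))"
        unfolding fd [OF t] by (metis inj_on_imageI2 surface_patch_immersion [OF patch t])
    qed
  qed (rule D)
qed

lemma inner_isometry:
  assumes "linear f" and "\<And>x. norm (f x) = norm x"
  shows "f x \<bullet> f y = x \<bullet> y"
proof -
  have "(f x + f y) \<bullet> (f x + f y) = (x + y) \<bullet> (x + y)" "f x \<bullet> f x = x \<bullet> x" "f y \<bullet> f y = y \<bullet> y"
    using assms by (simp_all add: linear_add [symmetric] flip: power2_norm_eq_inner)
  then show ?thesis
    by (simp add: inner_add_left inner_add_right inner_commute)
qed

text \<open>A patch of \<Gamma> becomes a patch of \<open>A\<close> \<Gamma>\<open>with the same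
  Gram matrices, hence the same area element. Off\<close>A \<open>\<Gamma>\<close> the measure \<mu>
  is null, so \<open>B\<close> need only undo \<open>A\<close>.\<close>

lemma is_surface_measure_isometry:
  fixes A :: "'a::euclidean_space \<Rightarrow> 'b::euclidean_space"
  assumes A: "linear A" "\<And>x. norm (A x) = norm x" and B: "linear B" and BA: "\<And>x. B (A x) = x"
    and \<Gamma>: "compact \<Gamma>" and \<mu>: "is_surface_measure TYPE('m::finite) (A ` \<Gamma>) \<mu>"
  shows "is_surface_measure TYPE('m) \<Gamma> (distr \<mu> borel B)"
proof -
  have sets_\<mu>: "sets \<mu> = sets borel" and null: "emeasure \<mu> (- A ` \<Gamma>) = 0"
    using \<mu> by (auto simp: is_surface_measure_def)
  have space_\<mu>: "space \<mu> = UNIV"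
    using sets_eq_imp_space_eq [OF sets_\<mu>] by simp
  have contB: "continuous_on T B" and contA: "continuous_on S A" for S T
    using A(1) B by (simp_all add: linear_continuous_on linear_conv_bounded_linear)
  have B_meas: "B \<in> measurable \<mu> borel"
    using borel_measurable_continuous_onI [OF contB] by (simp add: measurable_cong_sets [OF sets_\<mu> refl])
  have A\<Gamma>: "compact (A ` \<Gamma>)"
    using contA \<Gamma> by (rule compact_continuous_image)
  have emeasure: "emeasure (distr \<mu> borel B) C = emeasure \<mu> (A ` (C \<inter> \<Gamma>))" if C: "C \<in> sets borel" for C
  proof -
    have BC: "B -` C \<in> sets \<mu>"
      using measurable_sets [OF B_meas C] by (simp add: space_\<mu>)
    have "emeasure (distr \<mu> borel B) C = emeasure \<mu> (B -` C)"
      using emeasure_distr [OF B_meas C] by (simp add: space_\<mu>)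
    also have "\<dots> = emeasure \<mu> (B -` C - - A ` \<Gamma>)"
      using A\<Gamma> null BC
      by (intro emeasure_Diff_null_set [symmetric]) (auto simp: null_sets_def sets_\<mu> dest!: compact_imp_closed)
    also have "B -` C - - A ` \<Gamma> = A ` (C \<inter> \<Gamma>)"
      by (auto simp: BA)
    finally show ?thesis .
  qed
  show ?thesis
    unfolding is_surface_measure_def
  proof (intro conjI allI impI)
    show "emeasure (distr \<mu> borel B) (- \<Gamma>) = 0"
      using \<Gamma> by (subst emeasure) (auto dest: compact_imp_closed)
    fix D :: "(real^'m) set" and \<phi> and C
    assume patch: "surface_patch \<Gamma> D \<phi>" and C: "C \<in> sets borel" "C \<subseteq> D"
    note AP = surface_patch_linear_image [OF A(1) B BA patch]
    have "\<phi> ` C \<inter> \<Gamma> = \<phi> ` C"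
      using C(2) surface_patch_subset [OF patch] by blast
    then have "emeasure (distr \<mu> borel B) (\<phi> ` C) = emeasure \<mu> ((A \<circ> \<phi>) ` C)"
      by (subst emeasure) (simp_all add: surface_patch_borel_image [OF patch \<Gamma> C] image_comp)
    also have "\<dots> = (\<integral>\<^sup>+t\<in>C. ennreal (area_element (A \<circ> \<phi>) t) \<partial>lborel)"
      using \<mu> AP(1) C unfolding is_surface_measure_def by blast
    also have "\<dots> = (\<integral>\<^sup>+t\<in>C. ennreal (area_element \<phi> t) \<partial>lborel)"
    proof (intro nn_integral_cong)
      fix t
      have "area_element (A \<circ> \<phi>) t = area_element \<phi> t" if "t \<in> C"
        using AP(2) [of t] that C(2) by (auto simp: area_element_def inner_isometry [OF A])
      then show "ennreal (area_element (A \<circ> \<phi>) t) * indicator C t = ennreal (area_element \<phi> t) * indicator C t"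
        by (cases "t \<in> C") auto
    qed
    finally show "emeasure (distr \<mu> borel B) (\<phi> ` C) = (\<integral>\<^sup>+t\<in>C. ennreal (area_element \<phi> t) \<partial>lborel)" .
  qed simp
qed

section \<open>Paravectors\<close>

lemma bounded_bilinear_clifford:
  "bounded_bilinear ((*) :: 'n::{finite,linorder} clifford \<Rightarrow> 'n clifford \<Rightarrow> 'n clifford)"
proof -
  have "bilinear ((*) :: 'n clifford \<Rightarrow> 'n clifford \<Rightarrow> 'n clifford)"
    unfolding bilinear_def by (auto intro!: linearI simp: algebra_simps)
  then show ?thesis
    by (simp add: bilinear_conv_bounded_bilinear)
qed

lemma linear_clifford_cnj: "linear (clifford_cnj :: 'n::{finite,linorder} clifford \<Rightarrow> 'n clifford)"
  by (rule linearI; rule clifford_eqI)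
    (simp_all add: clifford_cnj.rep_eq plus_clifford.rep_eq scaleR_clifford.rep_eq algebra_simps)

lemma inner_cl_e:
  assumes "i \<le> CARD('n::{finite,linorder})" "j \<le> CARD('n)"
  shows "cl_e i \<bullet> (cl_e j :: 'n clifford) = (if i = j then 1 else 0)"
proof -
  define l where "l = sorted_list_of_set (UNIV :: 'n set)"
  have l: "distinct l" "length l = CARD('n)"
    by (simp_all add: l_def)
  define s where "s k = (if k = 0 then {} else {l ! (k - 1)})" for k
  have e: "cl_e k = blade (s k)" for k
    by (simp add: cl_e_def s_def l_def one_clifford_def)
  have "blade (s i) \<in> (Basis :: 'n clifford set)" "blade (s j) \<in> (Basis :: 'n clifford set)"
    by (simp_all add: Basis_clifford_def)
  then have "cl_e i \<bullet> (cl_e j :: 'n clifford) = (if blade (s i) = (blade (s j) :: 'n clifford) then 1 else 0)"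
    unfolding e by (rule inner_Basis)
  also have "blade (s i) = (blade (s j) :: 'n clifford) \<longleftrightarrow> s i = s j"
  proof
    assume "blade (s i) = (blade (s j) :: 'n clifford)"
    then have "cl_coeff (blade (s i)) (s i) = cl_coeff (blade (s j) :: 'n clifford) (s i)"
      by simp
    then show "s i = s j"
      by (simp add: blade.rep_eq split: if_splits)
  qed simp
  also have "s i = s j \<longleftrightarrow> i = j"
  proof (cases "i = 0 \<or> j = 0")
    case False
    then have "i - 1 < length l" "j - 1 < length l"
      using assms l(2) by auto
    then show ?thesis
      using False nth_eq_iff_index_eq [OF l(1), of "i - 1" "j - 1"] by (auto simp: s_def)
  qed (auto simp: s_def)
  finally show ?thesis .
qed

text \<open>Both sides are bilinear, so generators suffice; there the identity is the
  anticommutation relation with one sign from conjugation, and a direct check when one factor is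
  \<open>cl_e 0 = 1\<close>.\<close>

lemma clifford_cnj_mult_polarized:
  fixes x y :: "'n::{finite,linorder} clifford"
  assumes "x \<in> span (cl_e ` {0..CARD('n)})" "y \<in> span (cl_e ` {0..CARD('n)})"
  shows "clifford_cnj x * y + clifford_cnj y * x = (2 * (x \<bullet> y)) *\<^sub>R 1"
proof -
  let ?B = "cl_e ` {0..CARD('n)} :: 'n clifford set"
  have add: "clifford_cnj (a + b) = clifford_cnj a + clifford_cnj b"
    and scale: "clifford_cnj (r *\<^sub>R a) = r *\<^sub>R clifford_cnj a" for a b :: "'n clifford" and r
    using linear_add [OF linear_clifford_cnj] linear_cmul [OF linear_clifford_cnj] by auto
  have "bilinear (\<lambda>x y :: 'n clifford. clifford_cnj x * y + clifford_cnj y * x)"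
    unfolding bilinear_def by (auto intro!: linearI simp: add scale algebra_simps)
  moreover have "bilinear (\<lambda>x y :: 'n clifford. (2 * (x \<bullet> y)) *\<^sub>R (1 :: 'n clifford))"
    unfolding bilinear_def
    by (auto intro!: linearI simp: inner_add_left inner_add_right algebra_simps)
  moreover have "clifford_cnj u * v + clifford_cnj v * u = (2 * (u \<bullet> v)) *\<^sub>R 1" if "u \<in> ?B" "v \<in> ?B" for u v
  proof -
    obtain i j where ij: "u = cl_e i" "v = cl_e j" "i \<le> CARD('n)" "j \<le> CARD('n)"
      using \<open>u \<in> ?B\<close> \<open>v \<in> ?B\<close> by auto
    have e0: "cl_e 0 = (1 :: 'n clifford)"
      by (simp add: cl_e_def)
    have two: "(2 :: real) *\<^sub>R (1 :: 'n clifford) = 2"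
      by (metis of_real_def of_real_numeral)
    show ?thesis
    proof (cases "i = 0 \<or> j = 0")
      case True
      then show ?thesis
        using ij by (auto simp: inner_cl_e clifford_cnj_cl_e e0 two)
    next
      case False
      then have "cl_e i * cl_e j + cl_e j * cl_e i = (if i = j then - 2 else 0 :: 'n clifford)"
        using ij by (intro cl_e_anticommute) auto
      then have "- (cl_e i * cl_e j) - cl_e j * cl_e i = (if i = j then 2 else 0 :: 'n clifford)"
        by (metis (no_types, lifting) add.inverse_inverse minus_add_distrib neg_0_equal_iff_equal uminus_add_conv_diff add.commute)
      then show ?thesis
        using ij False by (auto simp: inner_cl_e clifford_cnj_cl_e two split: if_splits)
    qed
  qed
  ultimately show ?thesis
    using bilinear_eq [of _ _ "span ?B" ?B "span ?B" ?B x y] assms by blast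
qed

lemma clifford_cnj_mult_self:
  fixes x :: "'n::{finite,linorder} clifford"
  assumes "x \<in> span (cl_e ` {0..CARD('n)})"
  shows "clifford_cnj x * x = (norm x)\<^sup>2 *\<^sub>R 1"
proof -
  have "2 *\<^sub>R (clifford_cnj x * x) = 2 *\<^sub>R ((norm x)\<^sup>2 *\<^sub>R 1)"
    using clifford_cnj_mult_polarized [OF assms assms]
    unfolding scaleR_2 [of "clifford_cnj x * x"] power2_norm_eq_inner scaleR_scaleR .
  then show ?thesis
    by (rule scaleR_left_imp_eq [rotated]) simp
qed

section \<open>The slice as a Euclidean space with an orthonormal frame\<close>

locale slice_frame =
  fixes p q :: nat and \<eta> :: "'n::{finite,linorder} clifford"
  assumes card_n: "CARD('n) = p + q" and \<eta>: "\<eta> \<in> unit_sphere p q"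
begin

lemma span_vector: "\<eta> \<in> span (cl_e ` {p + 1..p + q})"
  using \<eta> by (simp add: unit_sphere_def)

lemma span_mono_e: "A \<subseteq> {0..p + q} \<Longrightarrow> span (cl_e ` A) \<subseteq> span (cl_e ` {0..CARD('n)} :: 'n clifford set)"
  unfolding card_n by (intro span_mono image_mono)

lemma inner_e: "i \<le> p + q \<Longrightarrow> j \<le> p + q \<Longrightarrow> cl_e i \<bullet> (cl_e j :: 'n clifford) = (if i = j then 1 else 0)"
  by (simp add: inner_cl_e card_n)

lemma \<eta>_orthogonal: "i \<le> p \<Longrightarrow> \<eta> \<bullet> cl_e i = 0"
proof -
  assume i: "i \<le> p"
  have "span (cl_e ` {p + 1..p + q}) \<subseteq> {x :: 'n clifford. x \<bullet> cl_e i = 0}"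
    by (rule span_minimal) (use i in \<open>auto simp: inner_e subspace_hyperplane2\<close>)
  then show "\<eta> \<bullet> cl_e i = 0"
    using span_vector by blast
qed

text \<open>The sphere is defined algebraically by \<eta> squared being -1. Conjugation is negation
  on vectors, so \<open>clifford_cnj \<eta> * \<eta>\<close> is both 1 and the squared norm.\<close>

lemma norm_\<eta>: "norm \<eta> = 1"
proof -
  have "clifford_cnj x = - x" if "x \<in> span (cl_e ` {p + 1..p + q})" for x :: "'n clifford"
    by (rule linear_eq_on_span [OF linear_clifford_cnj _ _ that])
      (auto intro!: linearI simp: clifford_cnj_cl_e)
  then have "clifford_cnj \<eta> * \<eta> = - (\<eta> * \<eta>)"
    using span_vector by simp
  also have "\<dots> = 1"
    using \<eta> by (simp add: unit_sphere_def)
  finally have "(norm \<eta>)\<^sup>2 *\<^sub>R (1 :: 'n clifford) = 1 *\<^sub>R 1"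
    using clifford_cnj_mult_self [of \<eta>] span_vector span_mono_e [of "{p + 1..p + q}"] by auto
  then have "(norm \<eta>)\<^sup>2 = 1"
    by (simp only: scaleR_cancel_right) simp
  then have "norm \<eta> = 1 \<or> norm \<eta> = - 1"
    by (simp add: power2_eq_1_iff)
  then show ?thesis
    using norm_ge_zero [of \<eta>] by linarith
qed

text \<open>Putting \<eta> at index \<open>p + 1\<close> after \<open>cl_e 0\<close>, ...,
  \<open>cl_e p\<close> turns the Dirac operator of the slice into a single sum over an orthonormal
  basis.\<close>

definition frame :: "nat \<Rightarrow> 'n clifford" where
  "frame i = (if i \<le> p then cl_e i else \<eta>)"

lemma frame_inner: "i \<le> p + 1 \<Longrightarrow> j \<le> p + 1 \<Longrightarrow> frame i \<bullet> frame j = (if i = j then 1 else 0)"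
  using \<eta>_orthogonal norm_\<eta> by (auto simp: frame_def inner_e inner_commute norm_eq_1)

lemma frame_image: "frame ` {0..p + 1} = insert \<eta> (cl_e ` {0..p})"
proof -
  have "{0..p + 1} = insert (p + 1) {0..p}"
    by auto
  then show ?thesis
    by (auto simp: frame_def image_iff)
qed

lemma slice_eq_span: "slice p \<eta> = span (frame ` {0..p + 1})"
proof (intro equalityI subsetI)
  fix x assume "x \<in> slice p \<eta>"
  then obtain xp r where "x = xp + r *\<^sub>R \<eta>" "xp \<in> span (cl_e ` {0..p})"
    by (auto simp: slice_def)
  then show "x \<in> span (frame ` {0..p + 1})"
    unfolding frame_image by (simp add: span_breakdown_eq exI [of _ r])
next
  fix x assume "x \<in> span (frame ` {0..p + 1})"
  then obtain r where "x - r *\<^sub>R \<eta> \<in> span (cl_e ` {0..p})"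
    unfolding frame_image span_breakdown_eq by blast
  then show "x \<in> slice p \<eta>"
    unfolding slice_def by (metis (mono_tags, lifting) diff_add_cancel mem_Collect_eq)
qed

lemma subspace_slice: "subspace (slice p \<eta>)"
  by (simp add: slice_eq_span subspace_span)

lemma frame_in_slice: "i \<le> p + 1 \<Longrightarrow> frame i \<in> slice p \<eta>"
  unfolding slice_eq_span by (intro span_base) auto

lemma slice_subset_paravectors: "slice p \<eta> \<subseteq> span (cl_e ` {0..CARD('n)})"
proof -
  have "span (cl_e ` {0..p}) \<subseteq> span (cl_e ` {0..CARD('n)} :: 'n clifford set)"
    by (rule span_mono_e) auto
  moreover have "\<eta> \<in> span (cl_e ` {0..CARD('n)})"
    using span_vector span_mono_e [of "{p + 1..p + q}"] by auto
  ultimately show ?thesis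
    unfolding slice_def by (auto intro!: span_add span_scale)
qed

lemma dim_slice: "dim (slice p \<eta>) = p + 2"
proof -
  have inj: "inj_on frame {0..p + 1}"
  proof (rule inj_onI)
    fix i j assume ij: "i \<in> {0..p + 1}" "j \<in> {0..p + 1}" and eq: "frame i = frame j"
    then have "frame i \<bullet> frame j = 1"
      using frame_inner [of j j] by simp
    then show "i = j"
      using frame_inner [of i j] ij by (auto split: if_splits)
  qed
  have "pairwise orthogonal (frame ` {0..p + 1})"
    unfolding pairwise_image by (auto simp: pairwise_def orthogonal_def frame_inner)
  moreover have "0 \<notin> frame ` {0..p + 1}"
  proof
    assume "0 \<in> frame ` {0..p + 1}"
    then obtain i where "i \<le> p + 1" "frame i = 0" by auto
    then show False
      using frame_inner [of i i] by simp
  qed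
  ultimately have "independent (frame ` {0..p + 1})"
    by (rule pairwise_orthogonal_independent)
  from dim_eq_card_independent [OF this] show ?thesis
    unfolding slice_eq_span dim_span card_image [OF inj] by simp
qed

lemma frame_expansion:
  assumes "y \<in> slice p \<eta>"
  shows "(\<Sum>i=0..p + 1. (y \<bullet> frame i) *\<^sub>R frame i) = y"
proof -
  have "y \<in> span (frame ` {0..p + 1})"
    using assms by (simp add: slice_eq_span)
  moreover have "linear (\<lambda>y. \<Sum>i=0..p + 1. (y \<bullet> frame i) *\<^sub>R frame i)"
    by (rule linearI) (simp_all add: inner_add_left scaleR_left_distrib sum.distrib scaleR_sum_right del: sum.cl_ivl_Suc)
  moreover have "linear (\<lambda>y. y :: 'n clifford)"
    by (rule linearI) auto
  moreover have "(\<Sum>i=0..p + 1. (u \<bullet> frame i) *\<^sub>R frame i) = u" if u: "u \<in> frame ` {0..p + 1}" for u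
  proof -
    obtain j where j: "j \<in> {0..p + 1}" "u = frame j"
      using u by auto
    have "(\<Sum>i=0..p + 1. (u \<bullet> frame i) *\<^sub>R frame i) = (\<Sum>i=0..p + 1. if i = j then frame j else 0)"
      using j by (intro sum.cong) (auto simp: frame_inner)
    also have "\<dots> = u"
      using j by (subst sum.delta) auto
    finally show ?thesis .
  qed
  ultimately show ?thesis
    using linear_eq_on_span [of "\<lambda>y. \<Sum>i=0..p + 1. (y \<bullet> frame i) *\<^sub>R frame i" "\<lambda>y. y" "frame ` {0..p + 1}" y]
    by blast
qed

lemma frame_cnj_mult: "i \<le> p + 1 \<Longrightarrow> clifford_cnj (frame i) * frame i = 1"
  using clifford_cnj_mult_self [of "frame i"] frame_in_slice slice_subset_paravectors frame_inner [of i i]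
  by (auto simp: power2_norm_eq_inner)

text \<open>On the slice the direction of \<open>x\<close> is \<eta> or -\<eta> according to the
  sign of \<open>r\<close>. Since \<open>\<eta> * \<eta> = -1\<close>, one coefficient of the kernel
  is then 1 and the other 0, and the surviving argument is \<open>x\<close>. For
  \<open>r = 0\<close> both arguments coincide and the coefficients add up to 1 whatever direction
  was chosen.\<close>

lemma gps_kernel_eq_cauchy:
  assumes x: "x \<in> slice p \<eta>"
  shows "gps_kernel p q \<eta> y x = cauchy_E p (y - x)"
proof -
  obtain xp r where xr: "x = xp + r *\<^sub>R \<eta>" "xp \<in> span (cl_e ` {0..p})"
    using x by (auto simp: slice_def)
  have lin: "linear (para_part p :: 'n clifford \<Rightarrow> _)" "linear (vec_part p q :: 'n clifford \<Rightarrow> _)"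
    unfolding para_part_def [abs_def] vec_part_def [abs_def]
    by (auto intro!: linearI simp: inner_add_left scaleR_left_distrib sum.distrib scaleR_sum_right)
  have delta: "(\<Sum>i\<in>I. (cl_e j \<bullet> (cl_e i :: 'n clifford)) *\<^sub>R cl_e i) = (if j \<in> I then cl_e j else 0 :: 'n clifford)"
    if "j \<le> p + q" "I \<subseteq> {0..p + q}" for j I
  proof -
    have "(\<Sum>i\<in>I. (cl_e j \<bullet> (cl_e i :: 'n clifford)) *\<^sub>R cl_e i) = (\<Sum>i\<in>I. if i = j then cl_e j else 0 :: 'n clifford)"
      using that by (intro sum.cong) (auto simp: inner_e subset_iff)
    also have "\<dots> = (if j \<in> I then cl_e j else 0)"
      using finite_subset [OF that(2)] by (subst sum.delta) auto
    finally show ?thesis .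
  qed
  have id: "linear (\<lambda>y :: 'n clifford. y)" "linear (\<lambda>y :: 'n clifford. 0 :: 'n clifford)"
    by (auto intro: linearI)
  have "para_part p xp = xp" "vec_part p q xp = 0"
    by (rule linear_eq_on_span [OF lin(1) id(1) _ xr(2)] linear_eq_on_span [OF lin(2) id(2) _ xr(2)];
        auto simp: para_part_def vec_part_def delta)+
  moreover have "para_part p \<eta> = 0" "vec_part p q \<eta> = \<eta>"
    by (rule linear_eq_on_span [OF lin(1) id(2) _ span_vector] linear_eq_on_span [OF lin(2) id(1) _ span_vector];
        auto simp: para_part_def vec_part_def delta)+
  ultimately have parts: "para_part p x = xp" "vec_part p q x = r *\<^sub>R \<eta>"
    using lin by (simp_all add: xr(1) linear_add linear_cmul)
  have \<eta>\<eta>: "\<eta> * \<eta> = -1"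
    using \<eta> by (simp add: unit_sphere_def)
  have \<eta>_nz: "\<eta> \<noteq> 0"
    using norm_\<eta> by auto
  have half: "(1 / 2) *\<^sub>R ((2 :: 'n clifford) * u) = u" for u
  proof -
    have "(2 :: 'n clifford) * u = 2 *\<^sub>R u"
      by (simp add: scaleR_2 mult_2)
    then show ?thesis by simp
  qed
  consider "r = 0" | "r > 0" | "r < 0" by linarith
  then show ?thesis
  proof cases
    case 1
    have "(1 / 2) *\<^sub>R ((1 - w) * u) + (1 / 2) *\<^sub>R ((1 + w) * u) = u" for w u :: "'n clifford"
    proof -
      have "(1 - w) * u + (1 + w) * u = 2 * u"
        by (simp add: algebra_simps mult_2)
      then show ?thesis
        by (simp only: scaleR_right_distrib [symmetric] half)
    qed
    then show ?thesis
      unfolding gps_kernel_def Let_def parts using 1 by (simp add: xr(1))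
  next
    case 2
    then have dir: "direction p q x = \<eta>"
      using \<eta>_nz norm_\<eta> by (simp add: direction_def parts)
    show ?thesis
      unfolding gps_kernel_def Let_def parts dir using 2 half by (simp add: xr(1) norm_\<eta> \<eta>\<eta>)
  next
    case 3
    then have dir: "direction p q x = - \<eta>"
      using \<eta>_nz norm_\<eta> by (simp add: direction_def parts)
    show ?thesis
      unfolding gps_kernel_def Let_def parts dir using 3 half by (simp add: xr(1) norm_\<eta> \<eta>\<eta>)
  qed
qed

end

text \<open>The area of the unit sphere is the dimension times the volume of the unit ball. In this
  form the normalisation of the kernel cancels against the mass of the shells and the factor from
  the Dirac derivative.\<close>

lemma sphere_area_eq: "sphere_area p = real (p + 2) * unit_ball_vol (real (p + 2))"
proof -
  have 1: "Gamma (1 / 2 :: real) ^ (p + 2) = pi powr (real (p + 2) / 2)"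
  proof -
    have 1: "Gamma (1 / 2 :: real) ^ (p + 2) = (pi powr (1 / 2)) powr real (p + 2)"
      by (subst powr_realpow) (simp_all add: Gamma_one_half_real powr_half_sqrt)
    also have "\<dots> = pi powr (real (p + 2) / 2)"
      by (subst powr_powr) simp
    finally show ?thesis .
  qed
  have 2: "Gamma (real (p + 2) / 2 + 1) = real (p + 2) / 2 * Gamma (real (p + 2) / 2)"
    by (rule Gamma_plus1) (auto dest: nonpos_Ints_nonpos)
  show ?thesis
    unfolding sphere_area_def unit_ball_vol_def 1 2 by simp
qed

section \<open>The truncated Cauchy kernel\<close>

text \<open>Rises across [a, 2a] and falls across [R, 2R]; its derivative is therefore the inner
  shell profile minus the outer one.\<close>

definition cutoff :: "real \<Rightarrow> real \<Rightarrow> real \<Rightarrow> real" where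
  "cutoff a R \<rho> = smooth_step (\<rho> / a - 1) - smooth_step (\<rho> / R - 1)"

definition cutoff' :: "real \<Rightarrow> real \<Rightarrow> real \<Rightarrow> real" where
  "cutoff' a R \<rho> = tent (\<rho> / a - 1) / a - tent (\<rho> / R - 1) / R"

text \<open>
  With \<open>m = (p + 2) / 2\<close> and \<open>r = |y|\<^sup>2\<close> this is the cutoff at \<open>|y|\<^bsup>p + 2\<^esup>\<close> divided by \<open>|y|\<^bsup>p + 2\<^esup>\<close>;
  taking the cutoff as a function of \<open>|y|\<^bsup>p + 2\<^esup>\<close> makes the Dirac derivative of the truncated kernel
  a function of the volume of the ball of radius \<open>|y|\<close>.
\<close>

definition radial_factor :: "real \<Rightarrow> real \<Rightarrow> real \<Rightarrow> real \<Rightarrow> real" where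
  "radial_factor m a R r = (if r > 0 then cutoff a R (r powr m) * r powr - m else 0)"

definition radial_factor' :: "real \<Rightarrow> real \<Rightarrow> real \<Rightarrow> real \<Rightarrow> real" where
  "radial_factor' m a R r = (if r > 0 then m * (cutoff' a R (r powr m) - cutoff a R (r powr m) * r powr - m) / r else 0)"

lemma cutoff_eq_1: "0 < a \<Longrightarrow> 2 * a \<le> \<rho> \<Longrightarrow> \<rho> \<le> R \<Longrightarrow> cutoff a R \<rho> = 1"
  by (simp add: cutoff_def smooth_step_ge_1 smooth_step_le_0 field_simps)

lemma cutoff_eq_0: "0 < a \<Longrightarrow> a \<le> R \<Longrightarrow> \<rho> \<le> a \<or> 2 * R \<le> \<rho> \<Longrightarrow> cutoff a R \<rho> = 0"
  by (auto simp: cutoff_def smooth_step_ge_1 smooth_step_le_0 field_simps)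

lemma cutoff'_eq_0: "0 < a \<Longrightarrow> a \<le> R \<Longrightarrow> \<rho> \<le> a \<Longrightarrow> cutoff' a R \<rho> = 0"
  by (auto simp: cutoff'_def tent_eq_0 field_simps)

lemma DERIV_cutoff: "0 < a \<Longrightarrow> a \<le> R \<Longrightarrow> (cutoff a R has_real_derivative cutoff' a R \<rho>) (at \<rho>)"
proof -
  have "((\<lambda>\<rho>. smooth_step (\<rho> / b - 1)) has_real_derivative tent (\<rho> / b - 1) / b) (at \<rho>)" if "b > 0" for b
  proof -
    have "((\<lambda>\<rho>. \<rho> / b - 1) has_real_derivative 1 / b) (at \<rho>)"
      using that by (auto intro!: derivative_eq_intros)
    from DERIV_chain2 [OF DERIV_smooth_step this] show ?thesis by simp
  qed
  then show "0 < a \<Longrightarrow> a \<le> R \<Longrightarrow> (cutoff a R has_real_derivative cutoff' a R \<rho>) (at \<rho>)"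
    unfolding cutoff_def [abs_def] cutoff'_def by (intro DERIV_diff) auto
qed

context
  fixes m a R :: real
  assumes m: "0 < m" and a: "0 < a" and aR: "a \<le> R"
begin

text \<open>Here \<open>r powr m\<close> stays below \<open>a\<close>, where the cutoff is still 0
  (and \<open>r \<le> 0\<close> is covered by the default value). This removes the singularity at
  the origin, so the factor is \<open>C1\<close> on the whole line.\<close>

lemma radial_small:
  assumes "r < a powr (1 / m)"
  shows "radial_factor m a R r = 0" "radial_factor' m a R r = 0"
proof -
  have "r powr m \<le> a" if "r > 0"
  proof -
    have "r powr m \<le> (a powr (1 / m)) powr m"
      using that assms m by (intro powr_mono2) auto
    also have "\<dots> = a"
      using a m by (simp add: powr_powr)
    finally show ?thesis .
  qed
  then show "radial_factor m a R r = 0" "radial_factor' m a R r = 0"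
    using a aR by (auto simp: radial_factor_def radial_factor'_def cutoff_eq_0 cutoff'_eq_0)
qed

lemma DERIV_radial_factor: "(radial_factor m a R has_real_derivative radial_factor' m a R r) (at r)"
proof (cases "r > 0")
  case True
  have "((\<lambda>r. cutoff a R (r powr m)) has_real_derivative cutoff' a R (r powr m) * (m * r powr (m - 1))) (at r)"
    by (rule DERIV_chain2 [OF DERIV_cutoff [OF a aR] has_real_derivative_powr [OF True]])
  from DERIV_mult [OF this has_real_derivative_powr [OF True, of "- m"]]
  have "((\<lambda>r. cutoff a R (r powr m) * r powr - m) has_real_derivative
      cutoff' a R (r powr m) * (m * r powr (m - 1)) * r powr - m + - m * r powr (- m - 1) * cutoff a R (r powr m)) (at r)" .
  moreover have "cutoff' a R (r powr m) * (m * r powr (m - 1)) * r powr - m + - m * r powr (- m - 1) * cutoff a R (r powr m)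
      = radial_factor' m a R r"
    using True by (simp add: radial_factor'_def powr_diff powr_minus field_simps)
  ultimately have "((\<lambda>r. cutoff a R (r powr m) * r powr - m) has_real_derivative radial_factor' m a R r) (at r)"
    by simp
  then show ?thesis
    by (rule has_field_derivative_transform_within_open [where S = "{0<..}"]) (use True in \<open>auto simp: radial_factor_def\<close>)
next
  case False
  then have r: "r < a powr (1 / m)"
    using powr_gt_zero [of a "1 / m"] a by linarith
  have "((\<lambda>r. 0) has_real_derivative radial_factor' m a R r) (at r)"
    by (simp add: radial_small [OF r])
  then show ?thesis
    by (rule has_field_derivative_transform_within_open [where S = "{..<a powr (1 / m)}"])
      (use r radial_small in auto)
qed

lemma continuous_on_radial_factor': "continuous_on UNIV (radial_factor' m a R)"
proof -
  have "continuous_on {0<..} (\<lambda>r. m * (cutoff' a R (r powr m) - cutoff a R (r powr m) * r powr - m) / r)"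
  proof -
    have "continuous_on UNIV (cutoff a R)"
      using DERIV_cutoff [OF a aR] by (intro continuous_at_imp_continuous_on ballI) (rule DERIV_isCont)
    then have 1: "continuous_on S (\<lambda>r. cutoff a R (h r))" if "continuous_on S h" for S and h :: "real \<Rightarrow> real"
      by (rule continuous_on_compose2 [OF _ that]) auto
    have "continuous_on UNIV (cutoff' a R)"
      unfolding cutoff'_def [abs_def] divide_inverse by (intro continuous_intros)
    then have 2: "continuous_on S (\<lambda>r. cutoff' a R (h r))" if "continuous_on S h" for S and h :: "real \<Rightarrow> real"
      by (rule continuous_on_compose2 [OF _ that]) auto
    show ?thesis
      by (intro continuous_intros 1 2) auto
  qed
  then have "continuous_on {0<..} (radial_factor' m a R)"
    by (rule continuous_on_eq) (auto simp: radial_factor'_def)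
  moreover have "continuous_on {..<a powr (1 / m)} (radial_factor' m a R)"
    by (rule continuous_on_eq [of _ "\<lambda>_. 0"]) (auto simp: radial_small)
  ultimately have "continuous_on ({0<..} \<union> {..<a powr (1 / m)}) (radial_factor' m a R)"
    by (intro continuous_on_open_Un) auto
  moreover have "a powr (1 / m) > 0"
    using a by simp
  then have "{0<..} \<union> {..<a powr (1 / m)} = UNIV"
    by (auto simp: not_less intro: le_less_trans)
  ultimately show ?thesis by simp
qed

text \<open>The terms in which the cutoff is not differentiated cancel: this is the radial form of
  the monogenicity of the Cauchy kernel.\<close>

lemma radial_factor_identity:
  assumes "0 \<le> r"
  shows "2 * radial_factor' m a R r * r + 2 * m * radial_factor m a R r = 2 * m * cutoff' a R (r powr m)"
proof (cases "r > 0")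
  case True
  then show ?thesis
    by (simp add: radial_factor_def radial_factor'_def field_simps)
next
  case False
  then have "r = 0" using assms by simp
  then show ?thesis
    using a aR m by (simp add: radial_factor_def radial_factor'_def cutoff'_eq_0)
qed

end

text \<open>The Cauchy kernel times the cutoff, without the factor \<open>1 / sphere_area p\<close>,
  which is put back at the end.\<close>

definition truncated_kernel :: "nat \<Rightarrow> real \<Rightarrow> real \<Rightarrow> 'n::{finite,linorder} clifford \<Rightarrow> 'n clifford" where
  "truncated_kernel p a R y = radial_factor (real (p + 2) / 2) a R (y \<bullet> y) *\<^sub>R clifford_cnj y"

definition truncated_kernel' ::
  "nat \<Rightarrow> real \<Rightarrow> real \<Rightarrow> 'n::{finite,linorder} clifford \<Rightarrow> 'n clifford \<Rightarrow> 'n clifford" where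
  "truncated_kernel' p a R y h =
     radial_factor (real (p + 2) / 2) a R (y \<bullet> y) *\<^sub>R clifford_cnj h +
     (radial_factor' (real (p + 2) / 2) a R (y \<bullet> y) * (2 * (y \<bullet> h))) *\<^sub>R clifford_cnj y"

lemma inner_self_powr: "(y \<bullet> y) powr (real (p + 2) / 2) = norm y ^ (p + 2)" for y :: "'a::real_inner"
proof (cases "y = 0")
  case False
  then have "(y \<bullet> y) powr (real (p + 2) / 2) = (norm y powr 2) powr (real (p + 2) / 2)"
    by (simp add: power2_norm_eq_inner [symmetric])
  also have "\<dots> = norm y powr (2 * (real (p + 2) / 2))"
    by (rule powr_powr)
  also have "2 * (real (p + 2) / 2) = real (p + 2)"
    by simp
  also have "norm y powr real (p + 2) = norm y ^ (p + 2)"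
    using False by (subst powr_realpow) auto
  finally show ?thesis .
qed simp

lemma truncated_kernel_has_derivative:
  assumes "0 < a" "a \<le> R"
  shows "(truncated_kernel p a R has_derivative truncated_kernel' p a R y) (at y)"
proof -
  let ?\<theta> = "radial_factor (real (p + 2) / 2) a R" and ?\<theta>' = "radial_factor' (real (p + 2) / 2) a R"
  have "(?\<theta> has_derivative (*) (?\<theta>' (y \<bullet> y))) (at (y \<bullet> y))"
    using DERIV_radial_factor [of "real (p + 2) / 2" a R] assms by (simp add: has_field_derivative_def)
  moreover have "((\<lambda>y. y \<bullet> y) has_derivative (\<lambda>h. 2 * (y \<bullet> h))) (at y)"
    by (auto intro!: derivative_eq_intros simp: inner_commute)
  ultimately have "((\<lambda>y. ?\<theta> (y \<bullet> y)) has_derivative (\<lambda>h. ?\<theta>' (y \<bullet> y) * (2 * (y \<bullet> h)))) (at y)"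
    using has_derivative_compose by blast
  from has_derivative_scaleR [OF this linear_imp_has_derivative [OF linear_clifford_cnj]]
  show ?thesis
    unfolding truncated_kernel_def [abs_def] truncated_kernel'_def [abs_def] .
qed

lemma continuous_on_truncated_kernel':
  assumes "0 < a" "a \<le> R"
  shows "continuous_on UNIV (\<lambda>y. truncated_kernel' p a R y h)"
proof -
  let ?\<theta> = "radial_factor (real (p + 2) / 2) a R" and ?\<theta>' = "radial_factor' (real (p + 2) / 2) a R"
  have cont: "continuous_on UNIV (\<lambda>y. k (y \<bullet> y))" if "continuous_on UNIV k" for k :: "real \<Rightarrow> real"
    by (rule continuous_on_compose2 [OF that]) (auto intro!: continuous_intros)
  have "continuous_on UNIV ?\<theta>"
    using DERIV_radial_factor [of "real (p + 2) / 2" a R] assms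
    by (intro continuous_at_imp_continuous_on ballI) (auto intro: DERIV_isCont)
  from cont [OF this] have 1: "continuous_on UNIV (\<lambda>y. ?\<theta> (y \<bullet> y))" .
  have "continuous_on UNIV ?\<theta>'"
    using assms by (intro continuous_on_radial_factor') auto
  from cont [OF this] have 2: "continuous_on UNIV (\<lambda>y. ?\<theta>' (y \<bullet> y))" .
  have 3: "continuous_on UNIV (clifford_cnj :: 'a clifford \<Rightarrow> _)"
    by (simp add: linear_continuous_on linear_linear linear_clifford_cnj)
  show ?thesis
    unfolding truncated_kernel'_def by (intro continuous_intros 1 2 3)
qed

lemma truncated_kernel_eq_cauchy:
  assumes "0 < a" "2 * a \<le> norm y ^ (p + 2)" "norm y ^ (p + 2) \<le> R"
  shows "truncated_kernel p a R y = sphere_area p *\<^sub>R cauchy_E p y"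
proof -
  have "y \<bullet> y > 0"
    using assms by (auto simp: zero_power)
  have "sphere_area p \<noteq> 0"
    unfolding sphere_area_eq by (intro less_imp_neq [symmetric] mult_pos_pos unit_ball_vol_pos) auto
  have "radial_factor (real (p + 2) / 2) a R (y \<bullet> y) = inverse (norm y ^ (p + 2))"
    unfolding radial_factor_def powr_minus inner_self_powr
    using \<open>y \<bullet> y > 0\<close> cutoff_eq_1 [OF assms] by simp
  then show ?thesis
    using \<open>sphere_area p \<noteq> 0\<close> by (simp add: truncated_kernel_def cauchy_E_def)
qed

lemma truncated_kernel_eq_0:
  assumes "0 < a" "a \<le> R" "2 * R \<le> norm y ^ (p + 2)"
  shows "truncated_kernel p a R y = 0"
  unfolding truncated_kernel_def radial_factor_def inner_self_powr
  using assms by (simp add: cutoff_eq_0)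

text \<open>The Dirac operator acts from the right. Differentiating \<open>clifford_cnj y\<close>
  gives \<open>clifford_cnj (frame i) * frame i = 1\<close> for each of the \<open>p + 2\<close>
  directions; differentiating the radial factor reassembles \<open>y\<close> from its components and
  leaves \<open>clifford_cnj y * y\<close>, the squared norm.\<close>

lemma (in slice_frame) truncated_kernel_dirac:
  assumes "0 < a" "a \<le> R" and y: "y \<in> slice p \<eta>"
  shows "(\<Sum>i=0..p + 1. truncated_kernel' p a R y (frame i) * frame i) =
    (real (p + 2) * cutoff' a R (norm y ^ (p + 2))) *\<^sub>R 1"
proof -
  let ?\<theta> = "radial_factor (real (p + 2) / 2) a R (y \<bullet> y)" and ?\<theta>' = "radial_factor' (real (p + 2) / 2) a R (y \<bullet> y)"
  have "(\<Sum>i=0..p + 1. truncated_kernel' p a R y (frame i) * frame i) =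
      (\<Sum>i=0..p + 1. ?\<theta> *\<^sub>R 1 + (2 * ?\<theta>') *\<^sub>R (clifford_cnj y * ((y \<bullet> frame i) *\<^sub>R frame i)))"
    by (intro sum.cong refl) (simp add: truncated_kernel'_def distrib_right frame_cnj_mult mult.commute mult.left_commute)
  also have "\<dots> = (real (p + 2) * ?\<theta>) *\<^sub>R 1 + (2 * ?\<theta>') *\<^sub>R (clifford_cnj y * (\<Sum>i=0..p + 1. (y \<bullet> frame i) *\<^sub>R frame i))"
    unfolding sum.distrib sum_distrib_left scaleR_sum_right [symmetric] sum_constant_scaleR by simp
  also have "\<dots> = (real (p + 2) * ?\<theta>) *\<^sub>R 1 + (2 * ?\<theta>') *\<^sub>R ((y \<bullet> y) *\<^sub>R 1)"
    using y slice_subset_paravectors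
    by (simp only: frame_expansion [OF y] clifford_cnj_mult_self [OF subsetD [OF slice_subset_paravectors y]] power2_norm_eq_inner)
  also have "\<dots> = (real (p + 2) * ?\<theta> + 2 * ?\<theta>' * (y \<bullet> y)) *\<^sub>R 1"
    by (simp only: scaleR_left_distrib scaleR_scaleR)
  also have "real (p + 2) * ?\<theta> + 2 * ?\<theta>' * (y \<bullet> y) = 2 * ?\<theta>' * (y \<bullet> y) + 2 * (real (p + 2) / 2) * ?\<theta>"
    by simp
  also have "\<dots> =
      2 * (real (p + 2) / 2) * cutoff' a R ((y \<bullet> y) powr (real (p + 2) / 2))"
    using assms by (intro radial_factor_identity) auto
  finally show ?thesis
    unfolding inner_self_powr by simp
qed

section \<open>The Cauchy integral formula for the exterior domain\<close>

text \<open>For subsets of \<open>V\<close> the preimage under \<open>J\<close> equals the image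
  under \<open>G\<close>: the first description transports openness, the second compactness, patches
  and closures. The normal is pulled back by \<open>G\<close>, which inverts \<open>J\<close> on
  \<open>V\<close>.\<close>

lemma jordan_domain_isometry:
  fixes J :: "real^('m::finite option) \<Rightarrow> 'a::euclidean_space"
  assumes J: "linear J" "\<And>z. norm (J z) = norm z" and G: "linear G" and GJ: "\<And>z. G (J z) = z"
    and JG: "\<And>y. y \<in> V \<Longrightarrow> J (G y) = y" and range_J: "range J = V"
    and jordan: "jordan_surface TYPE('m) V \<Gamma> Up Um"
    and n: "\<And>y. y \<in> \<Gamma> \<Longrightarrow> unit_normal_towards V \<Gamma> Um y (n y)"
    and \<mu>: "is_surface_measure TYPE('m) \<Gamma> \<mu>"
  shows "jordan_domain (J -` \<Gamma>) (J -` Up) (J -` Um) (\<lambda>z. G (n (J z))) (distr \<mu> borel G)"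
proof -
  have \<Gamma>: "\<Gamma> \<subseteq> V" "compact \<Gamma>" "C1_surface TYPE('m) \<Gamma>" "\<Gamma> \<subseteq> closure Up"
    and U: "Up \<inter> Um = {}" "Up \<union> Um = V - \<Gamma>" "openin (top_of_set V) Up" "openin (top_of_set V) Um"
    using jordan by (auto simp: jordan_surface_def)
  have contG: "continuous_on S G" and contJ: "continuous_on T J" for S T
    using G J(1) by (simp_all add: linear_continuous_on linear_linear)
  have vimage: "J -` S = G ` S" if "S \<subseteq> V" for S
    using that JG GJ by (auto simp: image_iff subset_iff) metis+
  have image: "J ` (J -` S) = S" if "S \<subseteq> V" for S
    using that range_J by (simp add: image_vimage_eq inf.absorb1)
  have open_vimage_J: "open (J -` S)" if S: "openin (top_of_set V) S" for S
  proof -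
    obtain T where T: "open T" "S = V \<inter> T"
      using S by (auto simp: openin_open)
    then have "J -` S = J -` T"
      using range_J by auto
    then show ?thesis
      using open_vimage [OF T(1) contJ] by simp
  qed
  have compact: "compact (J -` \<Gamma>)"
    unfolding vimage [OF \<Gamma>(1)] using contG \<Gamma>(2) by (rule compact_continuous_image)
  show ?thesis
  proof
    show "compact (J -` \<Gamma>)" by (rule compact)
    show "C1_surface TYPE('m) (J -` \<Gamma>)"
      unfolding C1_surface_def
    proof
      fix z assume z: "z \<in> J -` \<Gamma>"
      then obtain D :: "(real^'m) set" and \<phi> where patch: "surface_patch \<Gamma> D \<phi>" "J z \<in> \<phi> ` D"
        using \<Gamma>(3) by (auto simp: C1_surface_def)
      have "surface_patch (J -` \<Gamma>) D (G \<circ> \<phi>)"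
        unfolding vimage [OF \<Gamma>(1)] using \<Gamma>(1) JG
        by (intro surface_patch_linear_image(1) [OF G J(1) _ patch(1)]) auto
      moreover have "z \<in> (G \<circ> \<phi>) ` D"
        using patch(2) GJ by (metis image_comp image_eqI)
      ultimately show "\<exists>(D :: (real^'m) set) \<phi>. surface_patch (J -` \<Gamma>) D \<phi> \<and> z \<in> \<phi> ` D"
        by blast
    qed
    show "open (J -` Up)" "open (J -` Um)"
      using open_vimage_J U by auto
    show "J -` Up \<inter> J -` Um = {}"
      using U(1) by auto
    show "J -` Up \<union> J -` Um = - J -` \<Gamma>"
      using U(2) range_J by (auto simp flip: vimage_Un)
    show "J -` \<Gamma> \<subseteq> closure (J -` Up)"
    proof -
      have "Up \<subseteq> V" using U(2) by blast
      have "G ` closure Up \<subseteq> closure (G ` Up)"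
        by (rule image_closure_subset [OF contG closed_closure closure_subset])
      then have "G ` \<Gamma> \<subseteq> closure (J -` Up)"
        unfolding vimage [OF \<open>Up \<subseteq> V\<close>] using \<Gamma>(4) by blast
      then show ?thesis
        by (simp add: vimage [OF \<Gamma>(1)])
    qed
    show "is_surface_measure TYPE('m) (J -` \<Gamma>) (distr \<mu> borel G)"
      using \<mu> image [OF \<Gamma>(1)] by (intro is_surface_measure_isometry [OF J G GJ compact]) simp
    fix z assume z: "z \<in> J -` \<Gamma>"
    then have nz: "unit_normal_towards V \<Gamma> Um (J z) (n (J z))"
      using n by simp
    then have nV: "J (G (n (J z))) = n (J z)"
      using JG by (simp add: unit_normal_towards_def)
    show "unit_normal_towards UNIV (J -` \<Gamma>) (J -` Um) z (G (n (J z)))"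
      unfolding unit_normal_towards_def
    proof (intro conjI ballI)
      show "norm (G (n (J z))) = 1"
        using J(2) [of "G (n (J z))"] nz nV by (simp add: unit_normal_towards_def)
      show "G (n (J z)) \<bullet> w = 0" if w: "w \<in> tangent_vectors (J -` \<Gamma>) z" for w
      proof -
        obtain \<gamma> \<epsilon> where \<gamma>: "\<epsilon> > 0" "\<And>t. \<bar>t\<bar> < \<epsilon> \<Longrightarrow> \<gamma> t \<in> J -` \<Gamma>" "\<gamma> 0 = z"
          "(\<gamma> has_vector_derivative w) (at (0::real))"
          using w unfolding tangent_vectors_def by blast
        have "((\<lambda>t. J (\<gamma> t)) has_vector_derivative J w) (at 0)"
          using bounded_linear.has_vector_derivative [OF _ \<gamma>(4)] J(1) by (simp add: linear_conv_bounded_linear)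
        then have "J w \<in> tangent_vectors \<Gamma> (J z)"
          unfolding tangent_vectors_def using \<gamma>(1-3)
          by (intro CollectI exI [of _ "\<lambda>t. J (\<gamma> t)"] exI [of _ \<epsilon>]) auto
        then have "n (J z) \<bullet> J w = 0"
          using nz by (auto simp: unit_normal_towards_def)
        then show ?thesis
          using inner_isometry [OF J, of "G (n (J z))" w] nV by simp
      qed
      obtain \<epsilon> where "\<epsilon> > 0" "\<And>t. 0 < t \<Longrightarrow> t < \<epsilon> \<Longrightarrow> J z + t *\<^sub>R n (J z) \<in> Um"
        using nz by (auto simp: unit_normal_towards_def)
      then show "\<exists>\<epsilon>>0. \<forall>t. 0 < t \<and> t < \<epsilon> \<longrightarrow> z + t *\<^sub>R G (n (J z)) \<in> J -` Um"
        by (auto simp: linear_add [OF J(1)] linear_cmul [OF J(1)] nV)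
    qed simp
  qed
qed

lemma eq_if_norm_diff_le:
  fixes u w :: "'a::real_normed_vector"
  assumes "\<And>\<epsilon>. \<epsilon> > 0 \<Longrightarrow> norm (u - w) \<le> C * \<epsilon>" and "C > 0"
  shows "u = w"
proof (rule ccontr)
  assume "u \<noteq> w"
  then have "norm (u - w) > 0" by simp
  then have "norm (u - w) \<le> C * (norm (u - w) / (2 * C))"
    using assms(2) by (intro assms(1)) auto
  also have "\<dots> = norm (u - w) / 2"
    using assms(2) by simp
  finally show False
    using \<open>norm (u - w) > 0\<close> by simp
qed

context slice_frame
begin

lemma slice_isometry:
  assumes "CARD('m::finite) = p + 1"
  obtains J :: "real^('m::finite option) \<Rightarrow> 'n clifford" and G
  where "linear J" "\<And>z. norm (J z) = norm z" "linear G" "\<And>z. G (J z) = z"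
    "\<And>y. y \<in> slice p \<eta> \<Longrightarrow> J (G y) = y" "range J = slice p \<eta>"
proof -
  have "dim (UNIV :: (real^('m option)) set) = dim (slice p \<eta>)"
    using assms by (simp add: dim_slice)
  from isometries_subspaces [OF subspace_UNIV subspace_slice this] show ?thesis
    using that by (metis UNIV_I)
qed

lemma sum_frame_sandwich:
  assumes "y \<in> slice p \<eta>"
  shows "(\<Sum>i=0..p + 1. (y \<bullet> frame i) *\<^sub>R (b * frame i * c)) = b * y * c"
proof -
  have "(\<Sum>i=0..p + 1. (y \<bullet> frame i) *\<^sub>R (b * frame i * c)) = b * (\<Sum>i=0..p + 1. (y \<bullet> frame i) *\<^sub>R frame i) * c"
    by (simp only: sum_distrib_left sum_distrib_right mult_scaleR_left mult_scaleR_right)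
  then show ?thesis
    by (simp only: frame_expansion [OF assms])
qed

text \<open>Both positions of \<open>x\<close> are handled at once: they differ only in the limit of
  the inner shell average, as \<open>f\<close> extended by 0 to the interior domain is continuous at
  each \<open>x\<close> off \<Gamma>.\<close>

lemma cauchy_integral_exterior:
  fixes f n :: "'n clifford \<Rightarrow> 'n clifford"
  assumes card_m: "CARD('m::finite) = p + 1"
    and jordan: "jordan_surface TYPE('m) (slice p \<eta>) \<Gamma> Up Um"
    and normal_n: "\<And>y. y \<in> \<Gamma> \<Longrightarrow> unit_normal_towards (slice p \<eta>) \<Gamma> Um y (n y)"
    and \<mu>: "is_surface_measure TYPE('m) \<Gamma> \<mu>"
    and monogenic: "gps_monogenic_on p \<eta> Um f" and C1: "C1_on (Um \<union> \<Gamma>) f"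
    and limit: "(f \<longlongrightarrow> f_inf) (inf at_infinity (principal Um))"
    and x: "x \<in> slice p \<eta>" "x \<notin> \<Gamma>"
  shows "has_bochner_integral \<mu> (\<lambda>y. indicator \<Gamma> y *\<^sub>R (gps_kernel p q \<eta> y x * n y * f y))
    (f_inf - (if x \<in> Um then f x else 0))"
proof -
  obtain J :: "real^('m option) \<Rightarrow> 'n clifford" and G
    where J: "linear J" "\<And>z. norm (J z) = norm z" and G: "linear G" and GJ: "\<And>z. G (J z) = z"
      and JG: "\<And>y. y \<in> slice p \<eta> \<Longrightarrow> J (G y) = y" and range_J: "range J = slice p \<eta>"
    using slice_isometry [OF card_m] by blast
  define \<Gamma>' Up' Um' where "\<Gamma>' = J -` \<Gamma>" and "Up' = J -` Up" and "Um' = J -` Um"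
  define n' where "n' z = G (n (J z))" for z
  define \<mu>' where "\<mu>' = distr \<mu> borel G"
  interpret jordan_domain \<Gamma>' Up' Um' n' \<mu>'
    unfolding \<Gamma>'_def Up'_def Um'_def n'_def \<mu>'_def
    by (rule jordan_domain_isometry [OF J G GJ JG range_J jordan normal_n \<mu>])
  interpret mult: bounded_bilinear "(*) :: 'n clifford \<Rightarrow> 'n clifford \<Rightarrow> 'n clifford"
    by (rule bounded_bilinear_clifford)
  have DIM: "DIM(real^('m option)) = p + 2"
    using card_m by simp
  define d where "d = real (p + 2)"
  define V where "V = unit_ball_vol (real DIM(real^('m option)))"
  have \<sigma>: "sphere_area p = d * V" "d > 0" "V > 0"
    by (simp_all add: sphere_area_eq d_def V_def DIM card_m)
  have blJ: "bounded_linear J"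
    using J(1) by (simp add: linear_conv_bounded_linear)
  have contJ: "continuous_on S J" for S
    using blJ by (rule linear_continuous_on)
  have J_slice: "J z \<in> slice p \<eta>" for z
    using range_J by blast
  have image_J: "J ` (Um' \<union> \<Gamma>') = Um \<union> \<Gamma>"
  proof -
    have "Um \<union> \<Gamma> \<subseteq> range J"
      using jordan unfolding range_J jordan_surface_def by blast
    then show ?thesis
      by (auto simp: Um'_def \<Gamma>'_def)
  qed
  define x0 where "x0 = G x"
  have Jx0: "J x0 = x"
    using JG x(1) by (simp add: x0_def)
  have norm_Jx: "norm (J z - x) = norm (z - x0)" for z
    using J(2) [of "z - x0"] by (simp add: linear_diff [OF J(1)] Jx0)
  have Jx_slice: "J z - x \<in> slice p \<eta>" for z
    using J_slice x(1) subspace_slice by (simp add: subspace_diff)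
  obtain f' where f': "continuous_on (Um \<union> \<Gamma>) f'"
    "\<And>y. y \<in> Um \<union> \<Gamma> \<Longrightarrow> (f has_derivative blinfun_apply (f' y)) (at y within Um \<union> \<Gamma>)"
    using C1 by (auto simp: C1_on_def)
  have fJ_der: "((\<lambda>z. f (J z)) has_derivative (\<lambda>h. f' (J z) (J h))) (at z within Um' \<union> \<Gamma>')" if "z \<in> Um' \<union> \<Gamma>'" for z
  proof -
    have "(f has_derivative blinfun_apply (f' (J z))) (at (J z) within J ` (Um' \<union> \<Gamma>'))"
      unfolding image_J using that by (intro f'(2)) (auto simp: Um'_def \<Gamma>'_def)
    from has_derivative_in_compose [OF linear_imp_has_derivative [OF J(1)] this] show ?thesis .
  qed
  have fJ_cont: "continuous_on (Um' \<union> \<Gamma>') (\<lambda>z. f (J z))"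
    using fJ_der has_derivative_continuous unfolding continuous_on_eq_continuous_within by blast
  have f'J_cont: "continuous_on (Um' \<union> \<Gamma>') (\<lambda>z. f' (J z) h)" for h
    by (intro continuous_intros continuous_on_compose2 [OF f'(1) contJ]) (auto simp: Um'_def \<Gamma>'_def)
  \<comment> \<open>\<open>partial_deriv\<close> differentiates \<open>f\<close> along lines inside
    the slice, and at a point of \<open>Um\<close> short segments of these lines stay in
    \<open>Um\<close>. Passing through the open set \<open>Um'\<close> identifies these derivatives
    with values of \<open>f'\<close>.\<close>
  have dirac: "(\<Sum>i=0..p + 1. frame i * f' (J z) (frame i)) = 0" if z: "z \<in> Um'" for z
  proof -
    have "((\<lambda>z. f (J z)) has_derivative (\<lambda>h. f' (J z) (J h))) (at z within Um')"
      using fJ_der [of z] z by (auto intro: has_derivative_subset)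
    then have der: "((\<lambda>z. f (J z)) has_derivative (\<lambda>h. f' (J z) (J h))) (at z)"
      unfolding at_within_open [OF z open_Um] .
    have pd: "partial_deriv f w (J z) = f' (J z) w" if w: "w \<in> slice p \<eta>" for w
    proof -
      have "((\<lambda>t. z + t *\<^sub>R G w) has_derivative (\<lambda>t. t *\<^sub>R G w)) (at 0)"
        by (auto intro!: derivative_eq_intros)
      moreover have "((\<lambda>z. f (J z)) has_derivative (\<lambda>h. f' (J z) (J h))) (at (z + 0 *\<^sub>R G w))"
        using der by simp
      ultimately have "((\<lambda>t. f (J (z + t *\<^sub>R G w))) has_derivative (\<lambda>t. f' (J z) (J (t *\<^sub>R G w)))) (at 0)"
        by (rule has_derivative_compose)
      then have "((\<lambda>t. f (J z + t *\<^sub>R w)) has_vector_derivative f' (J z) w) (at 0)"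
        by (simp add: has_vector_derivative_def linear_add [OF J(1)] linear_cmul [OF J(1)] JG [OF w] blinfun.scaleR_right)
      then show ?thesis
        unfolding partial_deriv_def by (rule vector_derivative_at)
    qed
    have "(\<Sum>i=0..p + 1. frame i * f' (J z) (frame i)) =
        (\<Sum>i=0..p. cl_e i * partial_deriv f (cl_e i) (J z)) + \<eta> * partial_deriv f \<eta> (J z)"
    proof -
      have "partial_deriv f (frame i) (J z) = f' (J z) (frame i)" if "i \<le> p + 1" for i
        using that by (intro pd frame_in_slice)
      then have "(\<Sum>i=0..p + 1. frame i * f' (J z) (frame i)) = (\<Sum>i=0..p + 1. frame i * partial_deriv f (frame i) (J z))"
        by (intro sum.cong) auto
      also have "\<dots> = (\<Sum>i=0..p. frame i * partial_deriv f (frame i) (J z)) + frame (p + 1) * partial_deriv f (frame (p + 1)) (J z)"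
        by simp
      also have "(\<Sum>i=0..p. frame i * partial_deriv f (frame i) (J z)) = (\<Sum>i=0..p. cl_e i * partial_deriv f (cl_e i) (J z))"
        by (intro sum.cong) (auto simp: frame_def)
      finally show ?thesis by (simp add: frame_def)
    qed
    also have "\<dots> = 0"
      using monogenic z by (simp add: gps_monogenic_on_def Um'_def)
    finally show ?thesis .
  qed
  \<comment> \<open>Extension by 0 makes the shell averages integrals over the whole space, even for
    shells that cross \<Gamma>.\<close>
  define F where "F z = indicator Um' z *\<^sub>R f (J z)" for z
  have F_borel: "F \<in> borel_measurable borel"
    unfolding F_def [abs_def]
    by (rule borel_measurable_indicator_times [OF open_Um continuous_on_subset [OF fJ_cont]]) auto
  \<comment> \<open>Apply the divergence theorem to kernel times \<open>frame i\<close> times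
    \<open>f\<close> in direction \<open>frame i\<close> and sum over \<open>i\<close>. On \<Gamma>
    the frame assembles the normal between the two factors; in \<open>Um\<close> the product rule
    yields the Dirac derivative of the kernel times \<open>f\<close> plus the kernel times that of
    \<open>f\<close>.\<close>
  have truncated: "has_bochner_integral \<mu>'
      (\<lambda>z. indicator \<Gamma>' z *\<^sub>R (truncated_kernel p a R (J z - x) * n (J z) * f (J z)))
      (d *\<^sub>R ((\<integral>z. shell x0 R z *\<^sub>R F z \<partial>lborel) - (\<integral>z. shell x0 a z *\<^sub>R F z \<partial>lborel)))"
    if a: "0 < a" "a \<le> R" and int: "integrable lborel (\<lambda>z. shell x0 a z *\<^sub>R F z)" "integrable lborel (\<lambda>z. shell x0 R z *\<^sub>R F z)"
    for a R
  proof -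
    let ?K = "truncated_kernel p a R" and ?K' = "truncated_kernel' p a R"
    define u where "u i z = ?K (J z - x) * frame i * f (J z)" for i z
    define U where "U i z h = ?K (J z - x) * frame i * f' (J z) (J h) + ?K' (J z - x) (J h) * frame i * f (J z)" for i z h
    define v where "v i = G (frame i)" for i
    have Jv: "J (v i) = frame i" if "i \<le> p + 1" for i
      using JG [OF frame_in_slice [OF that]] by (simp add: v_def)
    have K_der: "((\<lambda>z. ?K (J z - x) * frame i) has_derivative (\<lambda>h. ?K' (J z - x) (J h) * frame i)) (at z within S)" for i z S
    proof -
      have "((\<lambda>z. J z - x) has_derivative J) (at z within S)"
        using has_derivative_diff [OF linear_imp_has_derivative [OF J(1)] has_derivative_const] by simp
      then have "((\<lambda>z. ?K (J z - x)) has_derivative (\<lambda>h. ?K' (J z - x) (J h))) (at z within S)"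
        by (rule has_derivative_compose) (rule truncated_kernel_has_derivative [OF a])
      then show ?thesis
        by (rule bounded_linear.has_derivative [OF mult.bounded_linear_left])
    qed
    have K_cont: "continuous_on S (\<lambda>z. ?K (J z - x) * frame i)" for S i
      using K_der has_derivative_continuous unfolding continuous_on_eq_continuous_within by blast
    have K'_cont: "continuous_on S (\<lambda>z. ?K' (J z - x) (J h) * frame i)" for S i h
      by (intro mult.continuous_on continuous_on_const
          continuous_on_compose2 [OF continuous_on_truncated_kernel' [OF a]] continuous_intros contJ) auto
    have u_der: "(u i has_derivative U i z) (at z within Um' \<union> \<Gamma>')" if "z \<in> Um' \<union> \<Gamma>'" for i z
      unfolding u_def [abs_def] U_def [abs_def] by (rule mult.FDERIV [OF K_der fJ_der [OF that]])
    have U_cont: "continuous_on (Um' \<union> \<Gamma>') (\<lambda>z. U i z h)" for i h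
      unfolding U_def by (intro continuous_on_add mult.continuous_on [OF K_cont f'J_cont] mult.continuous_on [OF K'_cont fJ_cont])
    \<comment> \<open>The summand 1 makes the distance at least 1, so raising it to the power
      \<open>p + 2\<close> does not decrease it, and it exceeds \<open>2 * R\<close>.\<close>
    have u_zero: "u i z = 0" if "z \<notin> cball x0 (2 * R + 1)" for i z
    proof -
      have "norm (z - x0) > 2 * R + 1"
        using that by (simp add: dist_norm norm_minus_commute)
      moreover have "norm (z - x0) \<le> norm (z - x0) ^ (p + 2)"
        using calculation a by (intro self_le_power) auto
      ultimately have "2 * R \<le> norm (J z - x) ^ (p + 2)"
        by (simp add: norm_Jx)
      then show ?thesis
        by (simp add: u_def truncated_kernel_eq_0 [OF a])
    qed
    have g: "integrable lborel (\<lambda>z. indicator Um' z *\<^sub>R U i z (v i))"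
      "has_bochner_integral \<mu>' (\<lambda>z. indicator \<Gamma>' z *\<^sub>R (n' z \<bullet> v i) *\<^sub>R u i z)
        (- (\<integral>z. indicator Um' z *\<^sub>R U i z (v i) \<partial>lborel))" for i
      using gauss_theorem [OF compact_cball u_der U_cont u_zero] by blast+
    have lhs: "(\<Sum>i=0..p + 1. indicator \<Gamma>' z *\<^sub>R (n' z \<bullet> v i) *\<^sub>R u i z) =
        indicator \<Gamma>' z *\<^sub>R (?K (J z - x) * n (J z) * f (J z))" for z
    proof (cases "z \<in> \<Gamma>'")
      case True
      then have nz: "n (J z) \<in> slice p \<eta>"
        using normal_n by (simp add: \<Gamma>'_def unit_normal_towards_def)
      have "n' z \<bullet> v i = n (J z) \<bullet> frame i" if "i \<le> p + 1" for i
        using inner_isometry [OF J, of "n' z" "v i"] by (simp add: n'_def JG [OF nz] Jv [OF that])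
      then have "(\<Sum>i=0..p + 1. indicator \<Gamma>' z *\<^sub>R (n' z \<bullet> v i) *\<^sub>R u i z) =
          (\<Sum>i=0..p + 1. (n (J z) \<bullet> frame i) *\<^sub>R (?K (J z - x) * frame i * f (J z)))"
        using True by (intro sum.cong) (auto simp: u_def)
      also have "\<dots> = ?K (J z - x) * n (J z) * f (J z)"
        by (rule sum_frame_sandwich [OF nz])
      finally show ?thesis using True by simp
    qed simp
    \<comment> \<open>The Dirac derivative of \<open>f\<close> is 0, and that of the kernel is
      \<open>d\<close> times the inner shell minus the outer shell; no singular term at
      \<open>x0\<close> remains.\<close>
    have rhs: "(\<Sum>i=0..p + 1. indicator Um' z *\<^sub>R U i z (v i)) =
        d *\<^sub>R (shell x0 a z *\<^sub>R F z - shell x0 R z *\<^sub>R F z)" for z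
    proof (cases "z \<in> Um'")
      case True
      have "(\<Sum>i=0..p + 1. U i z (v i)) =
          (\<Sum>i=0..p + 1. ?K (J z - x) * (frame i * f' (J z) (frame i)) + ?K' (J z - x) (frame i) * frame i * f (J z))"
        by (intro sum.cong) (auto simp: U_def Jv mult.assoc)
      also have "\<dots> = ?K (J z - x) * (\<Sum>i=0..p + 1. frame i * f' (J z) (frame i)) +
          (\<Sum>i=0..p + 1. ?K' (J z - x) (frame i) * frame i) * f (J z)"
        by (simp only: sum.distrib sum_distrib_left sum_distrib_right)
      also have "\<dots> = (d * cutoff' a R (norm (z - x0) ^ (p + 2))) *\<^sub>R f (J z)"
        unfolding dirac [OF True] truncated_kernel_dirac [OF a Jx_slice] norm_Jx by (simp add: d_def)
      also have "cutoff' a R (norm (z - x0) ^ (p + 2)) = shell x0 a z - shell x0 R z"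
        by (simp add: cutoff'_def shell_def card_m)
      finally show ?thesis
        using True by (simp add: F_def scaleR_diff_left [symmetric] del: sum.cl_ivl_Suc)
    qed (simp add: F_def)
    have "has_bochner_integral \<mu>' (\<lambda>z. \<Sum>i=0..p + 1. indicator \<Gamma>' z *\<^sub>R (n' z \<bullet> v i) *\<^sub>R u i z)
        (\<Sum>i=0..p + 1. - (\<integral>z. indicator Um' z *\<^sub>R U i z (v i) \<partial>lborel))"
      by (rule has_bochner_integral_sum) (rule g(2))
    moreover have "(\<Sum>i=0..p + 1. - (\<integral>z. indicator Um' z *\<^sub>R U i z (v i) \<partial>lborel)) =
        - (\<integral>z. (\<Sum>i=0..p + 1. indicator Um' z *\<^sub>R U i z (v i)) \<partial>lborel)"
      unfolding sum_negf by (subst Bochner_Integration.integral_sum) (use g(1) in auto)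
    moreover have "\<dots> = d *\<^sub>R ((\<integral>z. shell x0 R z *\<^sub>R F z \<partial>lborel) - (\<integral>z. shell x0 a z *\<^sub>R F z \<partial>lborel))"
      unfolding rhs integral_scaleR_right Bochner_Integration.integral_diff [OF int]
      by (simp add: algebra_simps)
    ultimately show ?thesis
      unfolding lhs by simp
  qed
  define c where "c = (if x \<in> Um then f x else 0)"
  \<comment> \<open>One radius serves two purposes: within it \<open>F\<close> is close to
    \<open>c\<close>, and \<Gamma>' stays outside it, so a cutoff changing only inside this radius
    does not alter the kernel on \<Gamma>'.\<close>
  have inner_close: "\<exists>e>0. (\<forall>z. norm (z - x0) < e \<longrightarrow> norm (F z - c) \<le> \<epsilon>) \<and> (\<forall>z\<in>\<Gamma>'. norm (z - x0) \<ge> e)"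
    if \<epsilon>: "\<epsilon> > 0" for \<epsilon>
  proof -
    have "closed \<Gamma>'" "x0 \<notin> \<Gamma>'"
      using compact_\<Gamma> x(2) by (auto simp: compact_imp_closed \<Gamma>'_def Jx0)
    then obtain e1 where e1: "e1 > 0" "ball x0 e1 \<subseteq> - \<Gamma>'"
      by (metis Compl_iff open_Compl open_contains_ball)
    have "\<exists>e2>0. \<forall>z. norm (z - x0) < e2 \<longrightarrow> norm (F z - c) \<le> \<epsilon>"
    proof (cases "x \<in> Um")
      case True
      then have x0: "x0 \<in> Um'" by (simp add: Um'_def Jx0)
      have "isCont (\<lambda>z. f (J z)) x0"
        using continuous_on_subset [OF fJ_cont, of Um'] x0 open_Um by (auto simp: continuous_on_eq_continuous_at)
      then obtain e2 where e2: "e2 > 0" "\<And>z. norm (z - x0) < e2 \<Longrightarrow> norm (f (J z) - f (J x0)) < \<epsilon>"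
        using \<epsilon> unfolding continuous_at_eps_delta dist_norm by meson
      obtain e3 where e3: "e3 > 0" "ball x0 e3 \<subseteq> Um'"
        using x0 open_Um by (meson open_contains_ball)
      have "norm (F z - c) \<le> \<epsilon>" if "norm (z - x0) < min e2 e3" for z
      proof -
        have "z \<in> Um'"
          using that e3(2) by (auto simp: dist_norm norm_minus_commute subset_iff)
        then show ?thesis
          using e2(2) [of z] that True by (simp add: F_def c_def Jx0)
      qed
      then show ?thesis
        using e2(1) e3(1) by (intro exI [of _ "min e2 e3"]) auto
    next
      case False
      then have "x0 \<in> Up'"
        using partition x(2) by (auto simp: Um'_def \<Gamma>'_def Jx0 set_eq_iff)
      then obtain e2 where e2: "e2 > 0" "ball x0 e2 \<subseteq> Up'"
        using open_Up by (meson open_contains_ball)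
      have "norm (F z - c) \<le> \<epsilon>" if "norm (z - x0) < e2" for z
      proof -
        have "z \<in> Up'"
          using that e2(2) by (auto simp: dist_norm norm_minus_commute subset_iff)
        then have "z \<notin> Um'"
          using disjoint by blast
        then show ?thesis
          using False \<epsilon> by (simp add: F_def c_def)
      qed
      then show ?thesis
        using e2(1) by blast
    qed
    then obtain e2 where e2: "e2 > 0" "\<And>z. norm (z - x0) < e2 \<Longrightarrow> norm (F z - c) \<le> \<epsilon>"
      by blast
    have "norm (z - x0) \<ge> e1" if "z \<in> \<Gamma>'" for z
      using e1(2) that by (force simp: dist_norm norm_minus_commute)
    then show ?thesis
      using e1(1) e2 by (intro exI [of _ "min e1 e2"]) (auto simp: min_le_iff_disj)
  qed
  have outer_close: "\<exists>S>0. (\<forall>z. norm (z - x0) \<ge> S \<longrightarrow> norm (F z - f_inf) \<le> \<epsilon>) \<and> (\<forall>z\<in>\<Gamma>'. norm (z - x0) \<le> S)"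
    if \<epsilon>: "\<epsilon> > 0" for \<epsilon>
  proof -
    have "\<forall>\<^sub>F y in inf at_infinity (principal Um). dist (f y) f_inf < \<epsilon>"
      using limit \<epsilon> by (rule tendstoD)
    then obtain b where b: "\<And>y. y \<in> Um \<Longrightarrow> norm y \<ge> b \<Longrightarrow> dist (f y) f_inf < \<epsilon>"
      unfolding eventually_inf_principal eventually_at_infinity by blast
    have "bounded (Up \<union> \<Gamma>)"
      using jordan by (auto simp: jordan_surface_def compact_imp_bounded)
    then obtain b' where b': "\<And>y. y \<in> Up \<union> \<Gamma> \<Longrightarrow> norm y \<le> b'"
      unfolding bounded_iff by blast
    \<comment> \<open>Beyond this distance from \<open>x0\<close> a point has norm past the
      threshold \<open>b\<close> of the limit and past the bound \<open>b'\<close> of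
      \<open>Up \<union> \<Gamma>\<close>, hence lies in the exterior domain.\<close>
    define S where "S = \<bar>b\<bar> + \<bar>b'\<bar> + norm x0 + 1"
    have far: "norm (J z) \<ge> \<bar>b\<bar> + \<bar>b'\<bar> + 1" if "norm (z - x0) \<ge> S" for z
      using that norm_triangle_ineq4 [of z x0] by (simp add: J(2) S_def)
    have "norm (F z - f_inf) \<le> \<epsilon>" if "norm (z - x0) \<ge> S" for z
    proof -
      have "J z \<notin> Up \<union> \<Gamma>"
        using far [OF that] b' [of "J z"] by (intro notI) auto
      then have "z \<in> Um'"
        using partition by (auto simp: Up'_def Um'_def \<Gamma>'_def set_eq_iff)
      moreover have "norm (J z) \<ge> b"
        using far [OF that] by simp
      ultimately show ?thesis
        using b [of "J z"] by (simp add: F_def Um'_def dist_norm)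
    qed
    moreover have "norm (z - x0) \<le> S" if "z \<in> \<Gamma>'" for z
    proof -
      have "norm z \<le> b'"
        using b' [of "J z"] that by (simp add: \<Gamma>'_def J(2))
      then show ?thesis
        using norm_triangle_ineq4 [of z x0] by (simp add: S_def)
    qed
    moreover have "S > 0"
      by (simp add: S_def add_nonneg_pos)
    ultimately show ?thesis by blast
  qed
  define H where "H z = indicator \<Gamma>' z *\<^sub>R (cauchy_E p (J z - x) * n (J z) * f (J z))" for z
  have approx: "\<exists>I. has_bochner_integral \<mu>' (\<lambda>z. sphere_area p *\<^sub>R H z) I \<and>
      norm (I - sphere_area p *\<^sub>R (f_inf - c)) \<le> (2 * sphere_area p) * \<epsilon>" if \<epsilon>: "\<epsilon> > 0" for \<epsilon>
  proof -
    obtain e where e: "e > 0" "\<And>z. norm (z - x0) < e \<Longrightarrow> norm (F z - c) \<le> \<epsilon>" "\<And>z. z \<in> \<Gamma>' \<Longrightarrow> norm (z - x0) \<ge> e"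
      using inner_close [OF \<epsilon>] by blast
    obtain S where S: "S > 0" "\<And>z. norm (z - x0) \<ge> S \<Longrightarrow> norm (F z - f_inf) \<le> \<epsilon>" "\<And>z. z \<in> \<Gamma>' \<Longrightarrow> norm (z - x0) \<le> S"
      using outer_close [OF \<epsilon>] by blast
    \<comment> \<open>With a quarter, \<open>2 * a\<close> is below \<open>e ^ (p + 2)\<close>: the
      inner shell stays within radius \<open>e\<close>, and on \<Gamma>' the inner transition is
      complete. Likewise \<open>R\<close> is at least \<open>S ^ (p + 2)\<close>, so the outer
      transition starts beyond \<Gamma>'; the maximum with \<open>a\<close> secures
      \<open>a \<le> R\<close>.\<close>
    define a where "a = e ^ (p + 2) / 4"
    define R where "R = max a (S ^ (p + 2))"
    have a: "0 < a" "a \<le> R"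
      using e(1) by (simp_all add: a_def R_def)
    then have R: "0 < R"
      by linarith
    have near: "norm (F z - c) \<le> \<epsilon>" if "norm (z - x0) ^ (p + 2) \<le> 2 * a" for z
    proof -
      have "2 * a < e ^ (p + 2)"
        using e(1) by (simp add: a_def)
      with that have "norm (z - x0) ^ (p + 2) < e ^ (p + 2)"
        by (rule le_less_trans)
      then have "norm (z - x0) < e"
        by (rule power_less_imp_less_base) (use e(1) in simp)
      then show ?thesis by (rule e(2))
    qed
    have far: "norm (F z - f_inf) \<le> \<epsilon>" if "R \<le> norm (z - x0) ^ (p + 2)" for z
    proof -
      have "S ^ (p + 2) \<le> norm (z - x0) ^ (p + 2)"
        using that by (simp add: R_def)
      then have "S \<le> norm (z - x0)"
        using S(1) by (subst (asm) power_mono_iff) auto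
      then show ?thesis by (rule S(2))
    qed
    note Ia = shell_average [OF a(1) F_borel less_imp_le [OF \<epsilon>], of x0 c, unfolded DIM, OF near]
    note IR = shell_average [OF R F_borel less_imp_le [OF \<epsilon>], of x0 f_inf, unfolded DIM, OF far]
    let ?Ia = "\<integral>z. shell x0 a z *\<^sub>R F z \<partial>lborel" and ?IR = "\<integral>z. shell x0 R z *\<^sub>R F z \<partial>lborel"
    have "indicator \<Gamma>' z *\<^sub>R (truncated_kernel p a R (J z - x) * n (J z) * f (J z)) = sphere_area p *\<^sub>R H z" for z
    proof (cases "z \<in> \<Gamma>'")
      case True
      have "e ^ (p + 2) \<le> norm (z - x0) ^ (p + 2)" "norm (z - x0) ^ (p + 2) \<le> S ^ (p + 2)"
        using e(1,3) S(1,3) True by (auto intro!: power_mono simp del: power_Suc)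
      moreover have "2 * a \<le> e ^ (p + 2)" "S ^ (p + 2) \<le> R"
        using e(1) by (simp_all add: a_def R_def)
      ultimately have "2 * a \<le> norm (J z - x) ^ (p + 2)" "norm (J z - x) ^ (p + 2) \<le> R"
        unfolding norm_Jx by linarith+
      then have "truncated_kernel p a R (J z - x) = sphere_area p *\<^sub>R cauchy_E p (J z - x)"
        by (rule truncated_kernel_eq_cauchy [OF a(1)])
      then show ?thesis
        using True by (simp add: H_def)
    qed (simp add: H_def)
    then have "has_bochner_integral \<mu>' (\<lambda>z. sphere_area p *\<^sub>R H z) (d *\<^sub>R (?IR - ?Ia))"
      using truncated [OF a Ia(1) IR(1)] by simp
    moreover have "norm (d *\<^sub>R (?IR - ?Ia) - sphere_area p *\<^sub>R (f_inf - c)) \<le> (2 * sphere_area p) * \<epsilon>"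
    proof -
      have "d *\<^sub>R (?IR - ?Ia) - sphere_area p *\<^sub>R (f_inf - c) = d *\<^sub>R ((?IR - V *\<^sub>R f_inf) - (?Ia - V *\<^sub>R c))"
        by (simp add: \<sigma>(1) algebra_simps)
      then have "norm (d *\<^sub>R (?IR - ?Ia) - sphere_area p *\<^sub>R (f_inf - c)) =
          d * norm ((?IR - V *\<^sub>R f_inf) - (?Ia - V *\<^sub>R c))"
        using \<sigma>(2) by simp
      also have "norm ((?IR - V *\<^sub>R f_inf) - (?Ia - V *\<^sub>R c)) \<le> V * \<epsilon> + V * \<epsilon>"
        using norm_triangle_ineq4 [of "?IR - V *\<^sub>R f_inf" "?Ia - V *\<^sub>R c"] IR(2) Ia(2)
        unfolding V_def DIM by linarith
      finally show ?thesis
        using \<sigma> by (simp add: algebra_simps)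
    qed
    ultimately show ?thesis by blast
  qed
  have "has_bochner_integral \<mu>' (\<lambda>z. sphere_area p *\<^sub>R H z) (sphere_area p *\<^sub>R (f_inf - c))"
  proof -
    obtain I where I: "has_bochner_integral \<mu>' (\<lambda>z. sphere_area p *\<^sub>R H z) I"
      using approx [of 1] by auto
    \<comment> \<open>Truncation has disappeared from the integrand, so uniqueness of the integral
      makes the values obtained for all \<epsilon> equal to the same \<open>I\<close>.\<close>
    have "I = sphere_area p *\<^sub>R (f_inf - c)"
    proof (rule eq_if_norm_diff_le)
      show "2 * sphere_area p > 0"
        using \<sigma> by simp
      fix \<epsilon> :: real assume "\<epsilon> > 0"
      then show "norm (I - sphere_area p *\<^sub>R (f_inf - c)) \<le> (2 * sphere_area p) * \<epsilon>"
        using approx [of \<epsilon>] has_bochner_integral_eq [OF I] by metis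
    qed
    with I show ?thesis by simp
  qed
  then have "has_bochner_integral \<mu>' (\<lambda>z. (1 / sphere_area p) *\<^sub>R (sphere_area p *\<^sub>R H z))
      ((1 / sphere_area p) *\<^sub>R (sphere_area p *\<^sub>R (f_inf - c)))"
    by (rule has_bochner_integral_scaleR_right)
  then have H: "has_bochner_integral \<mu>' H (f_inf - c)"
    using \<sigma> by simp
  have sets_\<mu>: "sets \<mu> = sets borel" and null: "emeasure \<mu> (- \<Gamma>) = 0"
    using \<mu> by (auto simp: is_surface_measure_def)
  have G_meas: "G \<in> measurable \<mu> borel"
    using borel_measurable_continuous_onI [of G] G
    by (simp add: measurable_cong_sets [OF sets_\<mu> refl] linear_continuous_on linear_linear)
  have H_borel: "H \<in> borel_measurable borel"
    using H by (auto simp: \<mu>'_def has_bochner_integral_iff dest: borel_measurable_integrable)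
  have HG: "has_bochner_integral \<mu> (\<lambda>y. H (G y)) (f_inf - c)"
    using H integrable_distr_eq [OF G_meas H_borel] integral_distr [OF G_meas H_borel]
    by (simp add: \<mu>'_def has_bochner_integral_iff)
  have \<Gamma>_slice: "\<Gamma> \<subseteq> slice p \<eta>" and "compact \<Gamma>"
    using jordan by (auto simp: jordan_surface_def)
  then have \<Gamma>_sets: "\<Gamma> \<in> sets \<mu>"
    by (simp add: sets_\<mu> borel_compact)
  have eq: "indicator \<Gamma> y *\<^sub>R (gps_kernel p q \<eta> y x * n y * f y) = indicator \<Gamma> y *\<^sub>R H (G y)" for y
  proof (cases "y \<in> \<Gamma>")
    case True
    then have "J (G y) = y"
      using JG \<Gamma>_slice by blast
    then show ?thesis
      using True by (simp add: H_def \<Gamma>'_def gps_kernel_eq_cauchy [OF x(1)])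
  qed simp
  \<comment> \<open>\<open>H \<circ> G\<close> can be nonzero off \<Gamma>, because \<open>G\<close>
    inverts \<open>J\<close> only on the slice; such points form a null set, so the indicator may be
    inserted.\<close>
  have "AE y in \<mu>. y \<in> \<Gamma>"
    using null \<Gamma>_sets by (intro AE_I' [of "- \<Gamma>"]) (auto simp: null_sets_def sets_\<mu>)
  then have "AE y in \<mu>. H (G y) = indicator \<Gamma> y *\<^sub>R H (G y)"
    by eventually_elim simp
  moreover have "(\<lambda>y. H (G y)) \<in> borel_measurable \<mu>"
    using HG by (auto simp: has_bochner_integral_iff)
  moreover have "(\<lambda>y. indicator \<Gamma> y *\<^sub>R H (G y)) \<in> borel_measurable \<mu>"
    using calculation(2) \<Gamma>_sets by measurable
  ultimately have "has_bochner_integral \<mu> (\<lambda>y. indicator \<Gamma> y *\<^sub>R H (G y)) (f_inf - c)"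
    using HG has_bochner_integral_cong_AE by blast
  then show ?thesis
    unfolding eq c_def .
qed

end

theorem theorem3p7:
  fixes p q :: nat
    and \<eta> f_inf :: "'n::{finite,linorder} clifford"
    and \<Gamma> Up Um :: "'n clifford set"
    and f n :: "'n clifford \<Rightarrow> 'n clifford"
  assumes "q \<ge> 1"
    and "CARD('n) = p + q"
    and "CARD('m::finite) = p + 1"
    and "\<eta> \<in> unit_sphere p q"
    and "jordan_surface TYPE('m) (slice p \<eta>) \<Gamma> Up Um"
    and "\<forall>y\<in>\<Gamma>. unit_normal_towards (slice p \<eta>) \<Gamma> Um y (n y)"
    and "gps_monogenic_on p \<eta> Um f"
    and "C1_on (Um \<union> \<Gamma>) f"
    and "(f \<longlongrightarrow> f_inf) (inf at_infinity (principal Um))"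
  shows "(\<forall>x\<in>Um. has_bochner_integral (surface_measure TYPE('m) \<Gamma>)
             (\<lambda>y. indicator \<Gamma> y *\<^sub>R (gps_kernel p q \<eta> y x * n y * f y)) (- f x + f_inf)) \<and>
         (\<forall>x\<in>Up. has_bochner_integral (surface_measure TYPE('m) \<Gamma>)
             (\<lambda>y. indicator \<Gamma> y *\<^sub>R (gps_kernel p q \<eta> y x * n y * f y)) f_inf)"
proof -
  interpret slice_frame p q \<eta>
    using assms(2,4) by unfold_locales
  have \<Gamma>: "compact \<Gamma>" "C1_surface TYPE('m) \<Gamma>" and U: "Up \<inter> Um = {}" "Up \<union> Um = slice p \<eta> - \<Gamma>"
    using assms(5) by (auto simp: jordan_surface_def)
  have cauchy: "has_bochner_integral (surface_measure TYPE('m) \<Gamma>)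
      (\<lambda>y. indicator \<Gamma> y *\<^sub>R (gps_kernel p q \<eta> y x * n y * f y)) (f_inf - (if x \<in> Um then f x else 0))"
    if "x \<in> Up \<union> Um" for x
    using that U(2) assms(6)
    by (intro cauchy_integral_exterior [OF assms(3,5) _ is_surface_measure_surface_measure [OF \<Gamma>] assms(7-9)]) auto
  show ?thesis
  proof (intro conjI ballI)
    show "has_bochner_integral (surface_measure TYPE('m) \<Gamma>)
        (\<lambda>y. indicator \<Gamma> y *\<^sub>R (gps_kernel p q \<eta> y x * n y * f y)) (- f x + f_inf)" if "x \<in> Um" for x
      using cauchy [of x] that by simp
    show "has_bochner_integral (surface_measure TYPE('m) \<Gamma>)
        (\<lambda>y. indicator \<Gamma> y *\<^sub>R (gps_kernel p q \<eta> y x * n y * f y)) f_inf" if "x \<in> Up" for x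
    proof -
      have "x \<notin> Um" using that U(1) by blast
      then show ?thesis using cauchy [of x] that by simp
    qed
  qed
qed

end
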